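(* Let $G$ be a periodic soluble group. Then the following are equivalent: (i) $G$ satisfies the weak minimal condition on non-subnormal subgroups; (ii) $G$ satisfies the weak maximal condition on non-subnormal subgroups; (iii) $G$ satisfies the weak double chain condition on non-subnormal subgroups; (iv) $G$ satisfies the real chain condition on non-subnormal subgroups; (v) either $G$ is a Chernikov group or all subgroups of $G$ are subnormal.
   Context: Let $P$ be a set of subgroups of $G$ ordered by inclusion. A chain in $P$ is a totally ordered subset. $P$ has the weak maximal (resp. weak minimal, weak double chain) condition if $P$ contains no chain of order type $\mathbb{N}$ (resp. the negative integers $-\mathbb{N}$, resp. $\mathbb{Z}$) in which each subgroup has infinite index in its immediate successor. $P$ has the real chain condition if it contains no chain order isomorphic to $\mathbb{R}$ with its usual ordering. For a subgroup property $\chi$, $G$ satisfies one of these conditions on non-$\chi$ subgroups if the poset of all subgroups of $G$ that do not have $\chi$ satisfies it. A Chernikov group is a group with an abelian normal subgroup of finite index satisfying the minimal condition on subgroups. *)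

theory Defs
  imports Complex_Main "HOL-Algebra.Algebra"
begin

definition periodic_group :: "('a, 'b) monoid_scheme \<Rightarrow> bool" where
  "periodic_group G \<longleftrightarrow> (\<forall>x\<in>carrier G. \<exists>n::nat. n > 0 \<and> x [^]\<^bsub>G\<^esub> n = \<one>\<^bsub>G\<^esub>)"

definition subnormal :: "'a set \<Rightarrow> ('a, 'b) monoid_scheme \<Rightarrow> bool" where
  "subnormal H G \<longleftrightarrow>
     (\<exists>(n::nat) K. K 0 = H \<and> K n = carrier G \<and>
        (\<forall>i\<le>n. subgroup (K i) G) \<and>
        (\<forall>i<n. K i \<lhd> G\<lparr>carrier := K (Suc i)\<rparr>))"

definition non_subnormal_subgroups :: "('a, 'b) monoid_scheme \<Rightarrow> 'a set set" where
  "non_subnormal_subgroups G = {H. subgroup H G \<and> \<not> subnormal H G}"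

definition infinite_index :: "('a, 'b) monoid_scheme \<Rightarrow> 'a set \<Rightarrow> 'a set \<Rightarrow> bool" where
  "infinite_index G H K \<longleftrightarrow> infinite (rcosets\<^bsub>G\<lparr>carrier := K\<rparr>\<^esub> H)"

text \<open>A strictly monotone map from a linear order is an isomorphism onto its range, so a chain
  of a given order type is given by an enumeration along that order. A chain of the order type of
  the negative integers is enumerated downwards by the natural numbers.\<close>

definition weak_maximal_condition :: "('a, 'b) monoid_scheme \<Rightarrow> 'a set set \<Rightarrow> bool" where
  "weak_maximal_condition G P \<longleftrightarrow>
     \<not> (\<exists>H :: nat \<Rightarrow> 'a set. range H \<subseteq> P \<and> strict_mono H \<and>
          (\<forall>n. infinite_index G (H n) (H (Suc n))))"

definition weak_minimal_condition :: "('a, 'b) monoid_scheme \<Rightarrow> 'a set set \<Rightarrow> bool" where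
  "weak_minimal_condition G P \<longleftrightarrow>
     \<not> (\<exists>H :: nat \<Rightarrow> 'a set. range H \<subseteq> P \<and> monotone (<) (>) H \<and>
          (\<forall>n. infinite_index G (H (Suc n)) (H n)))"

definition weak_double_chain_condition :: "('a, 'b) monoid_scheme \<Rightarrow> 'a set set \<Rightarrow> bool" where
  "weak_double_chain_condition G P \<longleftrightarrow>
     \<not> (\<exists>H :: int \<Rightarrow> 'a set. range H \<subseteq> P \<and> strict_mono H \<and>
          (\<forall>k. infinite_index G (H k) (H (k + 1))))"

definition real_chain_condition :: "'a set set \<Rightarrow> bool" where
  "real_chain_condition P \<longleftrightarrow> \<not> (\<exists>H :: real \<Rightarrow> 'a set. range H \<subseteq> P \<and> strict_mono H)"

definition min_on_subgroups :: "('a, 'b) monoid_scheme \<Rightarrow> bool" where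
  "min_on_subgroups G \<longleftrightarrow>
     \<not> (\<exists>H :: nat \<Rightarrow> 'a set. (\<forall>n. subgroup (H n) G) \<and> monotone (<) (>) H)"

definition chernikov_group :: "('a, 'b) monoid_scheme \<Rightarrow> bool" where
  "chernikov_group G \<longleftrightarrow>
     (\<exists>A. A \<lhd> G \<and> comm_group (G\<lparr>carrier := A\<rparr>) \<and> finite (rcosets\<^bsub>G\<^esub> A) \<and>
          min_on_subgroups (G\<lparr>carrier := A\<rparr>))"

end

theory Submission
  imports Defs
begin

text \<open>
  Only the step from the real chain condition to the structural alternative is hard; every other
  condition implies it, because only finitely many subgroups lie above one of finite index. Real chains are produced from independent families: if \<open>Y\<close> normalises independent subgroups
  \<open>A\<^sub>0, A\<^sub>1, \<dots>\<close> that are also independent of \<open>Y\<close>, then products of \<open>Y\<close> over disjoint index sets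
  intersect in \<open>Y\<close>, and the real chain condition forces \<open>Y\<close> to be subnormal; dually for a subgroup
  with an infinite elementary abelian quotient, using joins.

  Let \<open>G\<close> be periodic and soluble without the minimal condition. Every finite subgroup \<open>Y\<close> normalises
  an abelian subgroup with infinite socle, which is found by climbing the derived series;
  hence cyclic subgroups are subnormal. Climbing the derived series again reduces the subnormality
  of an arbitrary subgroup to that of \<open>Y\<close> in \<open>YV\<close>, where \<open>V\<close> is an abelian \<open>p\<close>-group on which \<open>Y\<close> acts
  through an abelian quotient. If \<open>Y\<close> is not subnormal, that quotient contains, up to finite index,
  a \<open>p\<close>-divisible subgroup \<open>D\<close> acting non-trivially on the elements of order \<open>p\<close>. Since
  \<open>y\<^sup>p - 1\<close> is a multiple of \<open>(y - 1)\<^sup>2\<close> in characteristic \<open>p\<close>, the \<open>D\<close>-invariant subgroups with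
  non-trivial action between them are densely ordered, and unions of such subgroups give a real chain.

  A periodic soluble group with the minimal condition is Chernikov, again by climbing the derived
  series: torsion automorphisms of an abelian group with the minimal condition are determined by their
  action on finitely many elements.
\<close>

section \<open>Subnormality, normalisers and quotients\<close>

text \<open>The real chain condition gives little at a time: from a chain it supplies a single
  subnormal member, at an unknown position. Two chains are therefore run over disjoint index sets,
  so that an arbitrary member of one and an arbitrary member of the other intersect in, or generate,
  the subgroup under study. Intersections of subnormal subgroups are always subnormal; for joins,
  one factor is arranged to normalise the other.

  The obstacle is a \<open>p\<close>-divisible group \<open>D\<close> acting on an elementary
  abelian section. As cyclic subgroups are subnormal, each element acts unipotently, but with a
  bound that depends on the element. Divisibility, on the other hand, forces an action with a common
  bound to be trivial. Hence every non-trivial action can be refined, which gives the dense order,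
  and the members of the resulting chain cannot be subnormal.

  The descent passes through quotients repeatedly, and each one changes the type of the elements.
  The arguments are therefore carried out with subsets of one group and moved across epimorphisms
  defined on a subgroup.\<close>

context group
begin

lemma inv_mult_cancel [simp]:
  assumes "x \<in> carrier G" "y \<in> carrier G"
  shows "inv x \<otimes> (x \<otimes> y) = y" "x \<otimes> (inv x \<otimes> y) = y"
  using assms by (simp_all add: m_assoc[symmetric])

definition conjg :: "'a \<Rightarrow> 'a \<Rightarrow> 'a" where
  "conjg x a = x \<otimes> a \<otimes> inv x"

lemma conjg_closed [simp, intro]: "x \<in> carrier G \<Longrightarrow> a \<in> carrier G \<Longrightarrow> conjg x a \<in> carrier G"
  by (simp add: conjg_def)

lemma conjg_mult: "x \<in> carrier G \<Longrightarrow> a \<in> carrier G \<Longrightarrow> b \<in> carrier G \<Longrightarrow> conjg x (a \<otimes> b) = conjg x a \<otimes> conjg x b"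
  by (simp add: conjg_def m_assoc)

lemma conjg_inv: "x \<in> carrier G \<Longrightarrow> a \<in> carrier G \<Longrightarrow> conjg x (inv a) = inv (conjg x a)"
  by (simp add: conjg_def m_assoc inv_mult_group)

lemma conjg_conjg: "x \<in> carrier G \<Longrightarrow> y \<in> carrier G \<Longrightarrow> a \<in> carrier G \<Longrightarrow> conjg x (conjg y a) = conjg (x \<otimes> y) a"
  by (simp add: conjg_def m_assoc inv_mult_group)

lemma conjg_one [simp]: "x \<in> carrier G \<Longrightarrow> conjg x \<one> = \<one>"
  by (simp add: conjg_def)

lemma one_conjg [simp]: "a \<in> carrier G \<Longrightarrow> conjg \<one> a = a"
  by (simp add: conjg_def)

lemma conjg_inv_conjg [simp]:
  "x \<in> carrier G \<Longrightarrow> a \<in> carrier G \<Longrightarrow> conjg (inv x) (conjg x a) = a"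
  "x \<in> carrier G \<Longrightarrow> a \<in> carrier G \<Longrightarrow> conjg x (conjg (inv x) a) = a"
  by (simp_all add: conjg_conjg)

lemma conjg_pow: "x \<in> carrier G \<Longrightarrow> a \<in> carrier G \<Longrightarrow> conjg x (a [^] (n::nat)) = conjg x a [^] n"
  by (induction n) (simp_all add: conjg_mult)

lemma conjg_eq_self_iff: "x \<in> carrier G \<Longrightarrow> a \<in> carrier G \<Longrightarrow> conjg x a = a \<longleftrightarrow> x \<otimes> a = a \<otimes> x"
  by (metis conjg_def inv_solve_right' m_closed)

lemma conjg_fix_sym: "x \<in> carrier G \<Longrightarrow> a \<in> carrier G \<Longrightarrow> conjg x a = a \<longleftrightarrow> conjg a x = x"
  by (auto simp: conjg_eq_self_iff)

definition normalizes :: "'a set \<Rightarrow> 'a set \<Rightarrow> bool" where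
  "normalizes Y A \<longleftrightarrow> (\<forall>x\<in>Y. \<forall>a\<in>A. conjg x a \<in> A)"

lemma normalizesD: "normalizes Y A \<Longrightarrow> x \<in> Y \<Longrightarrow> a \<in> A \<Longrightarrow> conjg x a \<in> A"
  by (simp add: normalizes_def)

lemma normalizesI: "(\<And>x a. x \<in> Y \<Longrightarrow> a \<in> A \<Longrightarrow> conjg x a \<in> A) \<Longrightarrow> normalizes Y A"
  by (simp add: normalizes_def)

lemma normalizes_mono: "normalizes Y A \<Longrightarrow> Z \<subseteq> Y \<Longrightarrow> normalizes Z A"
  by (auto simp: normalizes_def)

lemma normalizes_Int: "normalizes Y A \<Longrightarrow> normalizes Y B \<Longrightarrow> normalizes Y (A \<inter> B)"
  by (auto simp: normalizes_def)

lemma mem_carrier_of: "subgroup H G \<Longrightarrow> x \<in> H \<Longrightarrow> x \<in> carrier G"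
  by (rule subgroup.mem_carrier)

lemma sub_mult: "subgroup H G \<Longrightarrow> x \<in> H \<Longrightarrow> y \<in> H \<Longrightarrow> x \<otimes> y \<in> H"
  by (rule subgroup.m_closed)

lemma sub_inv: "subgroup H G \<Longrightarrow> x \<in> H \<Longrightarrow> inv x \<in> H"
  by (rule subgroup.m_inv_closed)

lemma sub_one: "subgroup H G \<Longrightarrow> \<one> \<in> H"
  by (rule subgroup.one_closed)

lemma sub_pow: "subgroup H G \<Longrightarrow> x \<in> H \<Longrightarrow> x [^] (n::nat) \<in> H"
  by (induction n) (simp_all add: sub_one sub_mult)

lemma sub_conjg: "subgroup H G \<Longrightarrow> x \<in> H \<Longrightarrow> y \<in> H \<Longrightarrow> conjg x y \<in> H"
  by (simp add: conjg_def sub_mult sub_inv)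

lemma sub_carrier: "subgroup H G \<Longrightarrow> H \<subseteq> carrier G"
  by (rule subgroup.subset)

lemma normalizes_self: "subgroup H G \<Longrightarrow> normalizes H H"
  by (simp add: normalizes_def sub_conjg)

lemma sg_mult_left_iff: "subgroup H G \<Longrightarrow> x \<in> H \<Longrightarrow> y \<in> carrier G \<Longrightarrow> x \<otimes> y \<in> H \<longleftrightarrow> y \<in> H"
  by (metis inv_mult_cancel(1) mem_carrier_of sub_inv sub_mult)

lemma sg_mult_right_iff: "subgroup H G \<Longrightarrow> y \<in> H \<Longrightarrow> x \<in> carrier G \<Longrightarrow> x \<otimes> y \<in> H \<longleftrightarrow> x \<in> H"
  by (metis inv_solve_right mem_carrier_of sub_inv sub_mult)

lemma subgroup_criterion:
  assumes "H \<subseteq> carrier G" "\<one> \<in> H" "\<And>x. x \<in> H \<Longrightarrow> inv x \<in> H"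
    "\<And>x y. x \<in> H \<Longrightarrow> y \<in> H \<Longrightarrow> x \<otimes> y \<in> H"
  shows "subgroup H G"
  using assms by (intro subgroupI) auto

lemma set_multI: "x \<in> A \<Longrightarrow> y \<in> B \<Longrightarrow> x \<otimes> y \<in> A <#> B"
  by (auto simp: set_mult_def)

lemma set_multE:
  assumes "z \<in> A <#> B" obtains x y where "x \<in> A" "y \<in> B" "z = x \<otimes> y"
  using assms by (auto simp: set_mult_def)

lemma set_mult_ge1: "subgroup B G \<Longrightarrow> A \<subseteq> carrier G \<Longrightarrow> A \<subseteq> A <#> B"
  using set_multI[of _ A \<one> B] by (auto simp: sub_one subset_iff)

lemma set_mult_ge2: "subgroup A G \<Longrightarrow> B \<subseteq> carrier G \<Longrightarrow> B \<subseteq> A <#> B"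
  using set_multI[of \<one> A _ B] by (auto simp: sub_one subset_iff)

lemma set_mult_le: "subgroup C G \<Longrightarrow> A \<subseteq> C \<Longrightarrow> B \<subseteq> C \<Longrightarrow> A <#> B \<subseteq> C"
  by (auto simp: set_mult_def sub_mult subset_iff)

lemma subgroup_set_mult:
  assumes Y: "subgroup Y G" and A: "subgroup A G" and normalizes: "normalizes Y A"
  shows "subgroup (Y <#> A) G"
proof (rule subgroup_criterion)
  show "Y <#> A \<subseteq> carrier G" using Y A by (auto simp: set_mult_def mem_carrier_of)
  show "\<one> \<in> Y <#> A" using set_multI[OF sub_one[OF Y] sub_one[OF A]] by simp
next
  fix z assume "z \<in> Y <#> A"
  then obtain x a where xa: "x \<in> Y" "a \<in> A" "z = x \<otimes> a" by (rule set_multE)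
  have c: "x \<in> carrier G" "a \<in> carrier G" using xa Y A by (auto simp: mem_carrier_of)
  have "inv z = inv x \<otimes> conjg x (inv a)" using c xa by (simp add: conjg_def m_assoc inv_mult_group)
  then show "inv z \<in> Y <#> A" using xa normalizes Y A by (auto intro!: set_multI simp: sub_inv normalizesD)
next
  fix z w assume "z \<in> Y <#> A" "w \<in> Y <#> A"
  then obtain x a y b where xa: "x \<in> Y" "a \<in> A" "z = x \<otimes> a" "y \<in> Y" "b \<in> A" "w = y \<otimes> b"
    by (metis set_multE)
  have c: "x \<in> carrier G" "a \<in> carrier G" "y \<in> carrier G" "b \<in> carrier G" using xa Y A by (auto simp: mem_carrier_of)
  have "z \<otimes> w = (x \<otimes> y) \<otimes> (conjg (inv y) a \<otimes> b)" using c xa by (simp add: conjg_def m_assoc)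
  then show "z \<otimes> w \<in> Y <#> A" using xa normalizes Y A by (auto intro!: set_multI simp: sub_inv sub_mult normalizesD)
qed

definition normal_in :: "'a set \<Rightarrow> 'a set \<Rightarrow> bool" where
  "normal_in H K \<longleftrightarrow> subgroup H G \<and> subgroup K G \<and> H \<subseteq> K \<and> normalizes K H"

text \<open>The reflexive transitive closure replaces an indexed series, so that induction can run
  from either end. The clause on \<open>H\<close> matters for the empty series, about which
  \<open>normal_in\<close> asserts nothing.\<close>

definition subnormal_in :: "'a set \<Rightarrow> 'a set \<Rightarrow> bool" where
  "subnormal_in H K \<longleftrightarrow> subgroup H G \<and> normal_in\<^sup>*\<^sup>* H K"

lemma normal_in_rtranclp_subset: "normal_in\<^sup>*\<^sup>* H K \<Longrightarrow> H \<subseteq> K"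
  by (induction rule: rtranclp_induct) (auto simp: normal_in_def)

lemma normal_in_rtranclp_subgroup: "normal_in\<^sup>*\<^sup>* H K \<Longrightarrow> subgroup H G \<Longrightarrow> subgroup K G"
  by (induction rule: rtranclp_induct) (auto simp: normal_in_def)

lemma subnormal_in_subset: "subnormal_in H K \<Longrightarrow> H \<subseteq> K"
  and subnormal_in_subgroup1: "subnormal_in H K \<Longrightarrow> subgroup H G"
  and subnormal_in_subgroup2: "subnormal_in H K \<Longrightarrow> subgroup K G"
  by (auto simp: subnormal_in_def dest: normal_in_rtranclp_subset normal_in_rtranclp_subgroup)

lemma subnormal_in_refl: "subgroup H G \<Longrightarrow> subnormal_in H H"
  by (simp add: subnormal_in_def)

lemma subnormal_in_trans [trans]: "subnormal_in H K \<Longrightarrow> subnormal_in K L \<Longrightarrow> subnormal_in H L"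
  by (auto simp: subnormal_in_def)

lemma normal_in_imp_subnormal_in: "normal_in H K \<Longrightarrow> subnormal_in H K"
  by (auto simp: subnormal_in_def normal_in_def)

lemma subnormal_in_normal_in_trans: "subnormal_in H K \<Longrightarrow> normal_in K L \<Longrightarrow> subnormal_in H L"
  using normal_in_imp_subnormal_in subnormal_in_trans by blast

lemma normal_inI: "subgroup H G \<Longrightarrow> subgroup K G \<Longrightarrow> H \<subseteq> K \<Longrightarrow> normalizes K H \<Longrightarrow> normal_in H K"
  by (simp add: normal_in_def)

lemma subnormal_in_induct [consumes 1, case_names refl step]:
  assumes "subnormal_in H K" and "subgroup H G \<Longrightarrow> P H"
    and "\<And>L M. subnormal_in H L \<Longrightarrow> normal_in L M \<Longrightarrow> P L \<Longrightarrow> P M"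
  shows "P K"
proof -
  have H: "subgroup H G" and "normal_in\<^sup>*\<^sup>* H K" using assms(1) by (auto simp: subnormal_in_def)
  from this(2) show ?thesis
    by (induction rule: rtranclp_induct) (use H assms(2,3) in \<open>auto simp: subnormal_in_def\<close>)
qed

lemma subnormal_in_converse_induct [consumes 1, case_names refl step]:
  assumes "subnormal_in H K" and "P K"
    and "\<And>L M. normal_in L M \<Longrightarrow> subnormal_in M K \<Longrightarrow> P M \<Longrightarrow> P L"
  shows "P H"
proof -
  have H: "subgroup H G" and "normal_in\<^sup>*\<^sup>* H K" using assms(1) by (auto simp: subnormal_in_def)
  from this(2) show ?thesis
  proof (induction rule: converse_rtranclp_induct)
    case base then show ?case using assms by auto
  next
    case (step L M)
    then show ?case using assms(3)[of L M] by (auto simp: subnormal_in_def normal_in_def)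
  qed
qed

lemma subnormal_in_inter: "subnormal_in H K \<Longrightarrow> subgroup L G \<Longrightarrow> subnormal_in (H \<inter> L) (K \<inter> L)"
proof (induction rule: subnormal_in_induct)
  case refl then show ?case by (simp add: subnormal_in_refl subgroup_Int)
next
  case (step M N)
  have "normal_in (M \<inter> L) (N \<inter> L)"
    using step.hyps(2) step.prems unfolding normal_in_def normalizes_def
    by (auto simp: subgroup_Int sub_conjg)
  then show ?case using step subnormal_in_normal_in_trans by blast
qed

lemma subnormal_in_restrict: "subnormal_in H K \<Longrightarrow> subgroup L G \<Longrightarrow> H \<subseteq> L \<Longrightarrow> L \<subseteq> K \<Longrightarrow> subnormal_in H L"
  using subnormal_in_inter[of H K L] by (metis inf.absorb1 inf.absorb_iff2)

lemma subnormal_in_Int: "subnormal_in H K \<Longrightarrow> subnormal_in L K \<Longrightarrow> subnormal_in (H \<inter> L) K"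
  using subnormal_in_inter[of H K L] subnormal_in_trans subnormal_in_subgroup1 subnormal_in_subset by (metis inf.absorb_iff2)

text \<open>Multiplying every term of a series from \<open>H\<close> to \<open>K\<close> by
  \<open>M\<close> gives a series again, and it still ends in \<open>K\<close> because
  \<open>M\<close> lies in \<open>K\<close>.\<close>

lemma subnormal_in_mult_normal:
  assumes "subnormal_in H K" "normal_in M K" shows "subnormal_in (H <#> M) K"
proof -
  have M: "subgroup M G" "M \<subseteq> K" "normalizes K M" and K: "subgroup K G" using assms by (auto simp: normal_in_def)
  have *: "normal_in (H1 <#> M) (H2 <#> M)" if h: "normal_in H1 H2" "H2 \<subseteq> K" for H1 H2
  proof (rule normal_inI)
    have h1: "subgroup H1 G" "subgroup H2 G" "H1 \<subseteq> H2" "normalizes H2 H1" using h by (auto simp: normal_in_def)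
    have normalizes: "normalizes H1 M" "normalizes H2 M" using h h1 M normalizes_mono by blast+
    show "subgroup (H1 <#> M) G" "subgroup (H2 <#> M) G" using subgroup_set_mult h1 M normalizes by auto
    show "H1 <#> M \<subseteq> H2 <#> M" using h1 by (auto simp: set_mult_def)
    show "normalizes (H2 <#> M) (H1 <#> M)"
    proof (rule normalizesI)
      fix z w assume "z \<in> H2 <#> M" "w \<in> H1 <#> M"
      then obtain x m y n where z: "x \<in> H2" "m \<in> M" "z = x \<otimes> m" "y \<in> H1" "n \<in> M" "w = y \<otimes> n"
        by (metis set_multE)
      have c: "x \<in> carrier G" "m \<in> carrier G" "y \<in> carrier G" "n \<in> carrier G"
        using z h1 M by (auto simp: mem_carrier_of)
      \<comment> \<open>Moving \<open>m\<close> past \<open>y\<close> costs only a conjugate of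
        \<open>m\<close>, so everything after \<open>conjg x y\<close> comes from
        \<open>M\<close>.\<close>
      have "conjg z w = conjg x y \<otimes> conjg x (conjg (inv y) m \<otimes> n \<otimes> inv m)"
        using c by (simp add: z conjg_def m_assoc inv_mult_group)
      moreover have "inv y \<in> H2" using z h1 by (auto simp: sub_inv)
      ultimately show "conjg z w \<in> H1 <#> M"
        using z h1 M normalizes by (auto intro!: set_multI intro: normalizesD simp: sub_inv sub_mult normalizesD)
    qed
  qed
  have "subnormal_in (L <#> M) (K <#> M) \<and> L \<subseteq> K" if "subnormal_in L K" for L
    using that
  proof (induction rule: subnormal_in_converse_induct)
    case refl
    then show ?case using subgroup_set_mult[OF K M(1,3)] by (simp add: subnormal_in_refl)
  next
    case (step L1 L2)
    then have "L2 \<subseteq> K" "subnormal_in (L2 <#> M) (K <#> M)" by auto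
    moreover have "normal_in (L1 <#> M) (L2 <#> M)" using *[of L1 L2] step(1) calculation by auto
    ultimately show ?case using normal_in_imp_subnormal_in subnormal_in_trans step(1) unfolding normal_in_def by blast
  qed
  moreover have "K <#> M = K" using set_mult_le[OF K subset_refl M(2)] set_mult_ge1[OF M(1) sub_carrier[OF K]] by blast
  ultimately show ?thesis using assms by auto
qed

text \<open>For a subgroup \<open>Y\<close> this is the intersection of the conjugates of
  \<open>S\<close> under \<open>Y\<close>, the largest \<open>Y\<close>-invariant subset of
  \<open>S\<close>.\<close>

definition conj_core :: "'a set \<Rightarrow> 'a set \<Rightarrow> 'a set" where
  "conj_core Y S = {g \<in> S. \<forall>x\<in>Y. conjg x g \<in> S}"

lemma conj_core_subset: "conj_core Y S \<subseteq> S" by (auto simp: conj_core_def)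

lemma conj_core_id: "normalizes Y S \<Longrightarrow> conj_core Y S = S" by (auto simp: conj_core_def normalizes_def)

lemma conj_core_subgroup: "subgroup Y G \<Longrightarrow> subgroup S G \<Longrightarrow> subgroup (conj_core Y S) G"
  by (rule subgroup_criterion) (auto simp: conj_core_def mem_carrier_of sub_one sub_inv sub_mult conjg_mult conjg_inv)

lemma normalizes_conj_core: "subgroup Y G \<Longrightarrow> subgroup S G \<Longrightarrow> normalizes Y (conj_core Y S)"
  by (rule normalizesI) (auto simp: conj_core_def mem_carrier_of sub_mult conjg_conjg)

lemma normal_in_conj_core:
  assumes "subgroup Y G" "normal_in S T" shows "normal_in (conj_core Y S) (conj_core Y T)"
proof (rule normal_inI)
  have ST: "subgroup S G" "subgroup T G" "S \<subseteq> T" "normalizes T S" using assms by (auto simp: normal_in_def)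
  show "subgroup (conj_core Y S) G" "subgroup (conj_core Y T) G" using assms ST conj_core_subgroup by auto
  show "conj_core Y S \<subseteq> conj_core Y T" using ST by (auto simp: conj_core_def)
  show "normalizes (conj_core Y T) (conj_core Y S)"
  proof (rule normalizesI)
    fix t s assume t: "t \<in> conj_core Y T" and s: "s \<in> conj_core Y S"
    have c: "t \<in> carrier G" "s \<in> carrier G" using t s ST by (auto simp: conj_core_def mem_carrier_of)
    have "conjg x (conjg t s) = conjg (conjg x t) (conjg x s)" if "x \<in> Y" for x
      using c that mem_carrier_of[OF assms(1)] by (simp add: conjg_def m_assoc inv_mult_group)
    then show "conjg t s \<in> conj_core Y S" using t s ST unfolding conj_core_def by (auto simp: normalizesD)
  qed
qed

text \<open>A series from \<open>L\<close> to \<open>K\<close> need not be invariant under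
  \<open>H\<close>, but the cores of its terms are, and they are still successively normal. If
  \<open>T\<close> follows \<open>S\<close> in the series, the core of \<open>S\<close> is normal in
  the product of \<open>H\<close> with the core of \<open>T\<close>, in which \<open>H\<close> is
  subnormal, so \<open>subnormal_in_mult_normal\<close> applies at every step. Both ends of the
  series are their own cores.\<close>

lemma subnormal_in_join:
  assumes H: "subnormal_in H K" and L: "subnormal_in L K" and normalizes: "normalizes H L"
  shows "subnormal_in (H <#> L) K"
proof -
  have Hs: "subgroup H G" "H \<subseteq> K" and Ks: "subgroup K G"
    using H subnormal_in_subset subnormal_in_subgroup1 subnormal_in_subgroup2 by auto
  have sg: "subgroup (H <#> conj_core H S) G" if "subgroup S G" for S
    using subgroup_set_mult conj_core_subgroup normalizes_conj_core Hs that by auto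
  have "subnormal_in (H <#> conj_core H S) (H <#> conj_core H K)" if "subnormal_in S K" for S
    using that
  proof (induction rule: subnormal_in_converse_induct)
    case refl show ?case using sg Ks by (simp add: subnormal_in_refl)
  next
    case (step S T)
    have ST: "subgroup S G" "subgroup T G" "T \<subseteq> K" using step subnormal_in_subset by (auto simp: normal_in_def)
    let ?T = "H <#> conj_core H T"
    have le: "?T \<subseteq> K" using set_mult_le[OF Ks Hs(2)] conj_core_subset ST(3) by (meson subset_trans)
    have "H \<subseteq> ?T" using set_mult_ge1 conj_core_subgroup Hs ST sub_carrier by metis
    then have snHT: "subnormal_in H ?T" using subnormal_in_restrict[OF H sg[OF ST(2)]] le by blast
    have n: "normal_in (conj_core H S) (conj_core H T)" using normal_in_conj_core Hs(1) step(1) by blast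
    have "normal_in (conj_core H S) ?T"
    proof (rule normal_inI)
      show "subgroup (conj_core H S) G" "subgroup ?T G" using conj_core_subgroup Hs ST sg by auto
      show "conj_core H S \<subseteq> ?T"
        using n set_mult_ge2[OF Hs(1) sub_carrier[OF conj_core_subgroup[OF Hs(1) ST(2)]]] by (auto simp: normal_in_def)
      show "normalizes ?T (conj_core H S)"
      proof (rule normalizesI)
        fix z s assume "z \<in> ?T" and s: "s \<in> conj_core H S"
        then obtain h t where z: "h \<in> H" "t \<in> conj_core H T" "z = h \<otimes> t" by (metis set_multE)
        have "conjg t s \<in> conj_core H S" using n s z by (auto simp: normal_in_def normalizesD)
        then have "conjg h (conjg t s) \<in> conj_core H S" using normalizesD[OF normalizes_conj_core[OF Hs(1) ST(1)]] z by blast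
        moreover have "h \<in> carrier G" "t \<in> carrier G" "s \<in> carrier G"
          using z s Hs ST by (auto simp: conj_core_def mem_carrier_of)
        ultimately show "conjg z s \<in> conj_core H S" using z by (simp add: conjg_conjg)
      qed
    qed
    then have "subnormal_in (H <#> conj_core H S) ?T" using subnormal_in_mult_normal[OF snHT] by blast
    then show ?case using step subnormal_in_trans by blast
  qed
  from this[OF L] have "subnormal_in (H <#> L) (H <#> K)"
    using conj_core_id[OF normalizes] conj_core_id[of H K] normalizes_mono[OF normalizes_self[OF Ks]] Hs by simp
  moreover have "H <#> K = K" using set_mult_le[OF Ks Hs(2) subset_refl] set_mult_ge2[OF Hs(1) sub_carrier[OF Ks]] by blast
  ultimately show ?thesis by simp
qed

lemma normal_carrier_update_iff:
  assumes "subgroup K G" and that: "subgroup H G"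
  shows "H \<lhd> G\<lparr>carrier := K\<rparr> \<longleftrightarrow> normal_in H K"
proof -
  interpret K: group "G\<lparr>carrier := K\<rparr>" using assms(1) by (rule subgroup_imp_group)
  have *: "subgroup H (G\<lparr>carrier := K\<rparr>) \<longleftrightarrow> H \<subseteq> K"
    using subgroup_incl[OF that assms(1)] subgroup.subset[of H "G\<lparr>carrier := K\<rparr>"] by auto
  show ?thesis unfolding K.normal_inv_iff * using that assms
    by (auto simp: normal_in_def normalizes_def conjg_def m_inv_consistent[OF assms(1)])
qed

lemma subnormal_iff_subnormal_in: "subnormal H G \<longleftrightarrow> subnormal_in H (carrier G)"
proof
  assume "subnormal H G"
  then obtain n K where K: "K 0 = H" "K n = carrier G" "\<forall>i\<le>n. subgroup (K i) G"
    "\<forall>i<n. K i \<lhd> G\<lparr>carrier := K (Suc i)\<rparr>" unfolding subnormal_def by blast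
  have "i \<le> n \<Longrightarrow> subnormal_in H (K i)" for i
  proof (induction i)
    case 0 then show ?case using K by (metis subnormal_in_refl zero_le)
  next
    case (Suc i)
    then have "normal_in (K i) (K (Suc i))" using K normal_carrier_update_iff[of "K (Suc i)" "K i"] by auto
    then show ?case using Suc subnormal_in_normal_in_trans by auto
  qed
  then show "subnormal_in H (carrier G)" using K(2) by (metis le_refl)
next
  assume "subnormal_in H (carrier G)"
  then show "subnormal H G"
  proof (induction rule: subnormal_in_converse_induct)
    case refl
    show ?case unfolding subnormal_def
      by (rule exI[of _ 0], rule exI[of _ "\<lambda>_. carrier G"]) (auto simp: subgroup_self)
  next
    case (step L M)
    then obtain n K where K: "K 0 = M" "K n = carrier G" "\<forall>i\<le>n. subgroup (K i) G"
      "\<forall>i<n. K i \<lhd> G\<lparr>carrier := K (Suc i)\<rparr>" unfolding subnormal_def by blast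
    define K' where "K' i = (case i of 0 \<Rightarrow> L | Suc j \<Rightarrow> K j)" for i
    have LM: "subgroup L G" "subgroup M G" using step by (auto simp: normal_in_def)
    have "K' 0 = L" "K' (Suc n) = carrier G" using K by (auto simp: K'_def)
    moreover have "subgroup (K' i) G" if "i \<le> Suc n" for i
      using that K(3) LM by (cases i) (auto simp: K'_def)
    moreover have "K' i \<lhd> G\<lparr>carrier := K' (Suc i)\<rparr>" if "i < Suc n" for i
      using that K step(1) LM normal_carrier_update_iff[of M L] by (cases i) (auto simp: K'_def)
    ultimately show ?case unfolding subnormal_def by blast
  qed
qed

section \<open>Chain conditions and the Baer property relative to a subgroup\<close>

definition rcc :: "'a set \<Rightarrow> bool" where
  "rcc K \<longleftrightarrow> \<not> (\<exists>H :: real \<Rightarrow> 'a set. strict_mono H \<and> (\<forall>r. subgroup (H r) G \<and> H r \<subseteq> K \<and> \<not> subnormal_in (H r) K))"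

lemma rcc_iff: "real_chain_condition (non_subnormal_subgroups G) \<longleftrightarrow> rcc (carrier G)"
  unfolding real_chain_condition_def rcc_def non_subnormal_subgroups_def subnormal_iff_subnormal_in
  by (metis (no_types, lifting) UNIV_I image_subset_iff mem_Collect_eq sub_carrier)

lemma rcc_mono: "rcc K \<Longrightarrow> subgroup K G \<Longrightarrow> subgroup L G \<Longrightarrow> L \<subseteq> K \<Longrightarrow> rcc L"
  unfolding rcc_def by (meson subnormal_in_restrict subset_trans)

lemma rccD:
  assumes "rcc K" "strict_mono (H :: real \<Rightarrow> 'a set)" "\<And>r. subgroup (H r) G" "\<And>r. H r \<subseteq> K"
  obtains r where "subnormal_in (H r) K"
  using assms unfolding rcc_def by blast

text \<open>The minimal condition on the interval from \<open>A\<close> to \<open>T\<close>. It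
  stands for the minimal condition on \<open>T/A\<close>, but makes sense without forming the
  quotient or knowing that \<open>A\<close> is normal.\<close>

definition dcc :: "'a set \<Rightarrow> 'a set \<Rightarrow> bool" where
  "dcc A T \<longleftrightarrow> \<not> (\<exists>H :: nat \<Rightarrow> 'a set. (\<forall>n. subgroup (H n) G \<and> A \<subseteq> H n \<and> H n \<subseteq> T) \<and> (\<forall>n. H (Suc n) \<subset> H n))"

lemma dccD:
  assumes "dcc A T" "\<And>n::nat. subgroup (H n) G" "\<And>n. A \<subseteq> H n" "\<And>n. H n \<subseteq> T" "\<And>n. H (Suc n) \<subset> H n"
  shows False
  using assms unfolding dcc_def by blast

lemma dccI:
  assumes "\<And>H :: nat \<Rightarrow> 'a set. (\<And>n. subgroup (H n) G) \<Longrightarrow> (\<And>n. A \<subseteq> H n) \<Longrightarrow> (\<And>n. H n \<subseteq> T) \<Longrightarrow> (\<And>n. H (Suc n) \<subset> H n) \<Longrightarrow> False"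
  shows "dcc A T"
  unfolding dcc_def using assms by blast

text \<open>Natural exponents suffice: for an element of finite order this is the cyclic subgroup it
  generates.\<close>

definition powers :: "'a \<Rightarrow> 'a set" where
  "powers x = range (\<lambda>n::nat. x [^] n)"

lemma powers_subgroup:
  assumes "x \<in> carrier G" "x [^] (m::nat) = \<one>" "m > 0"
  shows "subgroup (powers x) G"
proof (rule subgroup_criterion)
  show "powers x \<subseteq> carrier G" using assms by (auto simp: powers_def)
  show "\<one> \<in> powers x" unfolding powers_def by (rule range_eqI[of _ _ 0]) simp
next
  fix y assume "y \<in> powers x"
  then obtain n where n: "y = x [^] (n::nat)" by (auto simp: powers_def)
  have "n + n * (m - 1) = m * n" using assms(3) by (cases m) auto
  then have "y \<otimes> x [^] (n * (m - 1)) = x [^] (m * n)"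
    using assms n by (simp add: nat_pow_mult)
  also have "\<dots> = \<one>" using assms by (simp flip: nat_pow_pow)
  finally have "inv y = x [^] (n * (m - 1))" using assms n by (metis inv_comm inv_equality nat_pow_closed)
  then show "inv y \<in> powers x" by (auto simp: powers_def)
next
  fix y z assume "y \<in> powers x" "z \<in> powers x"
  then show "y \<otimes> z \<in> powers x" using assms by (auto simp: powers_def nat_pow_mult)
qed

lemma powers_self: "x \<in> carrier G \<Longrightarrow> x \<in> powers x"
  unfolding powers_def by (rule range_eqI[of _ _ 1]) simp

lemma powers_le: "subgroup H G \<Longrightarrow> x \<in> H \<Longrightarrow> powers x \<subseteq> H"
  by (auto simp: powers_def sub_pow)

definition baer :: "'a set \<Rightarrow> bool" where
  "baer K \<longleftrightarrow> (\<forall>x\<in>K. subnormal_in (powers x) K)"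

lemma baer_mono: "baer K \<Longrightarrow> subgroup L G \<Longrightarrow> L \<subseteq> K \<Longrightarrow> baer L"
  unfolding baer_def by (meson powers_le subnormal_in_restrict subset_iff)

definition torsion :: "'a set \<Rightarrow> bool" where
  "torsion K \<longleftrightarrow> (\<forall>x\<in>K. \<exists>n::nat. n > 0 \<and> x [^] n = \<one>)"

lemma torsion_mono: "torsion K \<Longrightarrow> L \<subseteq> K \<Longrightarrow> torsion L"
  by (auto simp: torsion_def)

lemma torsion_powers_subgroup: "torsion K \<Longrightarrow> subgroup K G \<Longrightarrow> x \<in> K \<Longrightarrow> subgroup (powers x) G"
  unfolding torsion_def using powers_subgroup mem_carrier_of by blast

definition commuting :: "'a set \<Rightarrow> bool" where
  "commuting A \<longleftrightarrow> (\<forall>a\<in>A. \<forall>b\<in>A. a \<otimes> b = b \<otimes> a)"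

lemma commuting_mono: "commuting A \<Longrightarrow> B \<subseteq> A \<Longrightarrow> commuting B"
  by (auto simp: commuting_def)

end

section \<open>Epimorphisms defined on a subgroup, and transfer of properties along them\<close>

locale partial_epi = G: group G + Q: group Q
  for G :: "('a, 'c) monoid_scheme" (structure) and Q :: "('b, 'd) monoid_scheme" +
  fixes K f
  assumes sub: "subgroup K G"
    and hom: "x \<in> K \<Longrightarrow> y \<in> K \<Longrightarrow> f (x \<otimes> y) = f x \<otimes>\<^bsub>Q\<^esub> f y"
    and onto: "f ` K = carrier Q"
begin

lemma f_closed [simp, intro]: "x \<in> K \<Longrightarrow> f x \<in> carrier Q"
  using onto by auto

lemma f_one [simp]: "f \<one> = \<one>\<^bsub>Q\<^esub>"
  using hom[of \<one> \<one>] G.sub_one[OF sub] by (metis G.one_closed G.r_one Q.l_cancel_one f_closed)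

lemma f_inv: "x \<in> K \<Longrightarrow> f (inv x) = inv\<^bsub>Q\<^esub> f x"
  by (metis G.l_inv G.mem_carrier_of G.sub_inv Q.inv_equality f_closed f_one hom sub)

lemma f_conjg: "x \<in> K \<Longrightarrow> y \<in> K \<Longrightarrow> f (G.conjg x y) = Q.conjg (f x) (f y)"
  by (simp add: G.conjg_def Q.conjg_def hom f_inv G.sub_mult[OF sub] G.sub_inv[OF sub])

lemma f_pow: "x \<in> K \<Longrightarrow> f (x [^] (n::nat)) = f x [^]\<^bsub>Q\<^esub> n"
  by (induction n) (simp_all add: hom G.sub_pow[OF sub])

definition pullback where "pullback S = {x \<in> K. f x \<in> S}"

lemma pullback_subset: "pullback S \<subseteq> K" by (auto simp: pullback_def)

lemma pullback_subgroup: "subgroup S Q \<Longrightarrow> subgroup (pullback S) G"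
  by (rule G.subgroup_criterion) (auto simp: pullback_def hom f_inv G.sub_mult[OF sub] G.sub_inv[OF sub] G.sub_one[OF sub] G.mem_carrier_of[OF sub] Q.sub_mult Q.sub_inv Q.sub_one)

lemma image_pullback: "S \<subseteq> carrier Q \<Longrightarrow> f ` pullback S = S"
  using onto by (auto simp: pullback_def)

lemma pullback_mono: "S \<subseteq> T \<Longrightarrow> pullback S \<subseteq> pullback T"
  by (auto simp: pullback_def)

lemma pullback_psubset: "S \<subset> T \<Longrightarrow> T \<subseteq> carrier Q \<Longrightarrow> pullback S \<subset> pullback T"
  by (metis image_pullback order.strict_iff_order pullback_mono subset_trans)

lemma image_subgroup:
  assumes H: "subgroup H G" "H \<subseteq> K" shows "subgroup (f ` H) Q"
proof (rule Q.subgroup_criterion)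
  show "f ` H \<subseteq> carrier Q" using H by auto
  show "\<one>\<^bsub>Q\<^esub> \<in> f ` H" using G.sub_one[OF H(1)] f_one by (metis imageI)
  show "inv\<^bsub>Q\<^esub> x \<in> f ` H" if x: "x \<in> f ` H" for x
  proof -
    obtain h where h: "h \<in> H" "x = f h" using x by auto
    then have "inv\<^bsub>Q\<^esub> x = f (inv h)" using H(2) by (auto simp: f_inv)
    then show ?thesis using G.sub_inv[OF H(1) h(1)] by simp
  qed
  show "x \<otimes>\<^bsub>Q\<^esub> y \<in> f ` H" if x: "x \<in> f ` H" "y \<in> f ` H" for x y
  proof -
    obtain h k where h: "h \<in> H" "x = f h" "k \<in> H" "y = f k" using x by auto
    then have "x \<otimes>\<^bsub>Q\<^esub> y = f (h \<otimes> k)" using subsetD[OF H(2)] by (simp add: hom)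
    then show ?thesis using G.sub_mult[OF H(1) h(1,3)] by simp
  qed
qed

lemma pullback_image:
  assumes H: "subgroup H G" "H \<subseteq> K" "pullback {\<one>\<^bsub>Q\<^esub>} \<subseteq> H" shows "pullback (f ` H) = H"
proof
  show "H \<subseteq> pullback (f ` H)" using H by (auto simp: pullback_def)
  show "pullback (f ` H) \<subseteq> H"
  proof
    fix x assume "x \<in> pullback (f ` H)"
    then obtain h where x: "x \<in> K" "h \<in> H" "f x = f h" by (auto simp: pullback_def)
    have "f (inv h \<otimes> x) = \<one>\<^bsub>Q\<^esub>" using x H(2) by (auto simp: hom f_inv G.sub_inv[OF sub])
    moreover have "inv h \<otimes> x \<in> K" using x H by (auto intro!: G.sub_mult[OF sub] G.sub_inv[OF sub])
    ultimately have "inv h \<otimes> x \<in> H" using H(3) by (auto simp: pullback_def)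
    then show "x \<in> H" using x H by (metis G.inv_closed G.sg_mult_left_iff G.mem_carrier_of G.sub_inv sub)
  qed
qed

lemma image_normal_in:
  assumes "G.normal_in H L" "L \<subseteq> K" shows "Q.normal_in (f ` H) (f ` L)"
  using assms unfolding G.normal_in_def Q.normal_in_def G.normalizes_def Q.normalizes_def
  by (auto simp: image_subgroup f_conjg[symmetric] subset_iff)

lemma image_subnormal_in: assumes "G.subnormal_in H L" "L \<subseteq> K" shows "Q.subnormal_in (f ` H) (f ` L)"
  using assms
proof (induction rule: G.subnormal_in_induct)
  case refl then show ?case by (simp add: Q.subnormal_in_refl image_subgroup)
next
  case (step L M)
  then have "L \<subseteq> K" by (auto simp: G.normal_in_def)
  then show ?case using step image_normal_in[of L M] Q.subnormal_in_normal_in_trans by blast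
qed

lemma pullback_normal_in: assumes "Q.normal_in S T" shows "G.normal_in (pullback S) (pullback T)"
  using assms pullback_subgroup[of S] pullback_subgroup[of T] unfolding G.normal_in_def Q.normal_in_def G.normalizes_def Q.normalizes_def
  by (auto simp: pullback_def f_conjg G.sub_conjg[OF sub])

lemma pullback_subnormal_in: assumes "Q.subnormal_in S T" shows "G.subnormal_in (pullback S) (pullback T)"
  using assms
proof (induction rule: Q.subnormal_in_induct)
  case refl then show ?case by (simp add: G.subnormal_in_refl pullback_subgroup)
next
  case (step L M)
  then show ?case using pullback_normal_in[of L M] G.subnormal_in_normal_in_trans by auto
qed

lemma pullback_carrier: "pullback (carrier Q) = K"
  by (auto simp: pullback_def)

lemma subnormal_in_pullback_iff: "subgroup S Q \<Longrightarrow> G.subnormal_in (pullback S) K \<longleftrightarrow> Q.subnormal_in S (carrier Q)"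
  using pullback_subnormal_in[of S "carrier Q"] image_subnormal_in[of "pullback S" K] image_pullback[of S] Q.sub_carrier[of S]
  by (auto simp: pullback_carrier onto)

lemma rcc_quotient: assumes "G.rcc K" shows "Q.rcc (carrier Q)"
  unfolding Q.rcc_def
proof (intro notI, elim exE conjE)
  fix H :: "real \<Rightarrow> 'b set" assume H: "strict_mono H" "\<forall>r. subgroup (H r) Q \<and> H r \<subseteq> carrier Q \<and> \<not> Q.subnormal_in (H r) (carrier Q)"
  have "strict_mono (\<lambda>r. pullback (H r))" using H pullback_psubset by (auto simp: strict_mono_def)
  then show False using G.rccD[OF assms] H pullback_subgroup pullback_subset subnormal_in_pullback_iff by metis
qed

lemma image_powers: "x \<in> K \<Longrightarrow> f ` G.powers x = Q.powers (f x)"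
  by (simp add: G.powers_def Q.powers_def image_image f_pow)

lemma baer_quotient: assumes "G.baer K" shows "Q.baer (carrier Q)"
  unfolding Q.baer_def
proof
  fix y assume "y \<in> carrier Q"
  then obtain x where "x \<in> K" "y = f x" using onto by auto
  then show "Q.subnormal_in (Q.powers y) (carrier Q)" using assms image_subnormal_in[of "G.powers x" K] by (auto simp: G.baer_def image_powers onto)
qed

lemma torsion_quotient: assumes "G.torsion K" shows "Q.torsion (carrier Q)"
  unfolding Q.torsion_def
proof
  fix y assume "y \<in> carrier Q"
  then obtain x where "x \<in> K" "y = f x" using onto by auto
  then show "\<exists>n::nat. n > 0 \<and> y [^]\<^bsub>Q\<^esub> n = \<one>\<^bsub>Q\<^esub>" using assms f_pow f_one by (metis G.torsion_def)
qed

text \<open>Taking images and pulling back are mutually inverse between subgroups of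
  \<open>Q\<close> and subgroups of \<open>K\<close> above the kernel, so strictly descending chains
  correspond in both directions.\<close>

lemma dcc_pullback:
  assumes "T \<subseteq> carrier Q" "subgroup S Q" shows "G.dcc (pullback S) (pullback T) \<longleftrightarrow> Q.dcc S T"
proof
  assume d: "G.dcc (pullback S) (pullback T)"
  show "Q.dcc S T"
  proof (rule Q.dccI)
    fix H :: "nat \<Rightarrow> 'b set"
    assume H: "\<And>n. subgroup (H n) Q" "\<And>n. S \<subseteq> H n" "\<And>n. H n \<subseteq> T" "\<And>n. H (Suc n) \<subset> H n"
    show False
    proof (rule G.dccD[OF d, of "\<lambda>n. pullback (H n)"])
      show "pullback (H (Suc n)) \<subset> pullback (H n)" for n using pullback_psubset[OF H(4)] Q.sub_carrier[OF H(1)] .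
    qed (use H pullback_subgroup pullback_mono in auto)
  qed
next
  assume d: "Q.dcc S T"
  show "G.dcc (pullback S) (pullback T)"
  proof (rule G.dccI)
    fix H :: "nat \<Rightarrow> 'a set"
    assume H: "\<And>n. subgroup (H n) G" "\<And>n. pullback S \<subseteq> H n" "\<And>n. H n \<subseteq> pullback T" "\<And>n. H (Suc n) \<subset> H n"
    have HK: "H n \<subseteq> K" "pullback {\<one>\<^bsub>Q\<^esub>} \<subseteq> H n" for n
      using H(2,3)[of n] pullback_subset[of T] pullback_mono[of "{\<one>\<^bsub>Q\<^esub>}" S] assms Q.sub_one by blast+
    have pbi: "pullback (f ` H n) = H n" for n using pullback_image[of "H n"] H(1) HK by auto
    show False
    proof (rule Q.dccD[OF d, of "\<lambda>n. f ` H n"])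
      show "f ` H (Suc n) \<subset> f ` H n" for n
      proof (rule psubsetI)
        show "f ` H (Suc n) \<subseteq> f ` H n" using H(4)[of n] by blast
        show "f ` H (Suc n) \<noteq> f ` H n" using H(4)[of n] pbi[of n] pbi[of "Suc n"] by auto
      qed
      show "subgroup (f ` H n) Q" for n using H(1) HK image_subgroup by auto
      show "S \<subseteq> f ` H n" for n using image_mono[OF H(2), of f n] image_pullback[OF Q.sub_carrier[OF assms(2)]] by simp
      show "f ` H n \<subseteq> T" for n using image_mono[OF H(3), of f n] image_pullback[OF assms(1)] by simp
    qed
  qed
qed

end

text \<open>The quotient is handed out as an epimorphism with known kernel, so that no later proof
  has to handle cosets. Its elements are sets, and quotients of quotients have elements one level
  higher.\<close>

lemma (in group) quotient_exists:
  assumes "normal_in M K"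
  obtains Q :: "'a set monoid" and f where "partial_epi G Q K f" "\<And>x. x \<in> K \<Longrightarrow> f x = \<one>\<^bsub>Q\<^esub> \<longleftrightarrow> x \<in> M"
proof -
  have K: "subgroup K G" and M: "subgroup M G" "M \<subseteq> K" using assms by (auto simp: normal_in_def)
  let ?K = "G\<lparr>carrier := K\<rparr>"
  interpret K: group ?K using K by (rule subgroup_imp_group)
  have "M \<lhd> ?K" using normal_carrier_update_iff[OF K M(1)] assms by simp
  then interpret N: normal M ?K .
  interpret Q: group "?K Mod M" by (rule N.factorgroup_is_group)
  let ?f = "\<lambda>x. M #>\<^bsub>?K\<^esub> x"
  have e: "partial_epi G (?K Mod M) K ?f"
  proof (intro partial_epi.intro partial_epi_axioms.intro)
    show "subgroup K G" by fact
    show "?f (x \<otimes> y) = ?f x \<otimes>\<^bsub>?K Mod M\<^esub> ?f y" if "x \<in> K" "y \<in> K" for x y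
      using N.rcos_sum[of x y] that by (simp add: FactGroup_def)
    show "?f ` K = carrier (?K Mod M)" by (auto simp: FactGroup_def RCOSETS_def)
  qed (simp_all add: Q.group_axioms)
  have "?f x = \<one>\<^bsub>?K Mod M\<^esub> \<longleftrightarrow> x \<in> M" if "x \<in> K" for x
    using that K.coset_join1[of M x] K.coset_join2[of x M] N.subgroup_axioms N.subset
    by (auto simp: FactGroup_def)
  from that[OF e this] show ?thesis .
qed

section \<open>Real chains of subgroups\<close>

text \<open>Dedekind cuts in an enumeration of the rationals: a copy of the real line among the
  subsets of a countable index set. Repetitions in the enumeration are harmless.\<close>

definition cut :: "real \<Rightarrow> nat set" where
  "cut r = {n. real_of_rat (nat_to_rat_surj n) < r}"

lemma strict_mono_cut: "strict_mono cut"
proof (rule strict_monoI)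
  fix r s :: real assume "r < s"
  then obtain q where q: "r < real_of_rat q" "real_of_rat q < s" using of_rat_dense by blast
  obtain n where "q = nat_to_rat_surj n" using surj_nat_to_rat_surj by (metis surjD)
  then have "n \<in> cut s" "n \<notin> cut r" using q by (auto simp: cut_def)
  then show "cut r \<subset> cut s" using \<open>r < s\<close> by (auto simp: cut_def)
qed

text \<open>Doubling the indices moves two copies of \<open>cut\<close> to the even and the odd
  numbers, so that any member of one chain is disjoint from any member of the other.\<close>

lemma even_odd_chain:
  obtains J0 J1 :: "real \<Rightarrow> nat set" where "strict_mono J0" "strict_mono J1" "\<And>r s. J0 r \<inter> J1 s = {}"
proof -
  let ?J = "\<lambda>c r. (\<lambda>n. 2 * n + c) ` cut r"
  have inj: "inj (\<lambda>n::nat. 2 * n + c)" for c by (auto intro: injI)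
  have "strict_mono (?J c)" for c
  proof (rule strict_monoI)
    fix r s :: real assume "r < s"
    then have "cut r \<subset> cut s" by (rule strict_monoD[OF strict_mono_cut])
    then show "?J c r \<subset> ?J c s" by (intro image_strict_mono inj_on_subset[OF inj subset_UNIV])
  qed
  moreover have "?J 0 r \<inter> ?J 1 s = {}" for r s by (auto, presburger)
  ultimately show ?thesis using that by blast
qed

context group
begin

text \<open>Stage \<open>n\<close> has used only indices below \<open>n\<close>; the factor
  \<open>A n\<close> joins at stage \<open>Suc n\<close>. Independence of \<open>A n\<close> is
  therefore always stated against stage \<open>n\<close>.\<close>

primrec partial_product :: "'a set \<Rightarrow> (nat \<Rightarrow> 'a set) \<Rightarrow> nat set \<Rightarrow> nat \<Rightarrow> 'a set" where
  "partial_product Y A J 0 = Y"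
| "partial_product Y A J (Suc n) = (if n \<in> J then partial_product Y A J n <#> A n else partial_product Y A J n)"

text \<open>The conditions below do not involve \<open>J\<close>: they concern the largest products only.\<close>

context
  fixes Y :: "'a set" and A :: "nat \<Rightarrow> 'a set"
  assumes Y: "subgroup Y G" and A: "\<And>n. subgroup (A n) G"
    and nzA: "\<And>n. normalizes (partial_product Y A UNIV n) (A n)"
    and ind: "\<And>n. A n \<inter> partial_product Y A UNIV n = {\<one>}"
begin

lemma partial_product_aux: "partial_product Y A J n \<subseteq> partial_product Y A UNIV n \<and> subgroup (partial_product Y A J n) G"
proof (induction n)
  case 0 then show ?case using Y by simp
next
  case (Suc n)
  have "subgroup (partial_product Y A J n <#> A n) G" using Suc A normalizes_mono[OF nzA] by (intro subgroup_set_mult) auto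
  moreover have "partial_product Y A UNIV n \<subseteq> partial_product Y A UNIV n <#> A n"
  proof -
    have "normalizes (partial_product Y A UNIV n) (A n)" using nzA by simp
    have "partial_product Y A UNIV n \<subseteq> carrier G"
    proof (induction n)
      case 0 then show ?case using Y sub_carrier by simp
    next
      case (Suc n) then show ?case using A[THEN sub_carrier] by (auto simp: set_mult_def)
    qed
    then show ?thesis using A set_mult_ge1 by blast
  qed
  ultimately show ?case using Suc by (auto simp: set_mult_def)
qed

lemma partial_product_subgroup: "subgroup (partial_product Y A J n) G" using partial_product_aux by blast

lemma partial_product_step: "partial_product Y A J n \<subseteq> partial_product Y A J (Suc n)"
  using set_mult_ge1[OF A sub_carrier[OF partial_product_subgroup]] by simp

lemma partial_product_mono_n: "m \<le> n \<Longrightarrow> partial_product Y A J m \<subseteq> partial_product Y A J n"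
  using partial_product_step by (rule lift_Suc_mono_le)

lemma partial_product_ge: "Y \<subseteq> partial_product Y A J n" using partial_product_mono_n[of 0 n J] by simp

lemma partial_product_mono_J: "I \<subseteq> J \<Longrightarrow> partial_product Y A I n \<subseteq> partial_product Y A J n"
proof (induction n)
  case (Suc n)
  then show ?case using partial_product_step[of J n] by (auto simp: set_mult_def split: if_splits)
qed simp

definition full_product where "full_product J = (\<Union>n. partial_product Y A J n)"

lemma full_product_subgroup: "subgroup (full_product J) G"
proof (rule subgroup_criterion)
  show "full_product J \<subseteq> carrier G" using partial_product_subgroup sub_carrier by (auto simp: full_product_def)
  show "\<one> \<in> full_product J" using partial_product_subgroup sub_one by (auto simp: full_product_def)
  show "inv x \<in> full_product J" if "x \<in> full_product J" for x using that sub_inv[OF partial_product_subgroup] unfolding full_product_def by blast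
  show "x \<otimes> y \<in> full_product J" if xy: "x \<in> full_product J" "y \<in> full_product J" for x y
  proof -
    obtain m n where "x \<in> partial_product Y A J m" "y \<in> partial_product Y A J n" using xy by (auto simp: full_product_def)
    then have "x \<in> partial_product Y A J (max m n)" "y \<in> partial_product Y A J (max m n)"
      using partial_product_mono_n[of m "max m n" J] partial_product_mono_n[of n "max m n" J] by auto
    then show ?thesis using sub_mult[OF partial_product_subgroup] unfolding full_product_def by blast
  qed
qed

text \<open>An index \<open>n\<close> lies in at most one of \<open>I\<close> and \<open>J\<close>.
  If the product that has just received \<open>A n\<close> meets the other one in
  \<open>b \<otimes> a\<close>, then \<open>b\<close> and \<open>b \<otimes> a\<close> both lie in
  the largest product at stage \<open>n\<close>, hence so does \<open>a\<close>, and independence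
  makes \<open>a\<close> trivial.\<close>

lemma partial_product_disjoint: "I \<inter> J = {} \<Longrightarrow> partial_product Y A I n \<inter> partial_product Y A J n = Y"
proof (induction n)
  case (Suc n)
  have *: "(partial_product Y A I n <#> A n) \<inter> partial_product Y A J n = Y" if IJ: "partial_product Y A I n \<inter> partial_product Y A J n = Y" for I J
  proof
    show "(partial_product Y A I n <#> A n) \<inter> partial_product Y A J n \<subseteq> Y"
    proof
      fix y assume y: "y \<in> (partial_product Y A I n <#> A n) \<inter> partial_product Y A J n"
      then obtain b a where b: "b \<in> partial_product Y A I n" "a \<in> A n" "y = b \<otimes> a" by (auto elim: set_multE)
      have "b \<in> partial_product Y A UNIV n" "y \<in> partial_product Y A UNIV n" using b y partial_product_aux by blast+
      then have "a \<in> partial_product Y A UNIV n" using b sg_mult_left_iff[OF partial_product_subgroup] mem_carrier_of[OF A] by blast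
      then have "a = \<one>" using ind b by blast
      then show "y \<in> Y" using b y IJ mem_carrier_of[OF partial_product_subgroup] by auto
    qed
    show "Y \<subseteq> (partial_product Y A I n <#> A n) \<inter> partial_product Y A J n"
      using IJ set_mult_ge1[OF A sub_carrier[OF partial_product_subgroup]] by blast
  qed
  show ?case
  proof (cases "n \<in> I")
    case True
    then show ?thesis using Suc *[of I J] by auto
  next
    case False
    then show ?thesis using Suc *[of J I] by (auto simp: Int_commute)
  qed
qed simp

lemma full_product_disjoint: assumes "I \<inter> J = {}" shows "full_product I \<inter> full_product J = Y"
proof
  show "full_product I \<inter> full_product J \<subseteq> Y"
  proof
    fix y assume "y \<in> full_product I \<inter> full_product J"
    then obtain m n where "y \<in> partial_product Y A I m" "y \<in> partial_product Y A J n" by (auto simp: full_product_def)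
    then have "y \<in> partial_product Y A I (max m n)" "y \<in> partial_product Y A J (max m n)"
      using partial_product_mono_n[of m "max m n" I] partial_product_mono_n[of n "max m n" J] by auto
    then show "y \<in> Y" using partial_product_disjoint[OF assms] by blast
  qed
  show "Y \<subseteq> full_product I \<inter> full_product J" using partial_product_ge by (auto simp: full_product_def)
qed

lemma full_product_ge: assumes "n \<in> J" shows "A n \<subseteq> full_product J"
proof -
  have "A n \<subseteq> partial_product Y A J (Suc n)" using set_mult_ge2[OF partial_product_subgroup[of J n] sub_carrier[OF A[of n]]] assms by simp
  then show ?thesis unfolding full_product_def by blast
qed

lemma full_product_not: assumes "n \<notin> J" shows "A n \<inter> full_product J = {\<one>}"
proof -
  have "A n \<inter> full_product J \<subseteq> Y" using full_product_ge[of n "{n}"] full_product_disjoint[of "{n}" J] assms by blast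
  then have "A n \<inter> full_product J \<subseteq> {\<one>}" using ind[of n] partial_product_ge[of UNIV n] by blast
  then show ?thesis using sub_one[OF A] sub_one[OF full_product_subgroup] by blast
qed

lemma full_product_psubset:
  assumes "\<And>n. A n \<noteq> {\<one>}" "I \<subset> J" shows "full_product I \<subset> full_product J"
proof -
  obtain n where n: "n \<in> J" "n \<notin> I" using assms by blast
  have "full_product I \<subseteq> full_product J" using partial_product_mono_J[of I J] assms by (auto simp: full_product_def)
  moreover have "full_product I \<noteq> full_product J" using full_product_ge[OF n(1)] full_product_not[OF n(2)] assms(1)[of n] by blast
  ultimately show ?thesis by blast
qed

text \<open>Each of two real chains of index sets, disjoint from each other, yields one subnormal
  product, and these two products intersect in \<open>Y\<close>.\<close>

lemma independent_imp_subnormal_in: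
  assumes ne: "\<And>n. A n \<noteq> {\<one>}" and rcc: "rcc K" and K: "\<And>n. partial_product Y A UNIV n \<subseteq> K"
  shows "subnormal_in Y K"
proof -
  obtain J0 J1 :: "real \<Rightarrow> nat set" where J: "strict_mono J0" "strict_mono J1" "\<And>r s. J0 r \<inter> J1 s = {}"
    using even_odd_chain by metis
  have *: "\<exists>r. subnormal_in (full_product (J r)) K" if "strict_mono J" for J :: "real \<Rightarrow> nat set"
  proof -
    have "strict_mono (\<lambda>r. full_product (J r))" using that full_product_psubset ne by (auto simp: strict_mono_def)
    moreover have "full_product (J r) \<subseteq> K" for r using partial_product_aux K by (force simp: full_product_def)
    ultimately show ?thesis using rccD[OF rcc] full_product_subgroup by metis
  qed
  obtain r s where "subnormal_in (full_product (J0 r)) K" "subnormal_in (full_product (J1 s)) K" using *[OF J(1)] *[OF J(2)] by blast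
  then have "subnormal_in (full_product (J0 r) \<inter> full_product (J1 s)) K" by (rule subnormal_in_Int)
  then show ?thesis using full_product_disjoint[OF J(3)] by simp
qed

lemma independent_imp_not_dcc:
  assumes ne: "\<And>n. A n \<noteq> {\<one>}" and K: "\<And>n. partial_product Y A UNIV n \<subseteq> K"
  shows "\<not> dcc Y K"
proof
  assume d: "dcc Y K"
  show False
  proof (rule dccD[OF d, of "\<lambda>n. full_product {n..}"])
    show "subgroup (full_product {n..}) G" for n by (rule full_product_subgroup)
    show "Y \<subseteq> full_product {n..}" for n using partial_product_ge by (auto simp: full_product_def)
    show "full_product {n..} \<subseteq> K" for n using partial_product_aux K by (force simp: full_product_def)
    show "full_product {Suc n..} \<subset> full_product {n..}" for n by (rule full_product_psubset[OF ne]) auto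
  qed
qed

end

text \<open>The dual of the argument with independent factors: two subnormal members now generate
  \<open>Y\<close>. The passage to the join is made by \<open>subnormal_in_join\<close>, which is
  why each \<open>F J\<close> is required to be normalised by \<open>Y\<close>.\<close>

lemma product_cover_imp_subnormal_in:
  fixes F :: "nat set \<Rightarrow> 'a set"
  assumes F: "\<And>J. subgroup (F J) G" "\<And>J. normalizes Y (F J)" "F UNIV = Y"
    and strict: "\<And>I J. I \<subset> J \<Longrightarrow> F I \<subset> F J"
    and prod: "\<And>I J. F (I \<union> J) \<subseteq> F I <#> F J"
    and rcc: "rcc K" and YK: "Y \<subseteq> K"
  shows "subnormal_in Y K"
proof -
  obtain J0 J1 :: "real \<Rightarrow> nat set" where J: "strict_mono J0" "strict_mono J1" "\<And>r s. J0 r \<inter> J1 s = {}"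
    using even_odd_chain by metis
  have FY: "F I \<subseteq> Y" for I using strict[of I UNIV] F(3) by (cases "I = UNIV") auto
  have *: "\<exists>r. subnormal_in (F (J r \<union> M)) K" if "strict_mono J" "\<And>r. J r \<inter> M = {}" for J :: "real \<Rightarrow> nat set" and M
  proof -
    have "strict_mono (\<lambda>r. F (J r \<union> M))"
    proof (rule strict_monoI)
      fix r s :: real assume "r < s"
      then have "J r \<subset> J s" using that(1) by (auto simp: strict_mono_def)
      then have "J r \<union> M \<subset> J s \<union> M" using that(2)[of r] that(2)[of s] by blast
      then show "F (J r \<union> M) \<subset> F (J s \<union> M)" by (rule strict)
    qed
    moreover have "F (J r \<union> M) \<subseteq> K" for r using FY YK by blast
    ultimately show ?thesis using rccD[OF rcc] F(1) by metis
  qed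
  \<comment> \<open>\<open>M\<close> contains every \<open>J1 s\<close> and avoids every
    \<open>J0 r\<close>. Adding \<open>M\<close> to the first chain and its complement to the second
    keeps both strict, and any two members together cover all indices.\<close>
  define M where "M = (\<Union>r. J1 r)"
  have M: "J0 r \<inter> M = {}" "J1 r \<inter> (UNIV - M) = {}" for r using J(3) by (auto simp: M_def)
  obtain r s where rs: "subnormal_in (F (J0 r \<union> M)) K" "subnormal_in (F (J1 s \<union> (UNIV - M))) K"
    using *[OF J(1) M(1)] *[OF J(2) M(2)] by blast
  have "normalizes (F (J0 r \<union> M)) (F (J1 s \<union> (UNIV - M)))" using normalizes_mono[OF F(2) FY] .
  then have "subnormal_in (F (J0 r \<union> M) <#> F (J1 s \<union> (UNIV - M))) K" using rs by (intro subnormal_in_join)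
  moreover have "F (J0 r \<union> M) <#> F (J1 s \<union> (UNIV - M)) = Y"
  proof
    show "F (J0 r \<union> M) <#> F (J1 s \<union> (UNIV - M)) \<subseteq> Y" using set_mult_le[of Y] FY F(1)[of UNIV] F(3) by metis
    have "(J0 r \<union> M) \<union> (J1 s \<union> (UNIV - M)) = UNIV" by blast
    then show "Y \<subseteq> F (J0 r \<union> M) <#> F (J1 s \<union> (UNIV - M))" using prod F(3) by metis
  qed
  ultimately show ?thesis by simp
qed

text \<open>Dependent choice: \<open>Inv\<close> records what the product built so far must satisfy
  for another factor to exist.\<close>

lemma independent_sequence:
  assumes Y: "Inv Y" and step: "\<And>H. Inv H \<Longrightarrow> \<exists>A. subgroup A G \<and> normalizes H A \<and> A \<inter> H = {\<one>} \<and> A \<noteq> {\<one>} \<and> Inv (H <#> A)"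
  obtains A where "\<And>n. subgroup (A n) G" "\<And>n. normalizes (partial_product Y A UNIV n) (A n)"
    "\<And>n. A n \<inter> partial_product Y A UNIV n = {\<one>}" "\<And>n::nat. A n \<noteq> {\<one>}" "\<And>n. Inv (partial_product Y A UNIV n)"
proof -
  obtain a where a: "\<And>H. Inv H \<Longrightarrow> subgroup (a H) G \<and> normalizes H (a H) \<and> a H \<inter> H = {\<one>} \<and> a H \<noteq> {\<one>} \<and> Inv (H <#> a H)"
    using step by metis
  define Hn where "Hn = rec_nat Y (\<lambda>_ H. H <#> a H)"
  define A where "A n = a (Hn n)" for n
  have Hn: "Hn 0 = Y" "Hn (Suc n) = Hn n <#> A n" for n by (simp_all add: Hn_def A_def)
  have partial_product: "partial_product Y A UNIV n = Hn n" for n by (induction n) (simp_all add: Hn)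
  have "Inv (Hn n)" for n by (induction n) (use Y a in \<open>auto simp: Hn A_def\<close>)
  then show ?thesis using that[of A] a by (auto simp: partial_product A_def)
qed

end

text \<open>\<open>lt\<close> is not assumed transitive, so distant members are compared by
  inclusion only. The relation itself survives between neighbours, which is why each set in
  \<open>C r\<close> comes with some \<open>V\<close> above it: properties encoded in
  \<open>lt\<close> are read off from there.\<close>

lemma dense_imp_real_chain:
  fixes lt :: "'a set \<Rightarrow> 'a set \<Rightarrow> bool"
  assumes sub: "\<And>U V. lt U V \<Longrightarrow> U \<subset> V" and dense: "\<And>U V. lt U V \<Longrightarrow> \<exists>W. lt U W \<and> lt W V"
    and AB: "lt A B"
  obtains H :: "real \<Rightarrow> 'a set" and C where "strict_mono H"
    "\<And>r. H r = \<Union>(C r)" "\<And>r. C r \<noteq> {}"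
    "\<And>r U. U \<in> C r \<Longrightarrow> A \<subseteq> U \<and> U \<subseteq> B \<and> (\<exists>V. lt U V)"
    "\<And>r U V. U \<in> C r \<Longrightarrow> V \<in> C r \<Longrightarrow> U \<subseteq> V \<or> V \<subseteq> U"
proof -
  obtain mid where mid: "\<And>U V. lt U V \<Longrightarrow> lt U (mid U V) \<and> lt (mid U V) V" using dense by metis
  \<comment> \<open>\<open>f n k\<close> sits at the dyadic point \<open>k / 2^n\<close>: the next
    level keeps the old sets at even positions and inserts midpoints at odd ones.\<close>
  define f where "f = rec_nat (\<lambda>k::nat. if k = 0 then A else B)
     (\<lambda>n g k. if even k then g (k div 2) else mid (g (k div 2)) (g (k div 2 + 1)))"
  have f0: "f 0 k = (if k = 0 then A else B)" for k by (simp add: f_def)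
  have fS: "f (Suc n) k = (if even k then f n (k div 2) else mid (f n (k div 2)) (f n (k div 2 + 1)))" for n k
    by (simp add: f_def)
  have step: "k < 2 ^ n \<Longrightarrow> lt (f n k) (f n (Suc k))" for n k
  proof (induction n arbitrary: k)
    case 0 then show ?case using AB by (simp add: f0)
  next
    case (Suc n)
    have l: "lt (f n (k div 2)) (f n (Suc (k div 2)))" using Suc by auto
    show ?case
    proof (cases "even k")
      case True
      then have "Suc k div 2 = k div 2" by (auto elim: evenE)
      then show ?thesis using True mid[OF l] by (simp add: fS)
    next
      case False
      then have "Suc k div 2 = Suc (k div 2)" by (auto elim: oddE)
      then show ?thesis using False mid[OF l] by (simp add: fS)
    qed
  qed
  have refine: "f (n + j) (k * 2 ^ j) = f n k" for n j k
    by (induction j) (simp_all add: fS mult.assoc)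
  have less: "j < k \<Longrightarrow> k \<le> 2 ^ n \<Longrightarrow> f n j \<subset> f n k" for n j k
  proof (induction k)
    case (Suc k)
    then show ?case using sub[OF step, of k n] by (cases "j = k") auto
  qed simp
  have le: "j \<le> k \<Longrightarrow> k \<le> 2 ^ n \<Longrightarrow> f n j \<subseteq> f n k" for n j k
    using less[of j k n] by (cases "j = k") auto
  \<comment> \<open>Positions at different levels are compared at the common level
    \<open>m + n\<close>.\<close>
  have le': "f n j \<subseteq> f m k" if "real j / 2 ^ n \<le> real k / 2 ^ m" "k \<le> 2 ^ m" for n j m k
  proof -
    have "real j * 2 ^ m \<le> real k * 2 ^ n" using that by (simp add: field_simps)
    then have "real (j * 2 ^ m) \<le> real (k * 2 ^ n)" by simp
    then have "j * 2 ^ m \<le> k * 2 ^ n" by (simp only: of_nat_le_iff)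
    moreover have "k * 2 ^ n \<le> 2 ^ (m + n)" using that(2) by (simp add: power_add)
    ultimately have "f (m + n) (j * 2 ^ m) \<subseteq> f (m + n) (k * 2 ^ n)" by (rule le)
    then show ?thesis using refine[of n m j] refine[of m n k] by (simp add: add.commute)
  qed
  \<comment> \<open>The dyadic points fill only the unit interval, so the real line is squeezed into
    its interior. As \<open>c r\<close> stays below one, every point under it has a right
    neighbour.\<close>
  define c where "c r = 1/2 + arctan r / pi" for r
  have c: "0 < c r" "c r < 1" for r
    using arctan_bounded[of r] pi_gt_zero by (auto simp: c_def field_simps)
  have c_mono: "r < s \<Longrightarrow> c r < c s" for r s
    by (simp add: c_def divide_strict_right_mono arctan_monotone)
  define C where "C r = {f n k | n k. real k / 2 ^ n < c r}" for r
  have kn: "k < 2 ^ n" if "real k / 2 ^ n < c r" for n k r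
  proof -
    have "real k / 2 ^ n < 1" using that c(2)[of r] by linarith
    then have "real k < real (2 ^ n)" by simp
    then show ?thesis by (simp only: of_nat_less_iff)
  qed
  have "strict_mono (\<lambda>r. \<Union>(C r))"
  proof (rule strict_monoI)
    fix r s :: real assume "r < s"
    then have d: "c s - c r > 0" using c_mono by simp
    \<comment> \<open>Two grid steps fit between \<open>c r\<close> and \<open>c s\<close>, so two
      consecutive grid points \<open>k\<close> and \<open>k + 1\<close> lie between them. The strict
      inclusion of their sets separates the two unions.\<close>
    obtain n where "2 / (c s - c r) < 2 ^ n" using real_arch_pow[of 2] by auto
    then have n: "2 / 2 ^ n < c s - c r" using d by (simp add: field_simps)
    define k where "k = nat \<lceil>c r * 2 ^ n\<rceil>"
    have "c r * 2 ^ n > 0" using c by simp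
    then have k: "c r * 2 ^ n \<le> real k" "real k < c r * 2 ^ n + 1" unfolding k_def by linarith+
    have k1: "c r \<le> real k / 2 ^ n" using k by (simp add: field_simps)
    have "real (Suc k) / 2 ^ n < (c r * 2 ^ n + 2) / 2 ^ n" using k by (intro divide_strict_right_mono) auto
    also have "\<dots> = c r + 2 / 2 ^ n" by (simp add: field_simps)
    also have "\<dots> < c s" using n by simp
    finally have k2: "real (Suc k) / 2 ^ n < c s" .
    have k3: "Suc k \<le> 2 ^ n" using kn[OF k2] by simp
    have "\<Union>(C r) \<subseteq> f n k"
    proof
      fix x assume "x \<in> \<Union>(C r)"
      then obtain m j where x: "x \<in> f m j" "real j / 2 ^ m < c r" by (auto simp: C_def)
      have "f m j \<subseteq> f n k" using le'[of j m k n] x k1 k3 by auto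
      then show "x \<in> f n k" using x by blast
    qed
    also have "f n k \<subset> f n (Suc k)" using sub[OF step] k3 by auto
    also have "f n (Suc k) \<subseteq> \<Union>(C s)" using k2 unfolding C_def by blast
    finally show "\<Union>(C r) \<subset> \<Union>(C s)" .
  qed
  moreover have "C r \<noteq> {}" for r
  proof -
    have "f 0 0 \<in> C r" unfolding C_def using c(1)[of r] by (intro CollectI exI[of _ 0]) simp
    then show ?thesis by blast
  qed
  moreover have "A \<subseteq> U \<and> U \<subseteq> B \<and> (\<exists>V. lt U V)" if UC: "U \<in> C r" for r U
  proof -
    obtain n k where U: "U = f n k" "real k / 2 ^ n < c r" using UC unfolding C_def by blast
    have k: "k < 2 ^ n" using kn U by blast
    have "f 0 0 \<subseteq> U" unfolding U by (rule le') (use k in auto)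
    moreover have "U \<subseteq> f 0 1" unfolding U
      by (rule le') (use k in \<open>auto simp: field_simps simp flip: of_nat_power\<close>)
    ultimately show ?thesis using step[OF k] U by (auto simp: f0)
  qed
  moreover have "U \<subseteq> V \<or> V \<subseteq> U" if UC: "U \<in> C r" "V \<in> C r" for r U V
  proof -
    obtain n k m j where U: "U = f n k" "real k / 2 ^ n < c r" "V = f m j" "real j / 2 ^ m < c r"
      using UC unfolding C_def by blast
    have k: "k \<le> 2 ^ n" "j \<le> 2 ^ m" using kn[OF U(2)] kn[OF U(4)] by auto
    show ?thesis using le'[of k n j m] le'[of j m k n] k U
      by (cases "real k / 2 ^ n \<le> real j / 2 ^ m") auto
  qed
  ultimately show ?thesis using that[of "\<lambda>r. \<Union>(C r)" C] by blast
qed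

section \<open>The minimal condition in periodic abelian groups\<close>

lemma antimono_finite_stable:
  fixes F :: "nat \<Rightarrow> 'a set"
  assumes "finite S" "\<And>n. F n \<subseteq> S" "\<And>n. F (Suc n) \<subseteq> F n"
  obtains N where "\<And>n. n \<ge> N \<Longrightarrow> F n = F N"
proof -
  have anti: "m \<le> n \<Longrightarrow> F n \<subseteq> F m" for m n by (rule lift_Suc_antimono_le[of F]) (use assms in auto)
  obtain N where N: "\<And>n. card (F N) \<le> card (F n)"
    using ex_has_least_nat[of "\<lambda>_. True" 0 "\<lambda>n. card (F n)"] by auto
  have "F n = F N" if "n \<ge> N" for n
    using card_subset_eq[of "F N" "F n"] anti[OF that] N[of n] card_mono[of "F N" "F n"] finite_subset[OF assms(2,1)]
    by auto
  then show ?thesis using that by blast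
qed

context group
begin

lemma subgroup_Union_chain:
  assumes "C \<noteq> {}" "\<And>U. U \<in> C \<Longrightarrow> subgroup U G" "\<And>U V. U \<in> C \<Longrightarrow> V \<in> C \<Longrightarrow> U \<subseteq> V \<or> V \<subseteq> U"
  shows "subgroup (\<Union>C) G"
proof (rule subgroup_criterion)
  show "\<Union>C \<subseteq> carrier G" using assms(2) sub_carrier by blast
  show "\<one> \<in> \<Union>C" using assms(1,2) sub_one by blast
  show "inv x \<in> \<Union>C" if "x \<in> \<Union>C" for x using that assms(2) sub_inv by blast
  show "x \<otimes> y \<in> \<Union>C" if xy: "x \<in> \<Union>C" "y \<in> \<Union>C" for x y
  proof -
    obtain U V where UV: "U \<in> C" "V \<in> C" "x \<in> U" "y \<in> V" using xy by blast
    then consider "x \<in> V" | "y \<in> U" using assms(3)[of U V] by blast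
    then show ?thesis using UV assms(2) sub_mult by cases blast+
  qed
qed

text \<open>Bezout in the form \<open>n a = m b + 1\<close>, which avoids negative exponents. For
  \<open>n = 0\<close> this equation has no solution, and coprimality makes \<open>m\<close> equal
  to one instead.\<close>

lemma coprime_pow_mem:
  assumes H: "subgroup H G" and x: "x \<in> carrier G" "x [^] (n::nat) \<in> H" "x [^] (m::nat) \<in> H" and c: "coprime n m"
  shows "x \<in> H"
proof (cases "n = 0")
  case True
  then have "m = 1" using c by simp
  then show ?thesis using x by simp
next
  case False
  then obtain a b where ab: "n * a = m * b + 1" using bezout_nat[of n m] c by auto
  have "x [^] (n * a) = x [^] (m * b) \<otimes> x" using ab by simp
  moreover have "x [^] (n * a) \<in> H" "x [^] (m * b) \<in> H" using x sub_pow[OF H] by (auto simp flip: nat_pow_pow)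
  ultimately show ?thesis using sg_mult_left_iff[OF H] x by metis
qed

text \<open>\<open>S\<close> represents right cosets of \<open>A\<close>. With representatives in
  place of cosets, transitivity of finite index is multiplication of two finite sets.\<close>

definition finite_index :: "'a set \<Rightarrow> 'a set \<Rightarrow> bool" where
  "finite_index A T \<longleftrightarrow> (\<exists>S. finite S \<and> S \<subseteq> T \<and> T \<subseteq> A <#> S)"

text \<open>If each fibre of \<open>g\<close> lies in one right coset of \<open>A\<close>, one
  representative per value is enough.\<close>

lemma finite_index_by_map:
  assumes A: "subgroup A G" and T: "T \<subseteq> carrier G" and fin: "finite (g ` T)"
    and g: "\<And>s t. s \<in> T \<Longrightarrow> t \<in> T \<Longrightarrow> g s = g t \<Longrightarrow> s \<otimes> inv t \<in> A"
  shows "finite_index A T"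
proof -
  define r where "r v = (SOME t. t \<in> T \<and> g t = v)" for v
  have r: "r (g t) \<in> T \<and> g (r (g t)) = g t" if "t \<in> T" for t
    unfolding r_def by (rule someI2[of _ t]) (use that in auto)
  have "T \<subseteq> A <#> (r ` g ` T)"
  proof
    fix t assume t: "t \<in> T"
    have "t = (t \<otimes> inv r (g t)) \<otimes> r (g t)" using r[OF t] t T by (simp add: subset_iff m_assoc)
    then show "t \<in> A <#> (r ` g ` T)" using g[OF t, of "r (g t)"] r[OF t] t by (metis imageI set_multI)
  qed
  then show ?thesis unfolding finite_index_def using fin r by (intro exI[of _ "r ` g ` T"]) auto
qed

lemma no_strict_decreasing_nat: "\<not> (\<forall>n. (f (Suc n) :: nat) < f n)"
proof
  assume f: "\<forall>n. f (Suc n) < f n"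
  have "f n + n \<le> f 0" for n
  proof (induction n)
    case (Suc n) then show ?case using f[rule_format, of n] by simp
  qed simp
  from this[of "Suc (f 0)"] show False by simp
qed

lemma finite_index_refl: "subgroup A G \<Longrightarrow> finite_index A A"
  unfolding finite_index_def using sub_one[of A] set_multI[of _ A \<one> "{\<one>}"] mem_carrier_of[of A]
  by (intro exI[of _ "{\<one>}"]) force

text \<open>A subgroup between \<open>A\<close> and \<open>T\<close> contains
  \<open>a \<otimes> s\<close> exactly when it contains \<open>s\<close>, so it is determined by its
  trace on the finite set \<open>S\<close>.\<close>

lemma finite_index_dcc:
  assumes "finite_index A T" and T: "subgroup T G"
  shows "dcc A T"
proof (rule dccI)
  fix H :: "nat \<Rightarrow> 'a set"
  assume H: "\<And>n. subgroup (H n) G" "\<And>n. A \<subseteq> H n" "\<And>n. H n \<subseteq> T" "\<And>n. H (Suc n) \<subset> H n"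
  obtain S where S: "finite S" "S \<subseteq> T" "T \<subseteq> A <#> S" using assms unfolding finite_index_def by blast
  have "S \<inter> H (Suc n) \<subset> S \<inter> H n" for n
  proof -
    obtain h where h: "h \<in> H n" "h \<notin> H (Suc n)" using H(4)[of n] by blast
    then have "h \<in> A <#> S" using S H(3) by blast
    then obtain a s where as: "a \<in> A" "s \<in> S" "h = a \<otimes> s" by (rule set_multE)
    have a: "a \<in> H n" "a \<in> H (Suc n)" using as H(2) by auto
    have s: "s \<in> carrier G" using as S sub_carrier[OF T] by auto
    have "s \<in> H n" "s \<notin> H (Suc n)"
      using h as sg_mult_left_iff[OF H(1) a(1) s] sg_mult_left_iff[OF H(1) a(2) s] by auto
    then show ?thesis using as H(4)[of n] by blast
  qed
  then have "card (S \<inter> H (Suc n)) < card (S \<inter> H n)" for n using S(1) by (intro psubset_card_mono) auto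
  then show False using no_strict_decreasing_nat[of "\<lambda>n. card (S \<inter> H n)"] by blast
qed

lemma dcc_stable:
  assumes d: "dcc A T" and H: "\<And>n::nat. subgroup (H n) G" "\<And>n. A \<subseteq> H n" "\<And>n. H n \<subseteq> T" "\<And>n. H (Suc n) \<subseteq> H n"
  obtains N where "\<And>n. n \<ge> N \<Longrightarrow> H n = H N"
proof (rule ccontr)
  assume neg: "\<not> thesis"
  have anti: "m \<le> n \<Longrightarrow> H n \<subseteq> H m" for m n by (rule lift_Suc_antimono_le[of H]) (use H in auto)
  have "\<exists>n. H n \<subset> H N" for N
  proof (rule ccontr)
    assume "\<nexists>n. H n \<subset> H N"
    then have "n \<ge> N \<Longrightarrow> H n = H N" for n using anti by blast
    then show False using neg that by blast
  qed
  then obtain g where g: "\<And>N. H (g N) \<subset> H N" by metis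
  define r where "r = rec_nat 0 (\<lambda>_ N. g N)"
  have "r (Suc n) = g (r n)" for n by (simp add: r_def)
  then show False using dccD[OF d, of "\<lambda>n. H (r n)"] H g by auto
qed

lemma dcc_mono: "dcc A T \<Longrightarrow> A \<subseteq> B \<Longrightarrow> S \<subseteq> T \<Longrightarrow> dcc B S"
  unfolding dcc_def by (meson subset_trans)

text \<open>The intersections \<open>H n \<inter> C\<close> and the products
  \<open>H n <#> C\<close> both become constant. By the modular law, nested subgroups with equal
  intersection and equal product coincide.\<close>

lemma dcc_trans:
  assumes sg: "subgroup C G" "A \<subseteq> C" "C \<subseteq> T" "normalizes T C" and T: "subgroup T G" and A: "subgroup A G"
    and d: "dcc A C" "dcc C T"
  shows "dcc A T"
proof (rule dccI)
  fix H :: "nat \<Rightarrow> 'a set"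
  assume H: "\<And>n. subgroup (H n) G" "\<And>n. A \<subseteq> H n" "\<And>n. H n \<subseteq> T" "\<And>n. H (Suc n) \<subset> H n"
  have sub: "subgroup (H n <#> C) G" for n using subgroup_set_mult[OF H(1) sg(1)] normalizes_mono[OF sg(4) H(3)] by blast
  have "H (Suc n) \<inter> C \<subseteq> H n \<inter> C" for n using H(4)[of n] by blast
  then obtain N where N: "\<And>n. n \<ge> N \<Longrightarrow> H n \<inter> C = H N \<inter> C"
    using dcc_stable[OF d(1), of "\<lambda>n. H n \<inter> C"] subgroup_Int[OF H(1) sg(1)] H(2) sg(2) by auto
  have "H (Suc n) <#> C \<subseteq> H n <#> C" for n using H(4)[of n] by (auto simp: set_mult_def)
  moreover have "C \<subseteq> H n <#> C" for n using set_mult_ge2[OF H(1) sub_carrier[OF sg(1)]] .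
  moreover have "H n <#> C \<subseteq> T" for n using set_mult_le[OF T H(3) sg(3)] .
  ultimately obtain M where M: "\<And>n. n \<ge> M \<Longrightarrow> H n <#> C = H M <#> C"
    using dcc_stable[OF d(2), of "\<lambda>n. H n <#> C"] sub by metis
  define n where "n = max M N"
  have e: "H (Suc n) \<inter> C = H n \<inter> C" "H (Suc n) <#> C = H n <#> C"
    using N[of n] N[of "Suc n"] M[of n] M[of "Suc n"] by (auto simp: n_def)
  have "H n \<subseteq> H (Suc n)"
  proof
    fix h assume h: "h \<in> H n"
    then have "h \<in> H (Suc n) <#> C" using e(2) set_mult_ge1[OF sg(1) sub_carrier[OF H(1)]] by blast
    then obtain h' c where hc: "h' \<in> H (Suc n)" "c \<in> C" "h = h' \<otimes> c" by (rule set_multE)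
    have "h' \<in> H n" using hc H(4)[of n] by blast
    then have "c \<in> H n" using hc h sg_mult_left_iff[OF H(1)] mem_carrier_of[OF sg(1)] by blast
    then have "c \<in> H (Suc n)" using e(1) hc by blast
    then show "h \<in> H (Suc n)" using hc sub_mult[OF H(1)] by blast
  qed
  then show False using H(4)[of n] by blast
qed

lemma finite_powers:
  assumes "x \<in> carrier G" "x [^] (m::nat) = \<one>" "m > 0"
  shows "finite (powers x)"
proof -
  have "x [^] n = x [^] (n mod m)" for n :: nat
  proof -
    have "x [^] (m * (n div m) + n mod m) = x [^] (n mod m)"
      using assms by (simp only: nat_pow_mult[symmetric] nat_pow_pow[symmetric] nat_pow_closed nat_pow_one l_one)
    then show ?thesis by simp
  qed
  then have "powers x \<subseteq> (\<lambda>n. x [^] n) ` {..<m}" using assms(3) unfolding powers_def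
    by (auto intro!: image_eqI[of _ _ "n mod m" for n])
  then show ?thesis using finite_surj by blast
qed

lemma finite_set_mult: "finite A \<Longrightarrow> finite B \<Longrightarrow> finite (A <#> B)"
  by (auto simp: set_mult_def)

text \<open>The set of elements of order one or a prime, not the subgroup that it generates; what
  counts is whether this set is finite.\<close>

definition socle :: "'a set \<Rightarrow> 'a set" where
  "socle A = {a \<in> A. \<exists>p::nat. Factorial_Ring.prime p \<and> a [^] p = \<one>}"

definition torsion_part :: "'a set \<Rightarrow> nat \<Rightarrow> 'a set" where
  "torsion_part A n = {a \<in> A. a [^] n = \<one>}"

lemma commuting_normalizes: "commuting A \<Longrightarrow> A \<subseteq> carrier G \<Longrightarrow> S \<subseteq> A \<Longrightarrow> U \<subseteq> A \<Longrightarrow> normalizes S U"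
proof (rule normalizesI)
  fix x a assume "commuting A" "A \<subseteq> carrier G" "S \<subseteq> A" "U \<subseteq> A" "x \<in> S" "a \<in> U"
  then have "x \<in> A" "a \<in> A" by auto
  then have "x \<otimes> a = a \<otimes> x" "x \<in> carrier G" "a \<in> carrier G"
    using \<open>commuting A\<close> \<open>A \<subseteq> carrier G\<close> by (auto simp: commuting_def)
  then have "conjg x a = a" using conjg_eq_self_iff[of x a] by simp
  then show "conjg x a \<in> U" using \<open>a \<in> U\<close> by simp
qed

text \<open>The products stay finite, so an infinite socle always offers an element of prime order
  outside. A cyclic group of prime order meets a subgroup that does not contain it
  trivially.\<close>

lemma prime_order_sequence:
  assumes A: "subgroup A G" "commuting A" and inf: "infinite (socle A)"
  obtains B where "\<And>n. subgroup (B n) G" "\<And>n. normalizes (partial_product {\<one>} B UNIV n) (B n)"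
    "\<And>n. B n \<inter> partial_product {\<one>} B UNIV n = {\<one>}" "\<And>n::nat. B n \<noteq> {\<one>}" "\<And>n. partial_product {\<one>} B UNIV n \<subseteq> A"
proof -
  define Inv where "Inv H \<longleftrightarrow> finite H \<and> subgroup H G \<and> H \<subseteq> A" for H
  have "\<exists>B. subgroup B G \<and> normalizes H B \<and> B \<inter> H = {\<one>} \<and> B \<noteq> {\<one>} \<and> Inv (H <#> B)" if H: "Inv H" for H
  proof -
    obtain x where "x \<in> socle A" "x \<notin> H" using inf H finite_subset[of "socle A" H] unfolding Inv_def by blast
    then obtain p :: nat where x: "x \<in> A" "x \<notin> H" "Factorial_Ring.prime p" "x [^] p = \<one>" by (auto simp: socle_def)
    have xc: "x \<in> carrier G" using x A mem_carrier_of by blast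
    have p0: "p > 0" using x(3) by (simp add: prime_gt_0_nat)
    have B: "subgroup (powers x) G" "finite (powers x)" using powers_subgroup[OF xc x(4) p0] finite_powers[OF xc x(4) p0] by auto
    have BA: "powers x \<subseteq> A" using powers_le[OF A(1) x(1)] .
    have normalizes: "normalizes H (powers x)" using commuting_normalizes[OF A(2) sub_carrier[OF A(1)]] H BA unfolding Inv_def by blast
    have "powers x \<inter> H \<subseteq> {\<one>}"
    proof
      fix y assume "y \<in> powers x \<inter> H"
      then obtain k :: nat where k: "y = x [^] k" "y \<in> H" by (auto simp: powers_def)
      show "y \<in> {\<one>}"
      proof (cases "p dvd k")
        case True
        then obtain j where "k = p * j" by auto
        then have "y = (x [^] p) [^] j" using k xc by (simp add: nat_pow_pow)
        then show ?thesis using x by simp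
      next
        case False
        then have "coprime p k" using x(3) by (simp add: prime_imp_coprime_nat)
        then have "x \<in> H" using coprime_pow_mem[of H x p k] k xc x H sub_one unfolding Inv_def by auto
        then show ?thesis using x by simp
      qed
    qed
    moreover have H': "finite H" "subgroup H G" "H \<subseteq> A" using H by (auto simp: Inv_def)
    ultimately have "powers x \<inter> H = {\<one>}" using sub_one[OF B(1)] sub_one[OF H'(2)] by blast
    moreover have "powers x \<noteq> {\<one>}" using powers_self[OF xc] x(2) sub_one[OF H'(2)] by auto
    moreover have "Inv (H <#> powers x)"
      unfolding Inv_def using subgroup_set_mult[OF H'(2) B(1) normalizes] set_mult_le[OF A(1) H'(3) BA] finite_set_mult[OF H'(1) B(2)] by blast
    ultimately show ?thesis using B normalizes by blast
  qed
  moreover have "Inv {\<one>}" using triv_subgroup A sub_one by (auto simp: Inv_def)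
  ultimately obtain B where B: "\<And>n. subgroup (B n) G" "\<And>n. normalizes (partial_product {\<one>} B UNIV n) (B n)"
    "\<And>n. B n \<inter> partial_product {\<one>} B UNIV n = {\<one>}" "\<And>n::nat. B n \<noteq> {\<one>}" "\<And>n. Inv (partial_product {\<one>} B UNIV n)"
    using independent_sequence[of Inv "{\<one>}"] by metis
  have "partial_product {\<one>} B UNIV n \<subseteq> A" for n using B(5)[of n] by (simp add: Inv_def)
  from that[OF B(1-4) this] show thesis .
qed

lemma dcc_finite_socle:
  assumes A: "subgroup A G" "commuting A" and d: "dcc {\<one>} A"
  shows "finite (socle A)"
proof (rule ccontr)
  assume "infinite (socle A)"
  then obtain B where B: "\<And>n. subgroup (B n) G" "\<And>n. normalizes (partial_product {\<one>} B UNIV n) (B n)"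
    "\<And>n. B n \<inter> partial_product {\<one>} B UNIV n = {\<one>}" "\<And>n::nat. B n \<noteq> {\<one>}" "\<And>n. partial_product {\<one>} B UNIV n \<subseteq> A"
    using prime_order_sequence[OF A] by metis
  show False using independent_imp_not_dcc[OF triv_subgroup B(1-5)] d by blast
qed

lemma commuting_pow_mult:
  "commuting A \<Longrightarrow> A \<subseteq> carrier G \<Longrightarrow> a \<in> A \<Longrightarrow> b \<in> A \<Longrightarrow> (a \<otimes> b) [^] (n::nat) = a [^] n \<otimes> b [^] n"
  by (rule pow_mult_distrib) (auto simp: commuting_def)

lemma commuting_pow_div:
  "commuting A \<Longrightarrow> subgroup A G \<Longrightarrow> a \<in> A \<Longrightarrow> b \<in> A \<Longrightarrow> (a \<otimes> inv b) [^] (n::nat) = a [^] n \<otimes> inv (b [^] n)"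
  using commuting_pow_mult[of A a "inv b" n] sub_carrier sub_inv[of A b] nat_pow_inv[of b n] mem_carrier_of[of A b] by auto

lemma torsion_part_subgroup: "subgroup A G \<Longrightarrow> commuting A \<Longrightarrow> subgroup (torsion_part A n) G"
proof (rule subgroup_criterion)
  assume A: "subgroup A G" "commuting A"
  note mem_carrier_of[OF A(1), simp]
  show "torsion_part A n \<subseteq> carrier G" by (auto simp: torsion_part_def)
  show "\<one> \<in> torsion_part A n" using sub_one[OF A(1)] by (simp add: torsion_part_def)
  show "inv x \<in> torsion_part A n" if "x \<in> torsion_part A n" for x
    using that sub_inv[OF A(1)] by (simp add: torsion_part_def nat_pow_inv)
  show "x \<otimes> y \<in> torsion_part A n" if "x \<in> torsion_part A n" "y \<in> torsion_part A n" for x y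
    using that sub_mult[OF A(1)] commuting_pow_mult[OF A(2) sub_carrier[OF A(1)]] by (simp add: torsion_part_def)
qed

text \<open>For a prime \<open>p\<close> dividing \<open>n = p m\<close>, the map
  \<open>a \<mapsto> a^p\<close> sends the elements killed by \<open>n\<close> to those killed by
  \<open>m\<close>, and two elements of one fibre differ by an element of the socle.\<close>

lemma finite_torsion_part:
  assumes A: "subgroup A G" "commuting A" and socle: "finite (socle A)" and n: "n > 0"
  shows "finite (torsion_part A n)"
  using n
proof (induction n rule: less_induct)
  case (less n)
  show ?case
  proof (cases "n = 1")
    case True
    then have "torsion_part A n \<subseteq> {\<one>}" using mem_carrier_of[OF A(1)] by (auto simp: torsion_part_def)
    then show ?thesis using finite_subset by blast
  next
    case False
    then obtain p where p: "Factorial_Ring.prime p" "p dvd n" using prime_factor_nat by blast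
    then obtain m where m: "n = p * m" by auto
    have m0: "0 < m" "m < n" using m less.prems prime_gt_1_nat[OF p(1)] by auto
    let ?f = "\<lambda>a. a [^] p"
    have "finite ((?f -` {c}) \<inter> torsion_part A n)" for c
    proof (cases "(?f -` {c}) \<inter> torsion_part A n = {}")
      case True then show ?thesis by simp
    next
      case False
      then obtain b where b: "b \<in> A" "b [^] p = c" by (auto simp: torsion_part_def)
      have "(?f -` {c}) \<inter> torsion_part A n \<subseteq> (\<lambda>u. u \<otimes> b) ` socle A"
      proof
        fix a assume "a \<in> (?f -` {c}) \<inter> torsion_part A n"
        then have a: "a \<in> A" "a [^] p = c" by (auto simp: torsion_part_def)
        then have "(a \<otimes> inv b) [^] p = \<one>" using commuting_pow_div[OF A(2,1) a(1) b(1), of p] a b mem_carrier_of[OF A(1)] by auto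
        then have "a \<otimes> inv b \<in> socle A" using p(1) a b A sub_mult sub_inv by (auto simp: socle_def)
        moreover have "a = (a \<otimes> inv b) \<otimes> b" using a b mem_carrier_of[OF A(1)] by (simp add: m_assoc)
        ultimately show "a \<in> (\<lambda>u. u \<otimes> b) ` socle A" by blast
      qed
      then show ?thesis using socle finite_surj by blast
    qed
    then have "finite ((?f -` torsion_part A m) \<inter> torsion_part A n)"
      using finite_finite_vimage_IntI[of "torsion_part A m" ?f "torsion_part A n"] less.IH m0 by blast
    moreover have "torsion_part A n \<subseteq> (?f -` torsion_part A m) \<inter> torsion_part A n"
      using m sub_pow[OF A(1)] mem_carrier_of[OF A(1)] by (auto simp: torsion_part_def nat_pow_pow)
    ultimately show ?thesis using finite_subset by blast
  qed
qed

definition power_image :: "'a set \<Rightarrow> nat \<Rightarrow> 'a set" where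
  "power_image A n = (\<lambda>a. a [^] n) ` A"

lemma power_image_subset: "subgroup A G \<Longrightarrow> power_image A n \<subseteq> A"
  by (auto simp: power_image_def sub_pow)

lemma power_image_mono: "A \<subseteq> B \<Longrightarrow> power_image A n \<subseteq> power_image B n"
  by (auto simp: power_image_def)

lemma power_image_dvd: "subgroup A G \<Longrightarrow> m dvd n \<Longrightarrow> power_image A n \<subseteq> power_image A m"
proof
  fix x assume A: "subgroup A G" and "m dvd n" "x \<in> power_image A n"
  then obtain k a where "n = k * m" "a \<in> A" "x = a [^] n" by (auto simp: power_image_def elim!: dvdE) (metis mult.commute)
  then have "x = (a [^] k) [^] m" using mem_carrier_of[OF A] by (simp add: nat_pow_pow)
  then show "x \<in> power_image A m" using sub_pow[OF A] \<open>a \<in> A\<close> by (auto simp: power_image_def)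
qed

lemma power_image_subgroup:
  assumes A: "subgroup A G" "commuting A" shows "subgroup (power_image A n) G"
proof (rule subgroup_criterion)
  note mem_carrier_of[OF A(1), simp]
  show "power_image A n \<subseteq> carrier G" by (auto simp: power_image_def)
  show "\<one> \<in> power_image A n" using imageI[OF sub_one[OF A(1)], of "\<lambda>a. a [^] n"] by (simp add: power_image_def)
  show "inv x \<in> power_image A n" if x: "x \<in> power_image A n" for x
  proof -
    obtain a where a: "a \<in> A" "x = a [^] n" using x by (auto simp: power_image_def)
    then have "inv x = (inv a) [^] n" by (simp add: nat_pow_inv)
    then show ?thesis using sub_inv[OF A(1) a(1)] by (auto simp: power_image_def)
  qed
  show "x \<otimes> y \<in> power_image A n" if x: "x \<in> power_image A n" "y \<in> power_image A n" for x y
  proof -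
    obtain a b where a: "a \<in> A" "x = a [^] n" "b \<in> A" "y = b [^] n" using x by (auto simp: power_image_def)
    then have "x \<otimes> y = (a \<otimes> b) [^] n" using commuting_pow_mult[OF A(2) sub_carrier[OF A(1)]] by simp
    then show ?thesis using sub_mult[OF A(1) a(1,3)] by (auto simp: power_image_def)
  qed
qed

lemma power_image_power_image: "subgroup A G \<Longrightarrow> power_image (power_image A m) n = power_image A (m * n)"
  unfolding power_image_def image_image by (intro image_cong) (auto simp: nat_pow_pow mem_carrier_of)

text \<open>Factorial exponents give a descending chain, and every exponent divides a later
  factorial. Where the chain stops, the power subgroup is divisible: taking further powers does not
  change it.\<close>

lemma power_image_stable:
  assumes A: "subgroup A G" "commuting A" and d: "dcc {\<one>} A"
  obtains k where "k > 0" "\<And>l. l > 0 \<Longrightarrow> power_image A (k * l) = power_image A k"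
proof -
  obtain N where N: "\<And>n. n \<ge> N \<Longrightarrow> power_image A (fact n) = power_image A (fact N)"
    using dcc_stable[OF d, of "\<lambda>n. power_image A (fact n)"] power_image_subgroup[OF A] power_image_subset[OF A(1)]
      sub_one[OF power_image_subgroup[OF A]] power_image_dvd[OF A(1)] by (metis dvd_triv_right empty_subsetI fact_Suc insert_subset)
  have "power_image A (fact N * l) = power_image A (fact N)" if "l > 0" for l
  proof
    show "power_image A (fact N * l) \<subseteq> power_image A (fact N)" using power_image_dvd[OF A(1)] by simp
    have "fact N * l dvd fact (N + fact N * l)" by (rule dvd_fact) (use that in auto)
    then show "power_image A (fact N) \<subseteq> power_image A (fact N * l)"
      using power_image_dvd[OF A(1)] N[of "N + fact N * l"] by (metis le_add1)
  qed
  then show ?thesis using that[of "fact N"] by simp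
qed

text \<open>Since \<open>a^k\<close> is also the \<open>k\<close>-th power of some
  \<open>b^k\<close>, the elements \<open>a\<close> and \<open>b^k\<close> differ by an element
  killed by \<open>k\<close>. With a stable exponent this writes the group as a divisible part times
  a part of finite exponent.\<close>

lemma power_image_torsion_part_decomp:
  assumes A: "subgroup A G" "commuting A" and k: "power_image A (k * k) = power_image A k" and a: "a \<in> A"
  obtains j c where "j \<in> power_image A k" "c \<in> torsion_part A k" "a = j \<otimes> c"
proof -
  have "a [^] k \<in> power_image A (k * k)" using a k by (auto simp: power_image_def)
  then obtain b where b: "b \<in> A" "a [^] k = (b [^] k) [^] k" by (auto simp: power_image_def nat_pow_pow mem_carrier_of[OF A(1)])
  let ?j = "b [^] k"
  have j: "?j \<in> A" using sub_pow[OF A(1) b(1)] .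
  note c = mem_carrier_of[OF A(1) a] mem_carrier_of[OF A(1) j]
  have "a \<otimes> inv ?j \<in> torsion_part A k"
    using commuting_pow_div[OF A(2,1) a j, of k] b(2) c sub_mult[OF A(1) a sub_inv[OF A(1) j]] by (simp add: torsion_part_def)
  moreover have "a = ?j \<otimes> (a \<otimes> inv ?j)"
  proof -
    have "?j \<otimes> a = a \<otimes> ?j" using A(2) a j by (auto simp: commuting_def)
    then show ?thesis using c by (metis inv_closed m_assoc r_inv r_one)
  qed
  moreover have "?j \<in> power_image A k" using b by (auto simp: power_image_def)
  ultimately show ?thesis using that by blast
qed

text \<open>Only finitely many primes occur, and \<open>m\<close> is their product. The power
  \<open>k\<close> depends on \<open>a\<close>, because quasicyclic subgroups may be present and
  then no common exponent exists.\<close>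

lemma finite_socle_exponent:
  assumes A: "subgroup A G" "commuting A" "torsion A" and socle: "finite (socle A)"
  obtains m :: nat where "m > 0" "\<And>a. a \<in> A \<Longrightarrow> \<exists>k. a [^] (m ^ k) = \<one>"
proof -
  define P where "P = {p::nat. Factorial_Ring.prime p \<and> (\<exists>a\<in>A. a \<noteq> \<one> \<and> a [^] p = \<one>)}"
  have "finite {p::nat. Factorial_Ring.prime p \<and> a [^] p = \<one>}" if a: "a \<in> A" "a \<noteq> \<one>" for a
  proof -
    have "p = q" if pq: "Factorial_Ring.prime p" "a [^] p = \<one>" "Factorial_Ring.prime q" "a [^] q = \<one>" for p q :: nat
    proof (rule ccontr)
      assume "p \<noteq> q"
      then have "coprime p q" using pq primes_coprime by blast
      then have "a \<in> {\<one>}" using coprime_pow_mem[OF triv_subgroup mem_carrier_of[OF A(1) a(1)]] pq by blast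
      then show False using a by simp
    qed
    then have "{p::nat. Factorial_Ring.prime p \<and> a [^] p = \<one>} \<subseteq> {q}"
      if "Factorial_Ring.prime q" "a [^] q = \<one>" for q :: nat
      using that by blast
    then have "\<exists>q. {p::nat. Factorial_Ring.prime p \<and> a [^] p = \<one>} \<subseteq> {q}" by blast
    then show ?thesis using finite_subset by (metis finite.emptyI finite.insertI)
  qed
  then have "finite (\<Union>a\<in>socle A - {\<one>}. {p::nat. Factorial_Ring.prime p \<and> a [^] p = \<one>})"
    using socle by (auto simp: socle_def)
  moreover have "P \<subseteq> (\<Union>a\<in>socle A - {\<one>}. {p::nat. Factorial_Ring.prime p \<and> a [^] p = \<one>})" by (auto simp: P_def socle_def)
  ultimately have fP: "finite P" using finite_subset by blast
  \<comment> \<open>\<open>P\<close> is the set of primes dividing the order of an element.\<close>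
  define m where "m = \<Prod>P"
  have m0: "m > 0" unfolding m_def by (rule prod_pos) (auto simp: P_def prime_gt_0_nat)
  have "\<exists>k. a [^] (m ^ k) = \<one>" if "a \<in> A" "n > 0" "a [^] (n::nat) = \<one>" for a n
    using that
  proof (induction n arbitrary: a rule: less_induct)
    case (less n)
    have ac: "a \<in> carrier G" using less.prems A mem_carrier_of by blast
    show ?case
    proof (cases "n = 1")
      case True then show ?thesis using less ac by (intro exI[of _ 0]) simp
    next
      case False
      then obtain p where p: "Factorial_Ring.prime p" "p dvd n" using prime_factor_nat by blast
      then obtain l where l: "n = p * l" by auto
      have "0 < l" "l < n" using l less.prems prime_gt_1_nat[OF p(1)] by auto
      moreover have "(a [^] p) [^] l = \<one>" using less.prems l ac by (simp add: nat_pow_pow)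
      ultimately obtain k where k: "(a [^] p) [^] (m ^ k) = \<one>" using less.IH[of l "a [^] p"] sub_pow[OF A(1)] less.prems by blast
      show ?thesis
      proof (cases "p \<in> P")
        case True
        then have "m = p * \<Prod>(P - {p})" using fP unfolding m_def by (simp add: prod.remove[of P p "\<lambda>x. x"])
        then obtain q where q: "m = p * q" by blast
        have "m ^ Suc k = p * m ^ k * q" by (subst power_Suc, subst q) (simp only: mult_ac)
        then have "a [^] (m ^ Suc k) = ((a [^] p) [^] (m ^ k)) [^] q" using ac by (simp only: nat_pow_pow nat_pow_closed)
        then show ?thesis using k by (intro exI[of _ "Suc k"]) simp
      next
        case False
        have "(a [^] (m ^ k)) [^] p = \<one>" using k ac by (simp add: nat_pow_pow mult.commute)
        then have "a [^] (m ^ k) = \<one>" using False p sub_pow[OF A(1) less.prems(1)] by (auto simp: P_def)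
        then show ?thesis by blast
      qed
    qed
  qed
  then show ?thesis using that[OF m0] A(3) unfolding torsion_def by metis
qed

text \<open>The converse of \<open>dcc_finite_socle\<close>, without structure theory. For a
  descending chain \<open>H n\<close>, the finite sets \<open>T k n\<close> record which elements
  killed by \<open>m\<close> are \<open>m^k\<close>-th powers of members of \<open>H n\<close>. Once
  they agree at \<open>n\<close> and \<open>Suc n\<close> for all \<open>k\<close> at once,
  induction on \<open>k\<close> moves every element of \<open>H n\<close> into
  \<open>H (Suc n)\<close>.\<close>

lemma finite_socle_dcc:
  assumes A: "subgroup A G" "commuting A" "torsion A" and socle: "finite (socle A)"
  shows "dcc {\<one>} A"
proof (rule dccI)
  fix H :: "nat \<Rightarrow> 'a set"
  assume H: "\<And>n. subgroup (H n) G" "\<And>n. {\<one>} \<subseteq> H n" "\<And>n. H n \<subseteq> A" "\<And>n. H (Suc n) \<subset> H n"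
  obtain m :: nat where m: "m > 0" "\<And>a. a \<in> A \<Longrightarrow> \<exists>k. a [^] (m ^ k) = \<one>"
    using finite_socle_exponent[OF A socle] by metis
  have fin: "finite (torsion_part A m)" using finite_torsion_part[OF A(1,2) socle m(1)] .
  define T where "T k n = power_image (H n) (m ^ k) \<inter> torsion_part A m" for k n
  have anti: "m \<le> n \<Longrightarrow> H n \<subseteq> H m" for m n using lift_Suc_antimono_le[of H m n] psubset_imp_subset[OF H(4)] by blast
  have T_n: "n \<le> n' \<Longrightarrow> T k n' \<subseteq> T k n" for k n n' unfolding T_def using power_image_mono[OF anti] by blast
  have T_k: "k \<le> k' \<Longrightarrow> T k' n \<subseteq> T k n" for k k' n
    unfolding T_def using power_image_dvd[OF H(1)] by (metis Int_mono le_imp_power_dvd subset_refl)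
  have Tfin: "finite (T k n)" for k n unfolding T_def using fin by blast
  \<comment> \<open>A pair with smallest cardinality makes \<open>T\<close> constant on the quadrant
    beyond it. Only the finitely many rows \<open>k < K\<close> remain, and each of them stabilises
    in \<open>n\<close>.\<close>
  obtain K N where KN: "\<And>k n. card (T K N) \<le> card (T k n)"
    using ex_has_least_nat[of "\<lambda>_. True" "(0,0)" "\<lambda>(k,n). card (T k n)"] by auto
  have big: "T k n = T K N" if "k \<ge> K" "n \<ge> N" for k n
  proof -
    have "T k n \<subseteq> T K N" using T_n[OF that(2)] T_k[OF that(1)] by blast
    then show ?thesis using KN[of k n] card_subset_eq[OF Tfin] card_mono[OF Tfin] by (metis le_antisym)
  qed
  have "\<exists>M. \<forall>k<j. \<forall>n\<ge>M. T k n = T k M" for j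
  proof (induction j)
    case (Suc j)
    then obtain M where M: "\<forall>k<j. \<forall>n\<ge>M. T k n = T k M" by blast
    obtain M' where M': "\<And>n. n \<ge> M' \<Longrightarrow> T j n = T j M'"
    proof (rule antimono_finite_stable[OF fin])
      show "T j n \<subseteq> torsion_part A m" for n by (auto simp: T_def)
      show "T j (Suc n) \<subseteq> T j n" for n by (rule T_n) simp
    qed blast
    have "T k n = T k (max M M')" if kn: "k < Suc j" "n \<ge> max M M'" for k n
    proof (cases "k = j")
      case True
      then show ?thesis using kn M'[of n] M'[of "max M M'"] by simp
    next
      case False
      then have "k < j" using kn by simp
      then have "T k n = T k M" "T k (max M M') = T k M" using kn by (auto intro!: M[rule_format])
      then show ?thesis by simp
    qed
    then show ?case by blast
  qed simp
  then obtain M where M: "\<forall>k<K. \<forall>n\<ge>M. T k n = T k M" by blast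
  define n where "n = max M N"
  have eq: "T k (Suc n) = T k n" for k
  proof (cases "k < K")
    case True
    then have "T k (Suc n) = T k M" "T k n = T k M" by (auto simp: n_def intro!: M[rule_format])
    then show ?thesis by simp
  next
    case False then show ?thesis using big[of k n] big[of k "Suc n"] by (auto simp: n_def)
  qed
  have "b \<in> H n \<Longrightarrow> b [^] (m ^ k) = \<one> \<Longrightarrow> b \<in> H (Suc n)" for k b
  proof (induction k arbitrary: b)
    case 0
    then show ?case using sub_one[OF H(1)] mem_carrier_of[OF H(1)] by simp
  next
    case (Suc k)
    have bA: "b \<in> A" "b \<in> carrier G" using Suc H(3) mem_carrier_of[OF H(1)] by auto
    have "(b [^] (m ^ k)) [^] m = \<one>" using Suc.prems bA by (simp add: nat_pow_pow mult.commute)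
    then have "b [^] (m ^ k) \<in> T k n" using Suc.prems sub_pow[OF A(1) bA(1)] by (auto simp: T_def power_image_def torsion_part_def)
    then have "b [^] (m ^ k) \<in> T k (Suc n)" using eq by simp
    then obtain c where c: "c \<in> H (Suc n)" "b [^] (m ^ k) = c [^] (m ^ k)" by (auto simp: T_def power_image_def)
    have cn: "c \<in> H n" "c \<in> A" "c \<in> carrier G" using c H(3,4) mem_carrier_of[OF H(1)] by auto
    \<comment> \<open>As \<open>b\<close> and \<open>c\<close> have the same \<open>m^k\<close>-th
      power, their quotient falls under the induction hypothesis.\<close>
    have "(b \<otimes> inv c) [^] (m ^ k) = \<one>" using commuting_pow_div[OF A(2,1) bA(1) cn(2)] c cn by simp
    moreover have "b \<otimes> inv c \<in> H n" using sub_mult[OF H(1)] sub_inv[OF H(1)] Suc.prems cn by blast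
    ultimately have "b \<otimes> inv c \<in> H (Suc n)" using Suc.IH by blast
    then show ?case using sg_mult_right_iff[OF H(1) sub_inv[OF H(1) c(1)] bA(2)] by blast
  qed
  then have "H n \<subseteq> H (Suc n)" using m(2) H(3)[of n] by blast
  then show False using H(4)[of n] by blast
qed

section \<open>Centralisers and complements\<close>

definition commutators_in :: "'a set \<Rightarrow> 'a set \<Rightarrow> bool" where
  "commutators_in E M \<longleftrightarrow> (\<forall>x\<in>E. \<forall>y\<in>E. conjg x y \<otimes> inv y \<in> M)"

lemma commutators_in_mono: "commutators_in E M \<Longrightarrow> F \<subseteq> E \<Longrightarrow> M \<subseteq> N \<Longrightarrow> commutators_in F N"
  unfolding commutators_in_def by blast

lemma normalizes_above:
  assumes "commutators_in E M" "subgroup K G" "M \<subseteq> K" "K \<subseteq> E" "E \<subseteq> carrier G"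
  shows "normalizes E K"
proof (rule normalizesI)
  fix x k assume x: "x \<in> E" "k \<in> K"
  then have "conjg x k \<otimes> inv k \<in> K" using assms unfolding commutators_in_def by blast
  then have "(conjg x k \<otimes> inv k) \<otimes> k \<in> K" using x sub_mult[OF assms(2)] by blast
  moreover have "x \<in> carrier G" "k \<in> carrier G" using x assms by auto
  ultimately show "conjg x k \<in> K" by (simp add: m_assoc)
qed

lemma commuting_commutators_in: "commuting A \<Longrightarrow> A \<subseteq> carrier G \<Longrightarrow> commutators_in A {\<one>}"
  unfolding commutators_in_def
proof (intro ballI)
  fix x y assume a: "commuting A" "A \<subseteq> carrier G" "x \<in> A" "y \<in> A"
  then have "x \<otimes> y = y \<otimes> x" "x \<in> carrier G" "y \<in> carrier G" by (auto simp: commuting_def)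
  then have "conjg x y = y" using conjg_eq_self_iff by blast
  then show "conjg x y \<otimes> inv y \<in> {\<one>}" using \<open>y \<in> carrier G\<close> by simp
qed

lemma conjg_pow_Suc: "x \<in> carrier G \<Longrightarrow> a \<in> carrier G \<Longrightarrow> conjg (x [^] Suc n) a = conjg x (conjg (x [^] n) a)"
  by (simp only: nat_pow_Suc2 conjg_conjg nat_pow_closed)

text \<open>\<open>E/M\<close> is an elementary abelian \<open>p\<close>-group, and
  \<open>K/M\<close> is a vector space complement of \<open>L/M\<close> in it. A subgroup maximal
  among those meeting \<open>L\<close> in \<open>M\<close> serves, so that neither the quotient nor
  a basis has to be formed.\<close>

lemma complement_exists:
  assumes E: "subgroup E G" "torsion E" and M: "subgroup M G" "M \<subseteq> L" and L: "subgroup L G" "L \<subseteq> E"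
    and commutators_in: "commutators_in E M" and p: "Factorial_Ring.prime (p::nat)" "\<And>x. x \<in> E \<Longrightarrow> x [^] p \<in> M"
  obtains K where "subgroup K G" "M \<subseteq> K" "K \<subseteq> E" "K \<inter> L = M" "E \<subseteq> L <#> K"
proof -
  define F where "F = {K. subgroup K G \<and> M \<subseteq> K \<and> K \<subseteq> E \<and> K \<inter> L = M}"
  have "M \<in> F" using M L by (auto simp: F_def)
  then have ne: "F \<noteq> {}" by blast
  have ch: "\<Union>C \<in> F" if C: "C \<noteq> {}" "subset.chain F C" for C
  proof -
    have CF: "C \<subseteq> F" and tot: "\<And>U V. U \<in> C \<Longrightarrow> V \<in> C \<Longrightarrow> U \<subseteq> V \<or> V \<subseteq> U"
      using C(2) by (auto simp: subset_chain_def)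
    have "subgroup (\<Union>C) G" by (rule subgroup_Union_chain) (use C CF tot in \<open>auto simp: F_def\<close>)
    then show ?thesis using C(1) CF unfolding F_def by blast
  qed
  obtain K where K: "K \<in> F" and max: "\<And>U. U \<in> F \<Longrightarrow> K \<subseteq> U \<Longrightarrow> U = K"
    using subset_Zorn_nonempty[OF ne ch] by blast
  have K': "subgroup K G" "M \<subseteq> K" "K \<subseteq> E" "K \<inter> L = M" using K by (auto simp: F_def)
  have nzK: "normalizes E K" using normalizes_above[OF commutators_in K'(1-3) sub_carrier[OF E(1)]] .
  have LK: "subgroup (L <#> K) G" using subgroup_set_mult[OF L(1) K'(1)] normalizes_mono[OF nzK L(2)] by blast
  have "E \<subseteq> L <#> K"
  proof
    fix x assume x: "x \<in> E"
    show "x \<in> L <#> K"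
    proof (rule ccontr)
      assume notin: "x \<notin> L <#> K"
      have xc: "x \<in> carrier G" using x E mem_carrier_of by blast
      have P: "subgroup (powers x) G" "powers x \<subseteq> E" using torsion_powers_subgroup[OF E(2,1) x] powers_le[OF E(1) x] by auto
      have S: "subgroup (powers x <#> K) G" using subgroup_set_mult[OF P(1) K'(1)] normalizes_mono[OF nzK P(2)] by blast
      have KS: "K \<subseteq> powers x <#> K" using set_mult_ge2[OF P(1) sub_carrier[OF K'(1)]] .
      have "(powers x <#> K) \<inter> L \<subseteq> M"
      proof
        fix y assume "y \<in> (powers x <#> K) \<inter> L"
        then obtain i k where y: "y \<in> L" "k \<in> K" "y = x [^] (i::nat) \<otimes> k" by (auto simp: set_mult_def powers_def)
        have kc: "k \<in> carrier G" "y \<in> carrier G" using y K' L mem_carrier_of by blast+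
        show "y \<in> M"
        proof (cases "p dvd i")
          case True
          then obtain j where "i = p * j" by auto
          then have "x [^] i = (x [^] p) [^] j" using xc by (simp add: nat_pow_pow)
          then have "x [^] i \<in> M" using sub_pow[OF M(1) p(2)[OF x]] by simp
          then have "y \<in> K" using y K' sub_mult by blast
          then show ?thesis using y K' by blast
        next
          case False
          \<comment> \<open>A power \<open>x^i\<close> with \<open>i\<close> prime to
            \<open>p\<close>, together with \<open>x^p\<close> in \<open>M\<close>, recovers
            \<open>x\<close>. So an element of \<open>powers x <#> K\<close> in \<open>L\<close>
            that involves such a power would put \<open>x\<close> into
            \<open>L <#> K\<close>.\<close>
          then have co: "coprime i p" using prime_imp_coprime_nat[OF p(1)] by (simp add: coprime_commute)
          have "x [^] i = y \<otimes> inv k" using y kc xc by (simp add: m_assoc)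
          then have "x [^] i \<in> L <#> K" using set_multI[of y L "inv k" K] y sub_inv[OF K'(1)] by simp
          moreover have "x [^] p \<in> L <#> K"
            using p(2)[OF x] K'(2) set_mult_ge2[OF L(1) sub_carrier[OF K'(1)]] by blast
          ultimately have "x \<in> L <#> K" using coprime_pow_mem[OF LK xc _ _ co] by blast
          then show ?thesis using notin by blast
        qed
      qed
      moreover have "M \<subseteq> (powers x <#> K) \<inter> L" using KS K'(2) M(2) by blast
      ultimately have "powers x <#> K \<in> F" using S KS K'(2) set_mult_le[OF E(1) P(2) K'(3)] by (auto simp: F_def)
      then have "powers x <#> K = K" using max KS by blast
      then have "x \<in> K" using set_mult_ge1[OF K'(1) sub_carrier[OF P(1)]] powers_self[OF xc] by blast
      then show False using notin set_mult_ge2[OF L(1) sub_carrier[OF K'(1)]] by blast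
    qed
  qed
  then show ?thesis using that K' by blast
qed

text \<open>Write \<open>j = i^m\<close> and put \<open>d = [s,j]\<close>, \<open>e = [s,i]\<close>,
  so that \<open>e^m = d\<close>. By induction \<open>s\<close> fixes \<open>j^m\<close>, hence
  \<open>d^m = 1\<close> and \<open>e\<close> is killed by the square of \<open>m\<close>: this is
  where that exponent comes from. So \<open>s\<close> fixes \<open>e\<close>, and \<open>s^q\<close>
  multiplies \<open>i\<close> by \<open>e^q\<close>, whence \<open>e^q = 1\<close>. Either
  \<open>q\<close> divides \<open>m\<close> and \<open>d = e^m\<close> is trivial, or
  \<open>q\<close> is prime to \<open>m\<close> and \<open>e\<close> itself is trivial.\<close>

lemma prime_order_fix:
  assumes J: "subgroup J G" "commuting J" and div: "power_image J m = J" and tors: "\<And>a. a \<in> J \<Longrightarrow> \<exists>k. a [^] (m ^ k) = \<one>"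
    and s: "s \<in> carrier G" "normalizes {s} J" and fxd: "\<And>a. a \<in> torsion_part J (m\<^sup>2) \<Longrightarrow> conjg s a = a"
    and q: "Factorial_Ring.prime (q::nat)" "\<And>a. a \<in> J \<Longrightarrow> conjg (s [^] q) a = a"
    and j: "j \<in> J"
  shows "conjg s j = j"
proof -
  note jc = mem_carrier_of[OF J(1)]
  have st: "\<forall>j\<in>J. j [^] (m ^ (r + 2)) = \<one> \<longrightarrow> conjg s j = j" for r
  proof (induction r)
    case 0 then show ?case using fxd by (simp add: torsion_part_def power2_eq_square)
  next
    case (Suc r)
    show ?case
    proof (intro ballI impI)
      fix j assume j: "j \<in> J" "j [^] (m ^ (Suc r + 2)) = \<one>"
      obtain i where i: "i \<in> J" "j = i [^] m" using j div by (auto simp: power_image_def)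
      note c = jc[OF j(1)] jc[OF i(1)]
      have sj: "conjg s j \<in> J" "conjg s i \<in> J" using s(2) j i by (auto simp: normalizes_def)
      define d where "d = conjg s j \<otimes> inv j"
      define e where "e = conjg s i \<otimes> inv i"
      have eJ: "e \<in> J" "e \<in> carrier G" unfolding e_def using sub_mult[OF J(1) sj(2) sub_inv[OF J(1) i(1)]] jc by auto
      have "(j [^] m) [^] (m ^ (r + 2)) = \<one>" using j c by (simp add: nat_pow_pow)
      then have "conjg s (j [^] m) = j [^] m" using Suc sub_pow[OF J(1) j(1)] by blast
      then have dm: "d [^] m = \<one>"
        unfolding d_def commuting_pow_div[OF J(2,1) sj(1) j(1)] using c s(1) by (simp flip: conjg_pow)
      have em: "e [^] m = d"
        unfolding e_def commuting_pow_div[OF J(2,1) sj(2) i(1)] d_def i(2) using c s(1) by (simp flip: conjg_pow)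
      have em2: "e [^] (m\<^sup>2) = \<one>" using em dm eJ by (simp add: power2_eq_square flip: nat_pow_pow)
      then have fe: "conjg s e = e" using fxd eJ by (simp add: torsion_part_def)
      have si: "conjg s i = e \<otimes> i" unfolding e_def using c s(1) by (simp add: m_assoc)
      have "conjg (s [^] a) i = e [^] a \<otimes> i" for a :: nat
      proof (induction a)
        case 0 then show ?case using c by simp
      next
        case (Suc a)
        have "conjg (s [^] Suc a) i = conjg s (conjg (s [^] a) i)" using s(1) c by (simp only: conjg_pow_Suc)
        also have "\<dots> = conjg s e [^] a \<otimes> conjg s i" using Suc s(1) c eJ by (simp add: conjg_mult conjg_pow)
        also have "\<dots> = e [^] Suc a \<otimes> i" using fe si eJ c by (simp add: m_assoc)
        finally show ?case .
      qed
      then have "e [^] q \<otimes> i = i" using q(2)[OF i(1)] by simp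
      then have eq: "e [^] q = \<one>" using eJ c by simp
      have "d = \<one>"
      proof (cases "q dvd m")
        case True
        then obtain l where "m = q * l" by auto
        then have "e [^] m = (e [^] q) [^] l" using eJ by (simp add: nat_pow_pow)
        then show ?thesis using em eq by simp
      next
        case False
        then have "coprime q (m\<^sup>2)" using q(1) by (simp add: prime_imp_coprime_nat)
        then have "e \<in> {\<one>}" using coprime_pow_mem[OF triv_subgroup eJ(2)] eq em2 by blast
        then show ?thesis using em by simp
      qed
      then show "conjg s j = j" unfolding d_def using c s(1) by (metis conjg_closed inv_solve_right' l_one one_closed)
    qed
  qed
  obtain k where "j [^] (m ^ k) = \<one>" using tors[OF j] by blast
  then have "j [^] (m ^ (k + 2)) = \<one>" using jc[OF j]
    by (simp only: power_add nat_pow_pow[symmetric] nat_pow_one)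
  then show ?thesis using st[of k] j by blast
qed

lemma fixed_pow: "s \<in> carrier G \<Longrightarrow> a \<in> carrier G \<Longrightarrow> conjg s a = a \<Longrightarrow> conjg (s [^] (n::nat)) a = a"
proof (induction n)
  case (Suc n)
  then show ?case using conjg_conjg[of "s [^] n" s a] by simp
qed simp

text \<open>\<open>A\<close> is its divisible part \<open>J\<close> times the elements killed by
  \<open>k\<close>; on \<open>J\<close> the order of the automorphism is brought down one prime at a
  time. The exponent \<open>N\<close> depends only on \<open>A\<close> and not on \<open>t\<close>,
  which is what makes centralisers have finite index later.\<close>

lemma centralizer_torsion_part:
  assumes A: "subgroup A G" "commuting A" "torsion A" and d: "dcc {\<one>} A"
  obtains N :: nat where "N > 0"
    "\<And>t a. t \<in> carrier G \<Longrightarrow> \<exists>n::nat. n > 0 \<and> t [^] n = \<one> \<Longrightarrow> normalizes {t} A \<Longrightarrow>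
      (\<And>b. b \<in> torsion_part A N \<Longrightarrow> conjg t b = b) \<Longrightarrow> a \<in> A \<Longrightarrow> conjg t a = a"
proof -
  obtain k where k: "k > 0" "\<And>l. l > 0 \<Longrightarrow> power_image A (k * l) = power_image A k"
    using power_image_stable[OF A(1,2) d] by blast
  obtain m :: nat where m: "m > 0" "\<And>a. a \<in> A \<Longrightarrow> \<exists>k. a [^] (m ^ k) = \<one>"
    using finite_socle_exponent[OF A dcc_finite_socle[OF A(1,2) d]] by blast
  define J where "J = power_image A k"
  have J: "subgroup J G" "J \<subseteq> A" unfolding J_def using power_image_subgroup[OF A(1,2)] power_image_subset[OF A(1)] by auto
  have Jab: "commuting J" using commuting_mono[OF A(2) J(2)] .
  have Jdiv: "power_image J m = J" unfolding J_def using power_image_power_image[OF A(1)] k(2)[OF m(1)] by simp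
  have Jt: "\<exists>k. a [^] (m ^ k) = \<one>" if "a \<in> J" for a using m(2) J(2) that by blast
  \<comment> \<open>\<open>torsion_part A N\<close> has to contain both the elements killed by
    \<open>k\<close>, which complement \<open>J\<close>, and those killed by the square of
    \<open>m\<close>, which control the action on \<open>J\<close>.\<close>
  define N where "N = k * m\<^sup>2"
  have sub: "torsion_part A l \<subseteq> torsion_part A N" if "l dvd N" for l
  proof
    fix a assume a: "a \<in> torsion_part A l"
    obtain r where "N = l * r" using \<open>l dvd N\<close> by auto
    moreover have "a \<in> carrier G" using a mem_carrier_of[OF A(1)] by (simp add: torsion_part_def)
    ultimately have "a [^] N = (a [^] l) [^] r" by (simp only: nat_pow_pow)
    then show "a \<in> torsion_part A N" using a by (simp add: torsion_part_def)
  qed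
  have main: "conjg t a = a" if t: "t \<in> carrier G" "\<exists>n::nat. n > 0 \<and> t [^] n = \<one>" "normalizes {t} A"
    and fxd: "\<And>b. b \<in> torsion_part A N \<Longrightarrow> conjg t b = b" and a: "a \<in> A" for t a
  proof -
    define fx where "fx s \<longleftrightarrow> (\<forall>j\<in>J. conjg s j = j)" for s
    have nzpow: "normalizes {t [^] (n::nat)} J" for n
    proof (rule normalizesI)
      have tJ: "conjg t j \<in> J" if j: "j \<in> J" for j
      proof -
        obtain a where "a \<in> A" "j = a [^] k" using j by (auto simp: J_def power_image_def)
        then show ?thesis using t(1,3) mem_carrier_of[OF A(1)] by (auto simp: J_def power_image_def conjg_pow normalizes_def)
      qed
      fix x j assume x: "x \<in> {t [^] n}" "j \<in> J"
      have "conjg (t [^] n) j \<in> J"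
      proof (induction n)
        case 0 then show ?case using x mem_carrier_of[OF J(1)] by simp
      next
        case (Suc n)
        have "conjg (t [^] Suc n) j = conjg t (conjg (t [^] n) j)"
          using t(1) x(2) mem_carrier_of[OF J(1)] by (simp only: conjg_pow_Suc)
        then show ?case using tJ[OF Suc] by simp
      qed
      then show "conjg x j \<in> J" using x by simp
    qed
    obtain n0 :: nat where "n0 > 0" "t [^] n0 = \<one>" using t(2) by blast
    then have "n0 > 0 \<and> fx (t [^] n0)" using mem_carrier_of[OF J(1)] by (simp add: fx_def)
    then have "\<exists>n>0. fx (t [^] (n::nat))" by blast
    then have L: "(LEAST n. 0 < n \<and> fx (t [^] (n::nat))) > 0 \<and> fx (t [^] (LEAST n. 0 < n \<and> fx (t [^] (n::nat))))"
      by (rule LeastI_ex)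
    define n where "n = (LEAST n. 0 < n \<and> fx (t [^] (n::nat)))"
    have n: "n > 0" "fx (t [^] n)" using L by (auto simp: n_def)
    have least: "n \<le> l" if "l > 0" "fx (t [^] l)" for l unfolding n_def by (rule Least_le) (use that in auto)
    \<comment> \<open>If a prime \<open>q\<close> divided the least exponent \<open>n\<close>, then
      \<open>t^(n/q)\<close> would act on \<open>J\<close> with trivial \<open>q\<close>-th power,
      hence trivially by \<open>prime_order_fix\<close>.\<close>
    have "n = 1"
    proof (rule ccontr)
      assume "n \<noteq> 1"
      then obtain q where q: "Factorial_Ring.prime q" "q dvd n" using prime_factor_nat by blast
      then obtain l where l: "n = l * q" by (auto elim!: dvdE simp: mult.commute)
      have l0: "0 < l" "l < n" using l n prime_gt_1_nat[OF q(1)] by auto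
      have "fx (t [^] l)" unfolding fx_def
      proof
        fix j assume j: "j \<in> J"
        show "conjg (t [^] l) j = j"
        proof (rule prime_order_fix[OF J(1) Jab Jdiv Jt _ nzpow _ q(1) _ j])
          show "t [^] l \<in> carrier G" using t by simp
          show "conjg (t [^] l) a = a" if aa: "a \<in> torsion_part J (m\<^sup>2)" for a
          proof -
            have "a \<in> torsion_part A N" using sub[of "m\<^sup>2"] aa J(2) by (auto simp: N_def torsion_part_def)
            then show ?thesis using fixed_pow[of t a l] t(1) fxd mem_carrier_of[OF A(1)] by (auto simp: torsion_part_def)
          qed
          show "conjg ((t [^] l) [^] q) a = a" if "a \<in> J" for a
            using n(2) l that t(1) by (simp add: fx_def nat_pow_pow)
        qed
      qed
      then have "n \<le> l" by (rule least[OF l0(1)])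
      then show False using l0 by simp
    qed
    then have fJ: "conjg t j = j" if "j \<in> J" for j using n(2) that t(1) by (simp add: fx_def)
    obtain j c where jc: "j \<in> power_image A k" "c \<in> torsion_part A k" "a = j \<otimes> c"
      using power_image_torsion_part_decomp[OF A(1,2) k(2)[OF k(1)] a] by blast
    have "conjg t c = c" using fxd sub[of k] jc(2) by (auto simp: N_def)
    moreover have "conjg t j = j" using fJ jc by (simp add: J_def)
    moreover have "j \<in> carrier G" "c \<in> carrier G" using jc mem_carrier_of[OF J(1)] mem_carrier_of[OF A(1)] by (auto simp: J_def torsion_part_def)
    ultimately show ?thesis using jc(3) t(1) by (simp add: conjg_mult)
  qed
  have "N > 0" using k(1) m(1) by (simp add: N_def)
  from that[OF this main] show ?thesis .
qed

section \<open>Invariant abelian subgroups\<close>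

definition commutator :: "'a \<Rightarrow> 'a \<Rightarrow> 'a" where
  "commutator c d = conjg c d \<otimes> inv d"

lemma commutator_closed [simp]: "c \<in> carrier G \<Longrightarrow> d \<in> carrier G \<Longrightarrow> commutator c d \<in> carrier G"
  by (simp add: commutator_def)

lemma commutator_one_iff: "c \<in> carrier G \<Longrightarrow> d \<in> carrier G \<Longrightarrow> commutator c d = \<one> \<longleftrightarrow> c \<otimes> d = d \<otimes> c"
  by (metis conjg_closed conjg_eq_self_iff inv_solve_right commutator_def l_one one_closed)

lemma commutator_sym: "c \<in> carrier G \<Longrightarrow> d \<in> carrier G \<Longrightarrow> commutator c d = \<one> \<longleftrightarrow> commutator d c = \<one>"
  by (auto simp: commutator_one_iff)

lemma conjg_commutator: "x \<in> carrier G \<Longrightarrow> c \<in> carrier G \<Longrightarrow> d \<in> carrier G \<Longrightarrow> conjg x (commutator c d) = commutator (conjg x c) (conjg x d)"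
  by (simp add: commutator_def conjg_def m_assoc inv_mult_group)

lemma commutator_one_conjg: "x \<in> carrier G \<Longrightarrow> c \<in> carrier G \<Longrightarrow> d \<in> carrier G \<Longrightarrow> commutator c d = \<one> \<Longrightarrow> commutator (conjg x c) (conjg x d) = \<one>"
  by (simp flip: conjg_commutator)

lemma commutators_in_commutator: "commutators_in E M \<longleftrightarrow> (\<forall>x\<in>E. \<forall>y\<in>E. commutator x y \<in> M)"
  by (simp add: commutators_in_def commutator_def)

definition centralizer_of :: "'a set \<Rightarrow> 'a set" where
  "centralizer_of U = {g \<in> carrier G. \<forall>u\<in>U. g \<otimes> u = u \<otimes> g}"

lemma centralizer_of_subgroup: "U \<subseteq> carrier G \<Longrightarrow> subgroup (centralizer_of U) G"
proof (rule subgroup_criterion)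
  assume U: "U \<subseteq> carrier G"
  show "centralizer_of U \<subseteq> carrier G" by (auto simp: centralizer_of_def)
  show "\<one> \<in> centralizer_of U" using U by (auto simp: centralizer_of_def)
  show "inv x \<in> centralizer_of U" if x: "x \<in> centralizer_of U" for x
  proof -
    have "inv x \<otimes> u = u \<otimes> inv x" if u: "u \<in> U" for u
    proof -
      have c: "u \<in> carrier G" "x \<in> carrier G" "x \<otimes> u = u \<otimes> x" using u U x by (auto simp: centralizer_of_def)
      have "inv x \<otimes> u = inv x \<otimes> (u \<otimes> x) \<otimes> inv x" using c(1,2) by (simp add: m_assoc)
      also have "\<dots> = u \<otimes> inv x" using c by (simp flip: c(3))
      finally show ?thesis .
    qed
    then show ?thesis using x by (auto simp: centralizer_of_def)
  qed
  show "x \<otimes> y \<in> centralizer_of U" if "x \<in> centralizer_of U" "y \<in> centralizer_of U" for x y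
    using that U unfolding centralizer_of_def by (auto simp: m_assoc subset_iff) (simp flip: m_assoc)
qed

text \<open>Two passes through centralisers: first \<open>U\<close> centralises what it generates,
  then the generated subgroup centralises itself.\<close>

lemma commuting_generate:
  assumes U: "U \<subseteq> carrier G" "commuting U" shows "commuting (generate G U)"
proof -
  have "generate G U \<subseteq> centralizer_of U"
    by (rule generate_subgroup_incl[OF _ centralizer_of_subgroup[OF U(1)]]) (use U in \<open>auto simp: centralizer_of_def commuting_def\<close>)
  then have "U \<subseteq> centralizer_of (generate G U)" using U by (auto simp: centralizer_of_def)
  then have "generate G U \<subseteq> centralizer_of (generate G U)"
    by (rule generate_subgroup_incl[OF _ centralizer_of_subgroup[OF generate_incl[OF U(1)]]])
  then show ?thesis by (auto simp: centralizer_of_def commuting_def)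
qed

lemma normalizes_generate:
  assumes "U \<subseteq> carrier G" "Y \<subseteq> carrier G" "normalizes Y U" shows "normalizes Y (generate G U)"
proof (rule normalizesI)
  fix y a assume y: "y \<in> Y" and a: "a \<in> generate G U"
  let ?S = "{g \<in> carrier G. conjg y g \<in> generate G U}"
  have g: "subgroup (generate G U) G" using generate_is_subgroup[OF assms(1)] .
  have yc: "y \<in> carrier G" using y assms(2) by auto
  have "subgroup ?S G"
    by (rule subgroup_criterion) (auto simp: yc conjg_mult conjg_inv sub_mult[OF g] sub_inv[OF g] sub_one[OF g])
  moreover have "U \<subseteq> ?S" using assms y generate.incl[of _ U G] by (auto simp: normalizes_def)
  ultimately show "conjg y a \<in> generate G U" using generate_subgroup_incl[of U ?S] a by blast
qed

lemma infinite_socle_cases: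
  assumes A: "subgroup A G" and inf: "infinite (socle A)"
  shows "(\<exists>p. Factorial_Ring.prime p \<and> infinite (torsion_part A p)) \<or> infinite {p. Factorial_Ring.prime p \<and> torsion_part A p \<noteq> {\<one>}}"
proof (rule ccontr)
  let ?P = "{p::nat. Factorial_Ring.prime p \<and> torsion_part A p \<noteq> {\<one>}}"
  assume "\<not> ?thesis"
  then have "finite (\<Union>p\<in>?P. torsion_part A p)" by blast
  moreover have "socle A \<subseteq> insert \<one> (\<Union>p\<in>?P. torsion_part A p)"
    by (auto simp: socle_def torsion_part_def)
  ultimately show False using inf finite_subset finite.insertI by metis
qed

lemma set_mult_mono: "A \<subseteq> A' \<Longrightarrow> B \<subseteq> B' \<Longrightarrow> A <#> B \<subseteq> A' <#> B'"
  by (fastforce simp: set_mult_def)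

lemma finite_index_trans:
  assumes "finite_index A B" "finite_index B C" and sg: "A \<subseteq> carrier G" "B \<subseteq> C" "C \<subseteq> carrier G" "subgroup C G"
  shows "finite_index A C"
proof -
  obtain S where S: "finite S" "S \<subseteq> B" "B \<subseteq> A <#> S" using assms(1) unfolding finite_index_def by blast
  obtain R where R: "finite R" "R \<subseteq> C" "C \<subseteq> B <#> R" using assms(2) unfolding finite_index_def by blast
  have "C \<subseteq> (A <#> S) <#> R" using R(3) set_mult_mono[OF S(3) subset_refl] by (rule subset_trans)
  also have "\<dots> = A <#> (S <#> R)" using S R sg by (intro set_mult_assoc) auto
  finally show ?thesis unfolding finite_index_def
    using finite_set_mult[OF S(1) R(1)] set_mult_le[OF sg(4), of S R] S R sg by (intro exI[of _ "S <#> R"]) auto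
qed

lemma finite_index_subset: "finite_index A C \<Longrightarrow> A \<subseteq> B \<Longrightarrow> finite_index B C"
  unfolding finite_index_def using set_mult_mono[of A B] by (meson subset_refl subset_trans)

text \<open>\<open>C/A\<close> is abelian and torsion, so finitely many elements generate a finite
  group over \<open>A\<close>. A new generator \<open>x\<close> multiplies the set of
  representatives by the finite set \<open>powers x\<close>, and centrality lets elements of
  \<open>A\<close> move past these powers.\<close>

lemma fin_gen_mod_central:
  assumes C: "subgroup C G" "torsion C" and A: "subgroup A G" "A \<subseteq> C"
    and central: "\<And>a c. a \<in> A \<Longrightarrow> c \<in> C \<Longrightarrow> a \<otimes> c = c \<otimes> a" and commutators_in: "commutators_in C A"
    and F: "finite F" "F \<subseteq> C"
  shows "\<exists>B. subgroup B G \<and> A \<subseteq> B \<and> F \<subseteq> B \<and> B \<subseteq> C \<and> finite_index A B"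
  using F
proof (induction F)
  case empty
  have "finite_index A A" using finite_index_refl[OF A(1)] .
  then show ?case using A by blast
next
  case (insert x F)
  then obtain B where B: "subgroup B G" "A \<subseteq> B" "F \<subseteq> B" "B \<subseteq> C" "finite_index A B" by blast
  have xC: "x \<in> C" "x \<in> carrier G" using insert mem_carrier_of[OF C(1)] by auto
  have nzB: "normalizes C B" using normalizes_above[OF commutators_in B(1,2,4) sub_carrier[OF C(1)]] .
  have P: "subgroup (powers x) G" "powers x \<subseteq> C" using torsion_powers_subgroup[OF C(2,1) xC(1)] powers_le[OF C(1) xC(1)] by auto
  have fP: "finite (powers x)" using finite_powers[OF xC(2)] C(2) xC(1) unfolding torsion_def by blast
  obtain S where S: "finite S" "S \<subseteq> B" "B \<subseteq> A <#> S" using B(5) unfolding finite_index_def by blast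
  have "subgroup (powers x <#> B) G" using subgroup_set_mult[OF P(1) B(1)] normalizes_mono[OF nzB P(2)] by blast
  moreover have "B \<subseteq> powers x <#> B" using set_mult_ge2[OF P(1) sub_carrier[OF B(1)]] .
  moreover have "x \<in> powers x <#> B" using set_mult_ge1[OF B(1) sub_carrier[OF P(1)]] powers_self[OF xC(2)] by blast
  moreover have "powers x <#> B \<subseteq> C" using set_mult_le[OF C(1) P(2) B(4)] .
  moreover have "finite_index A (powers x <#> B)" unfolding finite_index_def
  proof (intro exI conjI)
    show "finite (powers x <#> S)" using finite_set_mult fP S by blast
    show "powers x <#> S \<subseteq> powers x <#> B" using S(2) by (intro set_mult_mono) auto
    show "powers x <#> B \<subseteq> A <#> (powers x <#> S)"
    proof
      fix z assume "z \<in> powers x <#> B"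
      then obtain u b where u: "u \<in> powers x" "b \<in> B" "z = u \<otimes> b" by (rule set_multE)
      then have "b \<in> A <#> S" using S by blast
      then obtain a s where a: "a \<in> A" "s \<in> S" "b = a \<otimes> s" by (rule set_multE)
      have c: "u \<in> carrier G" "a \<in> carrier G" "s \<in> carrier G" using u a S B A P mem_carrier_of by blast+
      have "a \<otimes> u = u \<otimes> a" using central a u P by blast
      then have "z = a \<otimes> (u \<otimes> s)" using u(3) a(3) c by (simp flip: m_assoc)
      then show "z \<in> A <#> (powers x <#> S)" using a u set_multI by metis
    qed
  qed
  ultimately show ?case using B(2,3) by (intro exI[of _ "powers x <#> B"]) auto
qed

lemma finite_index_one_finite:
  assumes "finite_index {\<one>} B" "B \<subseteq> carrier G" shows "finite B"
proof -
  obtain S where S: "finite S" "S \<subseteq> B" "B \<subseteq> {\<one>} <#> S" using assms(1) unfolding finite_index_def by blast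
  have "B \<subseteq> S"
  proof
    fix b assume "b \<in> B"
    then have "b \<in> {\<one>} <#> S" using S(3) by blast
    then obtain s where "s \<in> S" "b = \<one> \<otimes> s" by (auto simp: set_mult_def)
    then show "b \<in> S" using S(2) assms(2) by auto
  qed
  then show ?thesis using S(1) finite_subset by blast
qed

lemma commuting_fin_gen_finite:
  assumes C: "subgroup C G" "torsion C" "commuting C" and F: "finite F" "F \<subseteq> C"
  shows "finite (generate G F)"
proof -
  have "\<exists>B. subgroup B G \<and> {\<one>} \<subseteq> B \<and> F \<subseteq> B \<and> B \<subseteq> C \<and> finite_index {\<one>} B"
    by (rule fin_gen_mod_central[OF C(1,2) triv_subgroup])
      (use F C sub_one[OF C(1)] mem_carrier_of[OF C(1)] commuting_commutators_in[OF C(3) sub_carrier[OF C(1)]] in auto)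
  then obtain B where B: "subgroup B G" "F \<subseteq> B" "B \<subseteq> C" "finite_index {\<one>} B" by blast
  have "finite B" using finite_index_one_finite[OF B(4) sub_carrier[OF B(1)]] .
  then show ?thesis using generate_subgroup_incl[OF B(2,1)] finite_subset by blast
qed

text \<open>Pigeonhole on the commutator data of partial products: since the members of the sequence commute,
  equal data for \<open>v\<^sub>0\<cdots>v\<^sub>i\<close> and \<open>v\<^sub>0\<cdots>v\<^sub>j\<close> force trivial data for \<open>v\<^sub>i\<^sub>+\<^sub>1\<cdots>v\<^sub>j\<close>.\<close>
lemma isotropic_element:
  assumes Y: "subgroup Y G" "finite Y" and C: "subgroup C G" "torsion C" "normalizes Y C"
    and A: "subgroup A G" "A \<subseteq> C" and central: "\<And>a c. a \<in> A \<Longrightarrow> c \<in> C \<Longrightarrow> a \<otimes> c = c \<otimes> a"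
    and fin: "finite D" and kkD: "\<And>c d. c \<in> C \<Longrightarrow> d \<in> C \<Longrightarrow> commutator c d \<in> D" and DA: "D \<subseteq> A"
    and nfi: "\<not> finite_index A C" and F: "finite F" "F \<subseteq> C"
  obtains w B where "w \<in> C" "\<And>y s. y \<in> Y \<Longrightarrow> s \<in> F \<Longrightarrow> commutator w s = \<one>"
    "\<And>x y. x \<in> Y \<Longrightarrow> y \<in> Y \<Longrightarrow> commutator (conjg x w) (conjg y w) = \<one>"
    "subgroup B G" "A \<subseteq> B" "F \<subseteq> B" "w \<notin> B"
proof -
  note Cc = mem_carrier_of[OF C(1)]
  note Yc = mem_carrier_of[OF Y(1)]
  have commutators_in: "commutators_in C A" using kkD DA by (auto simp: commutators_in_commutator)
  have cjC: "conjg y c \<in> C" if "y \<in> Y" "c \<in> C" for y c using normalizesD[OF C(3)] that by blast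
  have kkA: "commutator c d \<in> A" if "c \<in> C" "d \<in> C" for c d using kkD DA that by blast
  have commutator_l: "commutator (c \<otimes> c') d = commutator c d \<otimes> commutator c' d" if c: "c \<in> C" "c' \<in> C" "d \<in> C" for c c' d
  proof -
    have "commutator (c \<otimes> c') d = conjg c (commutator c' d) \<otimes> commutator c d" using c Cc by (simp add: commutator_def conjg_def m_assoc inv_mult_group)
    also have "conjg c (commutator c' d) = commutator c' d"
      using central[OF kkA[OF c(2,3)] c(1)] conjg_eq_self_iff[of c "commutator c' d"] c Cc by simp
    also have "commutator c' d \<otimes> commutator c d = commutator c d \<otimes> commutator c' d"
      using central[OF kkA[OF c(2,3)]] kkA[OF c(1,3)] A(2) by blast
    finally show ?thesis .
  qed
  have commutator_r: "commutator d (c \<otimes> c') = commutator d c \<otimes> commutator d c'" if c: "c \<in> C" "c' \<in> C" "d \<in> C" for c c' d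
  proof -
    have "commutator d (c \<otimes> c') = commutator d c \<otimes> conjg c (commutator d c')" using c Cc by (simp add: commutator_def conjg_def m_assoc inv_mult_group)
    also have "conjg c (commutator d c') = commutator d c'"
      using central[OF kkA[OF c(3,2)] c(1)] conjg_eq_self_iff[of c "commutator d c'"] c Cc by simp
    finally show ?thesis .
  qed
  have pick: "\<exists>v B. v \<in> C \<and> (\<forall>s\<in>E. commutator v s = \<one>) \<and> subgroup B G \<and> A \<subseteq> B \<and> E \<subseteq> B \<and> v \<notin> B"
    if E: "finite E" "E \<subseteq> C" for E
  proof -
    obtain B where B: "subgroup B G" "A \<subseteq> B" "E \<subseteq> B" "B \<subseteq> C" "finite_index A B"
      using fin_gen_mod_central[OF C(1,2) A central commutators_in E] by blast
    define Z where "Z = {v \<in> C. \<forall>s\<in>E. commutator v s = \<one>}"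
    have "\<not> Z \<subseteq> B"
    proof
      assume ZB: "Z \<subseteq> B"
      \<comment> \<open>Commutators with the members of \<open>E\<close> take finitely many values,
        so the elements of \<open>C\<close> commuting with all of \<open>E\<close> have finite
        index. If they all lay in \<open>B\<close>, then \<open>A\<close> would have finite index in
        \<open>C\<close>. The value \<open>1\<close> off \<open>E\<close> keeps the function space
        finite.\<close>
      define g where "g v = (\<lambda>s. if s \<in> E then commutator v s else \<one>)" for v
      have "g ` C \<subseteq> {h. \<forall>s. (s \<in> E \<longrightarrow> h s \<in> D) \<and> (s \<notin> E \<longrightarrow> h s = \<one>)}"
        using kkD E by (auto simp: g_def)
      then have fg: "finite (g ` C)" using finite_set_of_finite_funs[OF E(1) fin, of \<one>] finite_subset by blast
      have "finite_index B C"
      proof (rule finite_index_by_map[OF B(1) sub_carrier[OF C(1)] fg])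
        fix s t assume st: "s \<in> C" "t \<in> C" "g s = g t"
        have "commutator (s \<otimes> inv t) e = \<one>" if e: "e \<in> E" for e
        proof -
          have eC: "e \<in> C" using e E by blast
          have "commutator s e = commutator t e" using fun_cong[OF st(3), of e] e by (simp add: g_def)
          moreover have "commutator t e \<otimes> commutator (inv t) e = \<one>"
            using commutator_l[OF st(2) sub_inv[OF C(1) st(2)] eC] st(2) eC Cc by (simp add: commutator_def)
          ultimately show ?thesis using commutator_l[OF st(1) sub_inv[OF C(1) st(2)] eC] by simp
        qed
        then have "s \<otimes> inv t \<in> Z" using sub_mult[OF C(1) st(1) sub_inv[OF C(1) st(2)]] by (simp add: Z_def)
        then show "s \<otimes> inv t \<in> B" using ZB by blast
      qed
      then have "finite_index A C" using finite_index_trans[OF B(5)] sub_carrier[OF A(1)] sub_carrier[OF C(1)] B(4) C(1) by blast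
      then show False using nfi by blast
    qed
    then show ?thesis using B unfolding Z_def by blast
  qed
  obtain v Bv where v: "\<And>E. finite E \<Longrightarrow> E \<subseteq> C \<Longrightarrow> v E \<in> C \<and> (\<forall>s\<in>E. commutator (v E) s = \<one>) \<and>
      subgroup (Bv E) G \<and> A \<subseteq> Bv E \<and> E \<subseteq> Bv E \<and> v E \<notin> Bv E"
    using pick by metis
  \<comment> \<open>\<open>E n\<close> collects \<open>F\<close> and all \<open>Y\<close>-conjugates
    of the first \<open>n\<close> chosen elements, so that each new element commutes with every
    conjugate of the earlier ones.\<close>
  define E where "E = rec_nat F (\<lambda>_ E. E \<union> (\<lambda>y. conjg y (v E)) ` Y)"
  have E0: "E 0 = F" and ES: "E (Suc n) = E n \<union> (\<lambda>y. conjg y (v (E n))) ` Y" for n by (simp_all add: E_def)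
  have E: "finite (E n) \<and> E n \<subseteq> C" for n
  proof (induction n)
    case 0 then show ?case using F by (simp add: E0)
  next
    case (Suc n) then show ?case using v[of "E n"] cjC Y(2) by (auto simp: ES)
  qed
  define u where "u n = v (E n)" for n
  note vE = v[OF conjunct1[OF E] conjunct2[OF E]]
  have u: "u n \<in> C" "s \<in> E n \<Longrightarrow> commutator (u n) s = \<one>" "u n \<notin> Bv (E n)" for n s
    using vE[of n] by (auto simp: u_def)
  have Emono: "m \<le> n \<Longrightarrow> E m \<subseteq> E n" for m n by (rule lift_Suc_mono_le[of E]) (auto simp: ES)
  have uu: "commutator (conjg x (u m)) (conjg y (u n)) = \<one>" if mn: "m < n" "x \<in> Y" "y \<in> Y" for x y m n
  proof -
    have "conjg (inv y \<otimes> x) (u m) \<in> E (Suc m)"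
      using sub_mult[OF Y(1) sub_inv[OF Y(1) mn(3)] mn(2)] by (auto simp: ES u_def)
    then have "conjg (inv y \<otimes> x) (u m) \<in> E n" using Emono[of "Suc m" n] mn(1) by auto
    then have "commutator (u n) (conjg (inv y \<otimes> x) (u m)) = \<one>" using u(2) by blast
    then have "commutator (conjg y (u n)) (conjg y (conjg (inv y \<otimes> x) (u m))) = \<one>"
      using commutator_one_conjg u(1) Yc mn Cc by simp
    then have "commutator (conjg y (u n)) (conjg x (u m)) = \<one>" using u(1) Yc mn Cc by (simp add: conjg_conjg)
    then show ?thesis using commutator_sym u(1) Yc mn Cc by simp
  qed
  \<comment> \<open>\<open>w i j\<close> is the product of the \<open>j\<close> factors from
    \<open>u i\<close> to \<open>u (i + j - 1)\<close>.\<close>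
  define w where "w i = rec_nat \<one> (\<lambda>j a. a \<otimes> u (i + j))" for i
  have w0: "w i 0 = \<one>" and wS: "w i (Suc j) = w i j \<otimes> u (i + j)" for i j by (simp_all add: w_def)
  have wC: "w i j \<in> C" for i j by (induction j) (simp_all add: w0 wS sub_one[OF C(1)] sub_mult[OF C(1)] u)
  have w_add: "w 0 (i + j) = w 0 i \<otimes> w i j" for i j
    using wC u(1) Cc by (induction j) (simp_all add: w0 wS m_assoc)
  have uw: "commutator (conjg x (w 0 i)) (conjg y (u n)) = \<one>" if "i \<le> n" "x \<in> Y" "y \<in> Y" for x y i n
    using that(1)
  proof (induction i)
    case 0 then show ?case using u(1) Cc Yc that by (simp add: w0 commutator_def)
  next
    case (Suc i)
    have "conjg x (w 0 (Suc i)) = conjg x (w 0 i) \<otimes> conjg x (u i)" using wC u(1) Cc Yc that by (simp add: wS conjg_mult)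
    then show ?case using Suc uu[of i n x y] commutator_l cjC wC u(1) that by simp
  qed
  have ww: "commutator (conjg x (w 0 i)) (conjg y (w i j)) = \<one>" if "x \<in> Y" "y \<in> Y" for x y i j
  proof (induction j)
    case 0 then show ?case using wC Cc Yc that by (simp add: w0 commutator_def)
  next
    case (Suc j)
    have "conjg y (w i (Suc j)) = conjg y (w i j) \<otimes> conjg y (u (i + j))" using wC u(1) Cc Yc that by (simp add: wS conjg_mult)
    then show ?case using Suc uw[of i "i + j" x y] commutator_r cjC wC u(1) that by simp
  qed
  \<comment> \<open>The data of a product are the commutators of all pairs of its
    \<open>Y\<close>-conjugates. They take values in a finite set, while there are infinitely many
    indices.\<close>
  define dat where "dat n = (\<lambda>(x, y). if (x, y) \<in> Y \<times> Y then commutator (conjg x (w 0 n)) (conjg y (w 0 n)) else \<one>)" for n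
  have "range dat \<subseteq> {h. \<forall>s. (s \<in> Y \<times> Y \<longrightarrow> h s \<in> D) \<and> (s \<notin> Y \<times> Y \<longrightarrow> h s = \<one>)}"
    using kkD cjC wC by (auto simp: dat_def)
  then have "finite (range dat)"
    using finite_set_of_finite_funs[of "Y \<times> Y" D \<one>] Y(2) fin finite_subset by blast
  then have "\<not> inj dat" using finite_imageD[of dat UNIV] by auto
  then obtain i0 j0 where ij0: "i0 \<noteq> j0" "dat i0 = dat j0" by (auto simp: inj_on_def)
  obtain i j where ij: "dat i = dat (i + Suc j)"
  proof (cases "i0 < j0")
    case True then show ?thesis using that[of i0 "j0 - i0 - 1"] ij0 by auto
  next
    case False then show ?thesis using that[of j0 "i0 - j0 - 1"] ij0 by auto
  qed
  let ?w = "w i (Suc j)"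
  show ?thesis
  proof (rule that[of ?w "Bv (E (i + j))"])
    show "?w \<in> C" by (rule wC)
    show "subgroup (Bv (E (i + j))) G" "A \<subseteq> Bv (E (i + j))" using vE by blast+
    show "F \<subseteq> Bv (E (i + j))" using vE[of "i + j"] Emono[of 0 "i + j"] E0 by auto
    show "commutator ?w s = \<one>" if "y \<in> Y" "s \<in> F" for y s
    proof -
      have sC: "s \<in> C" using that F by blast
      have "commutator (w i l) s = \<one>" for l
      proof (induction l)
        case 0 then show ?case using sC Cc by (simp add: w0 commutator_def)
      next
        case (Suc l)
        have "s \<in> E (i + l)" using Emono[of 0 "i + l"] E0 that by auto
        then show ?case using Suc u(1,2) commutator_l[OF wC u(1) sC] by (simp add: wS)
      qed
      then show ?thesis .
    qed
    \<comment> \<open>The last factor \<open>u (i + j)\<close> avoids this subgroup and all earlier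
      factors lie in it. A last factor must exist, hence the length \<open>Suc j\<close>.\<close>
    show "?w \<notin> Bv (E (i + j))"
    proof
      let ?B = "Bv (E (i + j))"
      assume wB: "?w \<in> ?B"
      have B: "subgroup ?B G" "E (i + j) \<subseteq> ?B" using vE by blast+
      have "l \<le> j \<Longrightarrow> w i l \<in> ?B" for l
      proof (induction l)
        case 0 then show ?case using sub_one[OF B(1)] by (simp add: w0)
      next
        case (Suc l)
        have "conjg \<one> (u (i + l)) \<in> E (Suc (i + l))" using sub_one[OF Y(1)] by (auto simp: ES u_def)
        then have "u (i + l) \<in> E (i + j)" using Emono[of "Suc (i + l)" "i + j"] Suc.prems u(1) Cc by auto
        then show ?case using Suc B sub_mult[OF B(1)] by (auto simp: wS)
      qed
      then have "w i j \<in> ?B" by simp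
      then have "u (i + j) \<in> ?B" using wB sg_mult_left_iff[OF B(1), of "w i j" "u (i + j)"] u(1) Cc by (simp add: wS)
      then show False using u(3) by blast
    qed
    show "commutator (conjg x ?w) (conjg y ?w) = \<one>" if xy: "x \<in> Y" "y \<in> Y" for x y
    proof -
      let ?a = "w 0 i"
      have c: "conjg x ?a \<in> C" "conjg y ?a \<in> C" "conjg x ?w \<in> C" "conjg y ?w \<in> C" using cjC wC xy by auto
      have z: "conjg z (w 0 (i + Suc j)) = conjg z ?a \<otimes> conjg z ?w" if "z \<in> Y" for z
        using w_add[of i "Suc j"] wC Cc Yc that by (simp add: conjg_mult)
      have e: "commutator (conjg x ?a) (conjg y ?w) = \<one>" "commutator (conjg x ?w) (conjg y ?a) = \<one>"
        using ww xy ww[OF xy(2,1)] commutator_sym c Cc by blast+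
      have "commutator (conjg x ?a) (conjg y ?a) = commutator (conjg x (w 0 (i + Suc j))) (conjg y (w 0 (i + Suc j)))"
        using fun_cong[OF ij, of "(x, y)"] xy by (simp add: dat_def)
      also have "\<dots> = commutator (conjg x ?a) (conjg y ?a) \<otimes> commutator (conjg x ?w) (conjg y ?w)"
        unfolding z[OF xy(1)] z[OF xy(2)] using e c Cc by (simp add: commutator_l commutator_r sub_mult[OF C(1)])
      finally show ?thesis using c Cc by simp
    qed
  qed
qed

end

section \<open>Commutators, finite index and invariance across an epimorphism\<close>

context partial_epi
begin

lemma commuting_image:
  assumes T: "T \<subseteq> K" and commutators_in: "G.commutators_in T (pullback {\<one>\<^bsub>Q\<^esub>})" shows "Q.commuting (f ` T)"
  unfolding Q.commuting_def
proof (intro ballI)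
  fix a b assume "a \<in> f ` T" "b \<in> f ` T"
  then obtain x y where xy: "x \<in> T" "y \<in> T" "a = f x" "b = f y" by auto
  have K: "x \<in> K" "y \<in> K" using xy T by auto
  have "Q.conjg a b \<otimes>\<^bsub>Q\<^esub> inv\<^bsub>Q\<^esub> b = f (G.conjg x y \<otimes> inv y)"
    using xy K by (simp add: hom f_conjg f_inv G.sub_conjg[OF sub] G.sub_inv[OF sub])
  also have "\<dots> = \<one>\<^bsub>Q\<^esub>" using commutators_in xy by (auto simp: G.commutators_in_def pullback_def)
  finally have "Q.commutator a b = \<one>\<^bsub>Q\<^esub>" by (simp add: Q.commutator_def)
  then show "a \<otimes>\<^bsub>Q\<^esub> b = b \<otimes>\<^bsub>Q\<^esub> a" using Q.commutator_one_iff xy K by simp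
qed

lemma commutators_in_pullback:
  assumes "S \<subseteq> carrier Q" "Q.commuting S" shows "G.commutators_in (pullback S) (pullback {\<one>\<^bsub>Q\<^esub>})"
  unfolding G.commutators_in_def
proof (intro ballI)
  fix x y assume "x \<in> pullback S" "y \<in> pullback S"
  then have xy: "x \<in> K" "y \<in> K" "f x \<in> S" "f y \<in> S" by (auto simp: pullback_def)
  have "f (G.conjg x y \<otimes> inv y) = Q.commutator (f x) (f y)"
    using xy by (simp add: hom f_conjg f_inv G.sub_conjg[OF sub] G.sub_inv[OF sub] Q.commutator_def)
  also have "\<dots> = \<one>\<^bsub>Q\<^esub>" using Q.commutator_one_iff assms xy by (auto simp: Q.commuting_def)
  finally show "G.conjg x y \<otimes> inv y \<in> pullback {\<one>\<^bsub>Q\<^esub>}"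
    using xy by (simp add: pullback_def G.sub_mult[OF sub] G.sub_conjg[OF sub] G.sub_inv[OF sub])
qed

lemma finite_index_image:
  assumes "L \<subseteq> K" "G.finite_index L K" shows "Q.finite_index (f ` L) (carrier Q)"
proof -
  obtain S where S: "finite S" "S \<subseteq> K" "K \<subseteq> L <#> S" using assms(2) unfolding G.finite_index_def by blast
  have "carrier Q \<subseteq> f ` L <#>\<^bsub>Q\<^esub> f ` S"
  proof
    fix q assume "q \<in> carrier Q"
    then obtain x where x: "x \<in> K" "q = f x" using onto by auto
    then have "x \<in> L <#> S" using S by blast
    then obtain l s where ls: "l \<in> L" "s \<in> S" "x = l \<otimes> s" by (rule G.set_multE)
    then have "l \<in> K" "s \<in> K" using S assms(1) by auto
    then have "q = f l \<otimes>\<^bsub>Q\<^esub> f s" using x ls hom by simp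
    then show "q \<in> f ` L <#>\<^bsub>Q\<^esub> f ` S" using Q.set_multI[OF imageI[OF ls(1)] imageI[OF ls(2)], of f f] by simp
  qed
  then show ?thesis unfolding Q.finite_index_def using S by (intro exI[of _ "f ` S"]) auto
qed

lemma finite_index_pullback:
  assumes J: "subgroup J Q" and finite_index: "Q.finite_index J (carrier Q)" shows "G.finite_index (pullback J) K"
proof -
  obtain S where S: "finite S" "S \<subseteq> carrier Q" "carrier Q \<subseteq> J <#>\<^bsub>Q\<^esub> S" using finite_index unfolding Q.finite_index_def by blast
  obtain S' where S': "S' \<subseteq> K" "finite S'" "S = f ` S'" using finite_subset_image[OF S(1)] S(2) onto by metis
  have "K \<subseteq> pullback J <#> S'"
  proof
    fix y assume y: "y \<in> K"
    then have "f y \<in> J <#>\<^bsub>Q\<^esub> S" using S(3) by blast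
    then obtain j s where js: "j \<in> J" "s \<in> S" "f y = j \<otimes>\<^bsub>Q\<^esub> s" by (rule Q.set_multE)
    then obtain t where t: "t \<in> S'" "s = f t" using S' by auto
    have tK: "t \<in> K" using t S' by blast
    have "f (y \<otimes> inv t) = j" using js t tK y Q.mem_carrier_of[OF J js(1)] G.sub_inv[OF sub tK]
      by (simp add: hom f_inv f_closed Q.m_assoc)
    then have "y \<otimes> inv t \<in> pullback J" using js y tK G.sub_mult[OF sub y G.sub_inv[OF sub tK]] by (auto simp: pullback_def)
    moreover have "y = (y \<otimes> inv t) \<otimes> t" using y tK G.mem_carrier_of[OF sub] by (simp add: G.m_assoc)
    ultimately show "y \<in> pullback J <#> S'" using t G.set_multI by metis
  qed
  then show ?thesis unfolding G.finite_index_def using S' pullback_subset by (intro exI[of _ S']) (use S' in auto)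
qed

lemma normalizes_pullback:
  assumes Y: "Y \<subseteq> carrier G" "G.normalizes Y K" "Y \<subseteq> K" and S: "Q.normalizes (f ` Y) S" shows "G.normalizes Y (pullback S)"
  using assms unfolding G.normalizes_def Q.normalizes_def pullback_def by (auto simp: f_conjg subset_iff)

lemma normalizes_image:
  assumes "Y \<subseteq> K" "A \<subseteq> K" "G.normalizes Y A" shows "Q.normalizes (f ` Y) (f ` A)"
  using assms unfolding G.normalizes_def Q.normalizes_def by (auto simp flip: f_conjg simp: subset_iff)

end

context group
begin

lemma commutator_pow:
  assumes "c \<in> carrier G" "d \<in> carrier G" "c \<otimes> commutator c d = commutator c d \<otimes> c"
  shows "commutator (c [^] (n::nat)) d = commutator c d [^] n"
proof -
  have k: "conjg c (commutator c d) = commutator c d" using assms conjg_eq_self_iff by simp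
  have cd: "conjg c d = commutator c d \<otimes> d" using assms by (simp add: commutator_def m_assoc)
  have "conjg (c [^] n) d = commutator c d [^] n \<otimes> d"
  proof (induction n)
    case (Suc n)
    have "conjg (c [^] Suc n) d = conjg c (commutator c d [^] n \<otimes> d)" using Suc assms by (simp only: conjg_pow_Suc)
    also have "\<dots> = commutator c d [^] n \<otimes> (commutator c d \<otimes> d)" using assms k cd by (simp add: conjg_mult conjg_pow)
    finally show ?case using assms by (simp add: m_assoc)
  qed (use assms in simp)
  then have "commutator (c [^] n) d = (commutator c d [^] n \<otimes> d) \<otimes> inv d" by (simp add: commutator_def)
  then show ?thesis using assms by (simp add: m_assoc)
qed

text \<open>Commutators of \<open>C\<close> are killed by \<open>p\<close> and lie in
  \<open>A\<close>, so commutation is an alternating form with finitely many values on the infinite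
  group \<open>C/A\<close>. A maximal abelian \<open>Y\<close>-invariant \<open>T\<close> above
  \<open>A\<close> cannot have finite index over \<open>A\<close>, because
  \<open>isotropic_element\<close> would enlarge it. An abelian group of infinite index over
  \<open>A\<close> whose \<open>p\<close>-th powers lie in \<open>A\<close> violates the minimal
  condition.\<close>

lemma central_exponent_p_extension:
  assumes Y: "subgroup Y G" "finite Y" and C: "subgroup C G" "torsion C" "normalizes Y C"
    and A: "subgroup A G" "A \<subseteq> C" "normalizes Y A" and central: "\<And>a c. a \<in> A \<Longrightarrow> c \<in> C \<Longrightarrow> a \<otimes> c = c \<otimes> a"
    and commutators_in: "commutators_in C A" and dcc: "dcc {\<one>} A" and nfi: "\<not> finite_index A C"
    and p: "(p::nat) > 0" "\<And>c. c \<in> C \<Longrightarrow> c [^] p \<in> A"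
  obtains T where "subgroup T G" "T \<subseteq> C" "commuting T" "normalizes Y T" "\<not> dcc {\<one>} T"
proof -
  note Cc = mem_carrier_of[OF C(1)]
  note Yc = mem_carrier_of[OF Y(1)]
  have abA: "commuting A" using central A(2) by (auto simp: commuting_def)
  have fin: "finite (torsion_part A p)" using finite_torsion_part[OF A(1) abA dcc_finite_socle[OF A(1) abA dcc] p(1)] .
  have kkD: "commutator c d \<in> torsion_part A p" if c: "c \<in> C" "d \<in> C" for c d
  proof -
    have k: "commutator c d \<in> A" using commutators_in c by (simp add: commutators_in_commutator)
    have "commutator c d [^] p = commutator (c [^] p) d" using commutator_pow[of c d p] central[OF k c(1)] c Cc by simp
    also have "\<dots> = \<one>" using central[OF p(2)[OF c(1)] c(2)] commutator_one_iff c Cc by simp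
    finally show ?thesis using k by (simp add: torsion_part_def)
  qed
  define F where "F = {T. subgroup T G \<and> A \<subseteq> T \<and> T \<subseteq> C \<and> commuting T \<and> normalizes Y T}"
  have "A \<in> F" using A abA by (auto simp: F_def)
  then have ne: "F \<noteq> {}" by blast
  have ch: "\<Union>\<C> \<in> F" if \<C>: "\<C> \<noteq> {}" "subset.chain F \<C>" for \<C>
  proof -
    have CF: "\<C> \<subseteq> F" and tot: "\<And>U V. U \<in> \<C> \<Longrightarrow> V \<in> \<C> \<Longrightarrow> U \<subseteq> V \<or> V \<subseteq> U"
      using \<C>(2) by (auto simp: subset_chain_def)
    have "subgroup (\<Union>\<C>) G" by (rule subgroup_Union_chain) (use \<C> CF tot in \<open>auto simp: F_def\<close>)
    moreover have "commuting (\<Union>\<C>)" unfolding commuting_def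
    proof (intro ballI)
      fix a b assume "a \<in> \<Union>\<C>" "b \<in> \<Union>\<C>"
      then obtain U V where UV: "U \<in> \<C>" "V \<in> \<C>" "a \<in> U" "b \<in> V" by blast
      then have "commuting U" "commuting V" using CF by (auto simp: F_def)
      then show "a \<otimes> b = b \<otimes> a" using tot[OF UV(1,2)] UV(3,4) unfolding commuting_def by blast
    qed
    moreover have "normalizes Y (\<Union>\<C>)"
    proof (rule normalizesI)
      fix y a assume ya: "y \<in> Y" "a \<in> \<Union>\<C>"
      then obtain U where U: "U \<in> \<C>" "a \<in> U" by blast
      then have "normalizes Y U" using CF by (auto simp: F_def)
      then show "conjg y a \<in> \<Union>\<C>" using U normalizesD ya(1) by blast
    qed
    moreover have "A \<subseteq> \<Union>\<C>" "\<Union>\<C> \<subseteq> C" using \<C>(1) CF unfolding F_def by blast+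
    ultimately show ?thesis by (simp add: F_def)
  qed
  obtain T where T: "T \<in> F" and max: "\<And>U. U \<in> F \<Longrightarrow> T \<subseteq> U \<Longrightarrow> U = T"
    using subset_Zorn_nonempty[OF ne ch] by blast
  have T': "subgroup T G" "A \<subseteq> T" "T \<subseteq> C" "commuting T" "normalizes Y T" using T by (auto simp: F_def)
  have nfiT: "\<not> finite_index A T"
  proof
    assume "finite_index A T"
    then obtain S where S: "finite S" "S \<subseteq> T" "T \<subseteq> A <#> S" unfolding finite_index_def by blast
    obtain w B where w: "w \<in> C" "\<And>y s. y \<in> Y \<Longrightarrow> s \<in> S \<Longrightarrow> commutator w s = \<one>"
      "\<And>x y. x \<in> Y \<Longrightarrow> y \<in> Y \<Longrightarrow> commutator (conjg x w) (conjg y w) = \<one>"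
      and B: "subgroup B G" "A \<subseteq> B" "S \<subseteq> B" "w \<notin> B"
      by (rule isotropic_element[OF Y C A(1,2) central fin kkD _ nfi S(1)]) (use S(2) T'(3) in \<open>auto simp: torsion_part_def\<close>)
    have y1: "\<one> \<in> Y" by (rule sub_one[OF Y(1)])
    have wT: "commutator w t = \<one>" if t: "t \<in> T" for t
    proof -
      have "t \<in> A <#> S" using t S by blast
      then obtain a s where as: "a \<in> A" "s \<in> S" "t = a \<otimes> s" by (rule set_multE)
      have c: "a \<in> carrier G" "s \<in> carrier G" "w \<in> carrier G" "s \<in> C" using as S T' w(1) mem_carrier_of[OF A(1)] Cc by auto
      have "conjg w s = s" using w(2)[OF y1 as(2)] commutator_one_iff[of w s] conjg_eq_self_iff[of w s] c by simp
      moreover have "conjg w a = a" using central[OF as(1) w(1)] conjg_eq_self_iff[of w a] c by simp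
      ultimately show ?thesis using as(3) c by (simp add: commutator_def conjg_mult)
    qed
    define W where "W = (\<lambda>y. conjg y w) ` Y"
    have WC: "W \<subseteq> C" using normalizesD[OF C(3)] w(1) by (auto simp: W_def)
    have TW: "T \<union> W \<subseteq> carrier G" using WC T' sub_carrier[OF C(1)] by auto
    have WT: "commutator v t = \<one>" if vt: "v \<in> W" "t \<in> T" for v t
    proof -
      obtain y where y: "y \<in> Y" "v = conjg y w" using vt(1) by (auto simp: W_def)
      have c: "y \<in> carrier G" "t \<in> carrier G" "w \<in> carrier G" using y Yc vt T' w(1) Cc by auto
      have "conjg (inv y) t \<in> T" using normalizesD[OF T'(5) sub_inv[OF Y(1) y(1)] vt(2)] .
      then have "commutator (conjg y w) (conjg y (conjg (inv y) t)) = \<one>"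
        by (intro commutator_one_conjg[OF c(1,3) _ wT]) (use c in auto)
      then show ?thesis using y c by simp
    qed
    have "commuting (T \<union> W)" unfolding commuting_def
    proof (intro ballI)
      fix a b assume ab: "a \<in> T \<union> W" "b \<in> T \<union> W"
      have c: "a \<in> carrier G" "b \<in> carrier G" using ab TW by auto
      consider "a \<in> T" "b \<in> T" | "a \<in> W" "b \<in> T" | "a \<in> T" "b \<in> W" | "a \<in> W" "b \<in> W" using ab by blast
      then show "a \<otimes> b = b \<otimes> a"
      proof cases
        case 1 then show ?thesis using T'(4) by (auto simp: commuting_def)
      next
        case 2 then show ?thesis using WT commutator_one_iff c by blast
      next
        case 3 then have "commutator b a = \<one>" using WT by blast
        then show ?thesis using commutator_one_iff c by simp
      next
        case 4 then have "commutator a b = \<one>" using w(3) by (auto simp: W_def)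
        then show ?thesis using commutator_one_iff c by simp
      qed
    qed
    then have ab: "commuting (generate G (T \<union> W))" using commuting_generate TW by blast
    have "normalizes Y W"
    proof (rule normalizesI)
      fix y v assume y: "y \<in> Y" "v \<in> W"
      then obtain z where z: "z \<in> Y" "v = conjg z w" by (auto simp: W_def)
      then have "conjg y v = conjg (y \<otimes> z) w" using y Yc w(1) Cc by (simp add: conjg_conjg)
      then show "conjg y v \<in> W" using sub_mult[OF Y(1) y(1) z(1)] by (auto simp: W_def)
    qed
    then have "normalizes Y (T \<union> W)" using T'(5) by (auto simp: normalizes_def)
    then have nzg: "normalizes Y (generate G (T \<union> W))" using normalizes_generate TW sub_carrier[OF Y(1)] by blast
    have sub: "T \<union> W \<subseteq> generate G (T \<union> W)" by (auto intro: generate.incl)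
    have "generate G (T \<union> W) \<in> F"
      unfolding F_def using ab nzg sub T' generate_is_subgroup[OF TW] generate_subgroup_incl[OF _ C(1), of "T \<union> W"] WC by auto
    then have "generate G (T \<union> W) = T" using max sub by blast
    moreover have "w \<in> W" unfolding W_def using y1 w(1) Cc by (intro image_eqI[of _ _ \<one>]) auto
    ultimately have "w \<in> T" using sub by blast
    then have "w \<in> A <#> S" using S by blast
    then have "w \<in> B" using set_mult_le[OF B(1,2,3)] by blast
    then show False using B by blast
  qed
  have "\<not> dcc {\<one>} T"
  proof
    assume d: "dcc {\<one>} T"
    obtain k where k: "k > 0" "\<And>l. l > 0 \<Longrightarrow> power_image T (k * l) = power_image T k"
      using power_image_stable[OF T'(1,4) d] by blast
    \<comment> \<open>The stable power \<open>T^k\<close> equals \<open>T^(k p)\<close>, and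
      \<open>p\<close>-th powers lie in \<open>A\<close>. Hence \<open>T\<close> is covered by
      \<open>A\<close> and the finite \<open>k\<close>-torsion of \<open>T\<close>.\<close>
    have JA: "power_image T k \<subseteq> A"
    proof -
      have "power_image T k = power_image T (k * p)" using k(2)[OF p(1)] by simp
      also have "\<dots> \<subseteq> power_image T p" by (rule power_image_dvd[OF T'(1)]) simp
      also have "\<dots> \<subseteq> A" using p(2) T'(3) by (auto simp: power_image_def)
      finally show ?thesis .
    qed
    have "finite (torsion_part T k)" using finite_torsion_part[OF T'(1,4) dcc_finite_socle[OF T'(1,4) d] k(1)] .
    moreover have "T \<subseteq> A <#> torsion_part T k"
    proof
      fix t assume t: "t \<in> T"
      obtain j c where "j \<in> power_image T k" "c \<in> torsion_part T k" "t = j \<otimes> c"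
        using power_image_torsion_part_decomp[OF T'(1,4) k(2)[OF k(1)] t] by blast
      then show "t \<in> A <#> torsion_part T k" using JA set_multI by blast
    qed
    ultimately have "finite_index A T" unfolding finite_index_def by (intro exI[of _ "torsion_part T k"]) (auto simp: torsion_part_def)
    then show False using nfiT by blast
  qed
  then show ?thesis using that T' by blast
qed

text \<open>With the minimal condition, all orders of elements of \<open>T\<close> divide powers of
  one \<open>m\<close>. An element outside \<open>A\<close> whose \<open>p\<close>-th power lies in
  \<open>A\<close> forces \<open>p\<close> to divide \<open>m\<close>.\<close>

lemma infinite_primes_not_dcc:
  assumes T: "subgroup T G" "commuting T" "torsion T" and A: "subgroup A G"
    and inf: "infinite {p::nat. Factorial_Ring.prime p \<and> (\<exists>c\<in>T. c \<notin> A \<and> c [^] p \<in> A)}"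
  shows "\<not> dcc {\<one>} T"
proof
  assume d: "dcc {\<one>} T"
  obtain m :: nat where m: "m > 0" "\<And>a. a \<in> T \<Longrightarrow> \<exists>k. a [^] (m ^ k) = \<one>"
    using finite_socle_exponent[OF T dcc_finite_socle[OF T(1,2) d]] by blast
  have "{p::nat. Factorial_Ring.prime p \<and> (\<exists>c\<in>T. c \<notin> A \<and> c [^] p \<in> A)} \<subseteq> {..m}"
  proof (intro subsetI, elim CollectE conjE bexE)
    fix p :: nat and c assume p: "Factorial_Ring.prime p" and c: "c \<in> T" "c \<notin> A" "c [^] p \<in> A"
    have "p dvd m"
    proof (rule ccontr)
      assume "\<not> p dvd m"
      obtain k where k: "c [^] (m ^ k) = \<one>" using m(2) c by blast
      have "coprime p (m ^ k)" using prime_imp_coprime_nat[OF p \<open>\<not> p dvd m\<close>] by simp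
      moreover have "c [^] (m ^ k) \<in> A" using k sub_one[OF A] by simp
      ultimately have "c \<in> A" using coprime_pow_mem[OF A mem_carrier_of[OF T(1) c(1)] c(3)] by blast
      then show False using c by blast
    qed
    then show "p \<in> {..m}" using m(1) by (simp add: dvd_imp_le)
  qed
  then show False using inf finite_subset by blast
qed

text \<open>The socle of \<open>C/A\<close> is infinite in one of two ways. Infinitely many elements
  for one prime lead to \<open>central_exponent_p_extension\<close>. With infinitely many primes,
  the finitely many that occur in \<open>A\<close> can be discarded: on the preimage of the
  remaining part, a commutator is an element of \<open>A\<close> whose order is prime to all primes
  of \<open>A\<close>, hence trivial.\<close>

lemma central_extension_abelian:
  assumes Y: "subgroup Y G" "finite Y" and C: "subgroup C G" "torsion C" "normalizes Y C"
    and A: "subgroup A G" "A \<subseteq> C" "normalizes Y A" and central: "\<And>a c. a \<in> A \<Longrightarrow> c \<in> C \<Longrightarrow> a \<otimes> c = c \<otimes> a"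
    and commutators_in: "commutators_in C A" and dcc: "dcc {\<one>} A" and ndcc: "\<not> dcc A C"
  obtains T where "subgroup T G" "T \<subseteq> C" "commuting T" "normalizes Y T" "\<not> dcc {\<one>} T"
proof -
  note Cc = mem_carrier_of[OF C(1)]
  have abA: "commuting A" using central A(2) by (auto simp: commuting_def)
  have perA: "torsion A" using torsion_mono[OF C(2) A(2)] .
  have nzCA: "normalizes C A" using normalizes_above[OF commutators_in A(1) subset_refl A(2) sub_carrier[OF C(1)]] .
  obtain Q :: "'a set monoid" and f where Q: "partial_epi G Q C f" and ker: "\<And>x. x \<in> C \<Longrightarrow> f x = \<one>\<^bsub>Q\<^esub> \<longleftrightarrow> x \<in> A"
    using quotient_exists[OF normal_inI[OF A(1) C(1) A(2) nzCA]] by metis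
  interpret E: partial_epi G Q C f by (rule Q)
  have pb1: "E.pullback {\<one>\<^bsub>Q\<^esub>} = A" using ker A(2) by (auto simp: E.pullback_def)
  have abQ: "E.Q.commuting (carrier Q)" using E.commuting_image[of C] commutators_in pb1 E.onto by simp
  have perQ: "E.Q.torsion (carrier Q)" using E.torsion_quotient C(2) by blast
  have "\<not> E.Q.dcc {\<one>\<^bsub>Q\<^esub>} (carrier Q)"
    using E.dcc_pullback[of "carrier Q" "{\<one>\<^bsub>Q\<^esub>}"] ndcc pb1 E.pullback_carrier E.Q.triv_subgroup by simp
  then have inf: "infinite (E.Q.socle (carrier Q))"
    using E.Q.finite_socle_dcc[OF E.Q.subgroup_self abQ perQ] by blast
  from E.Q.infinite_socle_cases[OF E.Q.subgroup_self inf] show ?thesis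
  proof (elim disjE exE conjE)
    fix p :: nat assume p: "Factorial_Ring.prime p" and ip: "infinite (E.Q.torsion_part (carrier Q) p)"
    define C0 where "C0 = E.pullback (E.Q.torsion_part (carrier Q) p)"
    have C0: "subgroup C0 G" unfolding C0_def by (intro E.pullback_subgroup E.Q.torsion_part_subgroup E.Q.subgroup_self abQ)
    have C0C: "C0 \<subseteq> C" unfolding C0_def by (rule E.pullback_subset)
    have C0_iff: "c \<in> C0 \<longleftrightarrow> c \<in> C \<and> c [^] p \<in> A" for c
      using ker[of "c [^] p"] sub_pow[OF C(1)] by (auto simp: C0_def E.pullback_def E.Q.torsion_part_def E.f_pow)
    have AC0: "A \<subseteq> C0" using A(2) sub_pow[OF A(1)] by (auto simp: C0_iff)
    have nzC0: "normalizes Y C0"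
      using normalizesD[OF C(3)] normalizesD[OF A(3)] mem_carrier_of[OF Y(1)] Cc by (auto simp: normalizes_def C0_iff simp flip: conjg_pow)
    have "\<not> finite_index A C0"
    proof
      assume "finite_index A C0"
      then obtain S where S: "finite S" "S \<subseteq> C0" "C0 \<subseteq> A <#> S" unfolding finite_index_def by blast
      have "f ` C0 \<subseteq> f ` S"
      proof
        fix z assume "z \<in> f ` C0"
        then obtain c where c: "c \<in> C0" "z = f c" by blast
        then have "c \<in> A <#> S" using S by blast
        then obtain a s where as: "a \<in> A" "s \<in> S" "c = a \<otimes> s" by (rule set_multE)
        then have "a \<in> C" "s \<in> C" using A(2) S C0C by auto
        moreover have "f a = \<one>\<^bsub>Q\<^esub>" using ker[OF \<open>a \<in> C\<close>] as by simp
        ultimately have "a \<in> C" "s \<in> C" "f a = \<one>\<^bsub>Q\<^esub>" by auto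
        then have "z = f s" using c as by (simp add: E.hom)
        then show "z \<in> f ` S" using as by blast
      qed
      moreover have "f ` C0 = E.Q.torsion_part (carrier Q) p" unfolding C0_def by (rule E.image_pullback) (auto simp: E.Q.torsion_part_def)
      ultimately show False using ip S(1) finite_subset by (metis finite_imageI)
    qed
    then obtain T where T: "subgroup T G" "T \<subseteq> C0" "commuting T" "normalizes Y T" "\<not> dcc {\<one>} T"
      using central_exponent_p_extension[OF Y C0 torsion_mono[OF C(2) C0C] nzC0 A(1) AC0 A(3) _ commutators_in_mono[OF commutators_in C0C subset_refl] dcc _ prime_gt_0_nat[OF p]]
        central C0C C0_iff by blast
    then show ?thesis using that C0C by blast
  next
    assume ip: "infinite {p. Factorial_Ring.prime p \<and> E.Q.torsion_part (carrier Q) p \<noteq> {\<one>\<^bsub>Q\<^esub>}}"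
    obtain m :: nat where m: "m > 0" "\<And>a. a \<in> A \<Longrightarrow> \<exists>k. a [^] (m ^ k) = \<one>"
      using finite_socle_exponent[OF A(1) abA perA dcc_finite_socle[OF A(1) abA dcc]] by blast
    have copA: "a = \<one>" if a: "a \<in> A" "a [^] (n::nat) = \<one>" "coprime n m" for a n
    proof -
      obtain k where k: "a [^] (m ^ k) = \<one>" using m(2) a by blast
      have "coprime n (m ^ k)" using a(3) by simp
      then have "a \<in> {\<one>}" using coprime_pow_mem[OF triv_subgroup mem_carrier_of[OF A(1) a(1)]] a(2) k by blast
      then show ?thesis by simp
    qed
    define R where "R = {q \<in> carrier Q. \<exists>n::nat. coprime n m \<and> q [^]\<^bsub>Q\<^esub> n = \<one>\<^bsub>Q\<^esub>}"
    have R: "subgroup R Q"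
    proof (rule E.Q.subgroup_criterion)
      show "R \<subseteq> carrier Q" by (auto simp: R_def)
      show "\<one>\<^bsub>Q\<^esub> \<in> R" unfolding R_def by (auto intro!: exI[of _ 1])
      show "inv\<^bsub>Q\<^esub> x \<in> R" if "x \<in> R" for x using that by (auto simp: R_def E.Q.nat_pow_inv)
      show "x \<otimes>\<^bsub>Q\<^esub> y \<in> R" if xy: "x \<in> R" "y \<in> R" for x y
      proof -
        obtain n l :: nat where n: "x \<in> carrier Q" "coprime n m" "x [^]\<^bsub>Q\<^esub> n = \<one>\<^bsub>Q\<^esub>"
          "y \<in> carrier Q" "coprime l m" "y [^]\<^bsub>Q\<^esub> l = \<one>\<^bsub>Q\<^esub>" using xy unfolding R_def by blast
        have "(x \<otimes>\<^bsub>Q\<^esub> y) [^]\<^bsub>Q\<^esub> (n * l) = (x [^]\<^bsub>Q\<^esub> n) [^]\<^bsub>Q\<^esub> l \<otimes>\<^bsub>Q\<^esub> (y [^]\<^bsub>Q\<^esub> l) [^]\<^bsub>Q\<^esub> n"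
        proof -
          have "y [^]\<^bsub>Q\<^esub> (n * l) = (y [^]\<^bsub>Q\<^esub> l) [^]\<^bsub>Q\<^esub> n" using n(4) by (subst mult.commute) (simp only: E.Q.nat_pow_pow)
          moreover have "x [^]\<^bsub>Q\<^esub> (n * l) = (x [^]\<^bsub>Q\<^esub> n) [^]\<^bsub>Q\<^esub> l" using n(1) by (simp only: E.Q.nat_pow_pow)
          ultimately show ?thesis using E.Q.commuting_pow_mult[OF abQ subset_refl n(1,4), of "n * l"] by simp
        qed
        also have "\<dots> = \<one>\<^bsub>Q\<^esub>" using n by simp
        finally show ?thesis using n by (auto simp: R_def intro!: exI[of _ "n * l"])
      qed
    qed
    define T where "T = E.pullback R"
    have T: "subgroup T G" "T \<subseteq> C" unfolding T_def using E.pullback_subgroup[OF R] E.pullback_subset by auto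
    have T_iff: "c \<in> T \<longleftrightarrow> c \<in> C \<and> (\<exists>n::nat. coprime n m \<and> c [^] n \<in> A)" for c
    proof -
      have "f c [^]\<^bsub>Q\<^esub> n = \<one>\<^bsub>Q\<^esub> \<longleftrightarrow> c [^] n \<in> A" if "c \<in> C" for n :: nat
        using ker[OF sub_pow[OF C(1) that]] that by (simp add: E.f_pow)
      then show ?thesis by (auto simp: T_def R_def E.pullback_def)
    qed
    have nzT: "normalizes Y T"
    proof (rule normalizesI)
      fix y c assume y: "y \<in> Y" "c \<in> T"
      then obtain n :: nat where n: "c \<in> C" "coprime n m" "c [^] n \<in> A" by (auto simp: T_iff)
      have "conjg y c [^] n = conjg y (c [^] n)" using y n mem_carrier_of[OF Y(1)] Cc by (simp add: conjg_pow)
      then have "conjg y c [^] n \<in> A" using normalizesD[OF A(3) y(1) n(3)] by simp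
      then show "conjg y c \<in> T" using n normalizesD[OF C(3) y(1) n(1)] by (auto simp: T_iff)
    qed
    have abT: "commuting T" unfolding commuting_def
    proof (intro ballI)
      fix c d assume cd: "c \<in> T" "d \<in> T"
      then obtain n :: nat where n: "c \<in> C" "coprime n m" "c [^] n \<in> A" and d: "d \<in> C" by (auto simp: T_iff)
      have k: "commutator c d \<in> A" using commutators_in n d by (simp add: commutators_in_commutator)
      have "commutator c d [^] n = commutator (c [^] n) d" using commutator_pow[of c d n] central[OF k n(1)] n d Cc by simp
      also have "\<dots> = \<one>" using central[OF n(3) d] commutator_one_iff n d Cc by simp
      finally have "commutator c d = \<one>" using copA[OF k _ n(2)] by blast
      then show "c \<otimes> d = d \<otimes> c" using commutator_one_iff n d Cc by simp
    qed
    have "{p. Factorial_Ring.prime p \<and> E.Q.torsion_part (carrier Q) p \<noteq> {\<one>\<^bsub>Q\<^esub>}} - {..m} \<subseteq>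
      {p::nat. Factorial_Ring.prime p \<and> (\<exists>c\<in>T. c \<notin> A \<and> c [^] p \<in> A)}"
    proof (intro subsetI, elim DiffE CollectE conjE)
      fix p :: nat assume p: "Factorial_Ring.prime p" "p \<notin> {..m}" "E.Q.torsion_part (carrier Q) p \<noteq> {\<one>\<^bsub>Q\<^esub>}"
      have "\<one>\<^bsub>Q\<^esub> \<in> E.Q.torsion_part (carrier Q) p" by (simp add: E.Q.torsion_part_def)
      then obtain q where q: "q \<in> carrier Q" "q [^]\<^bsub>Q\<^esub> p = \<one>\<^bsub>Q\<^esub>" "q \<noteq> \<one>\<^bsub>Q\<^esub>" using p(3) by (auto simp: E.Q.torsion_part_def)
      obtain c where c: "c \<in> C" "q = f c" using q(1) E.onto by auto
      have cA: "c [^] p \<in> A" "c \<notin> A" using ker[of c] ker[of "c [^] p"] sub_pow[OF C(1) c(1)] c q by (auto simp: E.f_pow)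
      have "\<not> p dvd m" using p(2) m(1) by (auto dest: dvd_imp_le)
      then have "coprime p m" using prime_imp_coprime_nat[OF p(1)] by blast
      then have "c \<in> T" using c cA by (auto simp: T_iff)
      then show "p \<in> {p. Factorial_Ring.prime p \<and> (\<exists>c\<in>T. c \<notin> A \<and> c [^] p \<in> A)}" using cA p(1) by blast
    qed
    then have "infinite {p::nat. Factorial_Ring.prime p \<and> (\<exists>c\<in>T. c \<notin> A \<and> c [^] p \<in> A)}"
      using Diff_infinite_finite[OF finite_atMost ip] by (rule infinite_super)
    then have "\<not> dcc {\<one>} T" using infinite_primes_not_dcc[OF T(1) abT torsion_mono[OF C(2) T(2)] A(1)] by blast
    then show ?thesis using that T abT nzT by blast
  qed
qed

text \<open>The action of an element of \<open>T\<close> on the finite group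
  \<open>torsion_part A N\<close> already decides its action on \<open>A\<close>. There are finitely
  many such actions, and two elements with the same one differ by an element of
  \<open>C\<close>.\<close>

lemma centralizer_finite_index:
  assumes T: "subgroup T G" "torsion T" and A: "subgroup A G" "A \<subseteq> T" "commuting A" "normalizes T A" and dcc: "dcc {\<one>} A"
  defines "C \<equiv> {c \<in> T. \<forall>a\<in>A. conjg c a = a}"
  shows "subgroup C G" "A \<subseteq> C" "finite_index C T" "\<And>Z. subgroup Z G \<Longrightarrow> normalizes Z T \<Longrightarrow> normalizes Z A \<Longrightarrow> normalizes Z C"
proof -
  note Tc = mem_carrier_of[OF T(1)]
  note Ac = mem_carrier_of[OF A(1)]
  have perA: "torsion A" using torsion_mono[OF T(2) A(2)] .
  note nzTA = A(4)
  obtain N where N: "N > 0" "\<And>t a. t \<in> carrier G \<Longrightarrow> \<exists>n::nat. n > 0 \<and> t [^] n = \<one> \<Longrightarrow> normalizes {t} A \<Longrightarrow>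
      (\<And>b. b \<in> torsion_part A N \<Longrightarrow> conjg t b = b) \<Longrightarrow> a \<in> A \<Longrightarrow> conjg t a = a"
    using centralizer_torsion_part[OF A(1,3) perA dcc] by blast
  have finN: "finite (torsion_part A N)" using finite_torsion_part[OF A(1,3) dcc_finite_socle[OF A(1,3) dcc] N(1)] .
  have C: "subgroup C G"
  proof (rule subgroup_criterion)
    show "C \<subseteq> carrier G" using Tc by (auto simp: C_def)
    show "\<one> \<in> C" using sub_one[OF T(1)] Ac by (auto simp: C_def)
    show "inv x \<in> C" if "x \<in> C" for x
      using that sub_inv[OF T(1)] Tc Ac by (auto simp: C_def) (metis conjg_inv_conjg(1))
    show "x \<otimes> y \<in> C" if "x \<in> C" "y \<in> C" for x y
      using that sub_mult[OF T(1)] Tc Ac by (auto simp: C_def simp flip: conjg_conjg)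
  qed
  have CT: "C \<subseteq> T" by (auto simp: C_def)
  have AC: "A \<subseteq> C"
  proof
    fix a assume a: "a \<in> A"
    have "conjg a b = b" if "b \<in> A" for b using A(3) a that conjg_eq_self_iff Ac by (auto simp: commuting_def)
    then show "a \<in> C" using a A(2) by (auto simp: C_def)
  qed
  have cjC: "conjg g c \<in> C" if g: "g \<in> carrier G" "normalizes {g} A" "normalizes {inv g} A" "conjg g c \<in> T" "c \<in> C" for g c
  proof -
    have "conjg (conjg g c) a = a" if a: "a \<in> A" for a
    proof -
      have "conjg (inv g) a \<in> A" using g(3) a by (auto simp: normalizes_def)
      then have "conjg c (conjg (inv g) a) = conjg (inv g) a" using g(5) by (auto simp: C_def)
      moreover have "conjg (conjg g c) a = conjg g (conjg c (conjg (inv g) a))"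
        using g a Ac Tc CT by (simp add: conjg_def m_assoc inv_mult_group subset_iff)
      ultimately show ?thesis using g a Ac by simp
    qed
    then show ?thesis using g by (auto simp: C_def)
  qed
  have nzC: "normalizes Z C" if Z: "subgroup Z G" "normalizes Z T" "normalizes Z A" for Z
  proof (rule normalizesI)
    fix y c assume y: "y \<in> Z" "c \<in> C"
    show "conjg y c \<in> C"
      using cjC[of y c] y mem_carrier_of[OF Z(1)] CT normalizes_mono[OF Z(3)] sub_inv[OF Z(1)] normalizesD[OF Z(2)] by auto
  qed
  define g where "g t = (\<lambda>a. if a \<in> torsion_part A N then conjg t a else \<one>)" for t
  have tN: "conjg t a \<in> torsion_part A N" if "t \<in> T" "a \<in> torsion_part A N" for t a
    using that normalizesD[OF nzTA] Tc Ac by (simp add: torsion_part_def flip: conjg_pow)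
  have "g ` T \<subseteq> {h. \<forall>s. (s \<in> torsion_part A N \<longrightarrow> h s \<in> torsion_part A N) \<and> (s \<notin> torsion_part A N \<longrightarrow> h s = \<one>)}"
    using tN by (auto simp: g_def)
  then have fg: "finite (g ` T)" using finite_set_of_finite_funs[OF finN finN, of \<one>] finite_subset by blast
  have "finite_index C T"
  proof (rule finite_index_by_map[OF C sub_carrier[OF T(1)] fg])
    fix s t assume st: "s \<in> T" "t \<in> T" "g s = g t"
    let ?u = "s \<otimes> inv t"
    have uT: "?u \<in> T" using sub_mult[OF T(1) st(1) sub_inv[OF T(1) st(2)]] .
    have "conjg ?u b = b" if b: "b \<in> torsion_part A N" for b
    proof -
      have bc: "b \<in> carrier G" using b Ac by (simp add: torsion_part_def)
      have b': "conjg (inv t) b \<in> torsion_part A N" using tN[OF sub_inv[OF T(1) st(2)] b] .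
      have "conjg ?u b = conjg s (conjg (inv t) b)" using st Tc bc by (simp add: conjg_conjg)
      also have "\<dots> = conjg t (conjg (inv t) b)" using fun_cong[OF st(3), of "conjg (inv t) b"] b' by (simp add: g_def)
      finally show ?thesis using st Tc bc by simp
    qed
    then have "conjg ?u a = a" if "a \<in> A" for a
      using N(2)[of ?u a] uT T(2) Tc normalizes_mono[OF nzTA] that unfolding torsion_def by auto
    then show "?u \<in> C" using uT by (simp add: C_def)
  qed
  then show "finite_index C T" .
  show "subgroup C G" by (rule C)
  show "A \<subseteq> C" by (rule AC)
  show "normalizes Z C" if "subgroup Z G" "normalizes Z T" "normalizes Z A" for Z using nzC that by blast
qed

text \<open>Passing to the centraliser \<open>C\<close> of \<open>A\<close> in \<open>T\<close>
  makes \<open>A\<close> central. Its finite index ensures that \<open>C\<close> inherits the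
  failure of the minimal condition above \<open>A\<close>.\<close>

lemma normal_abelian_extension:
  assumes Y: "subgroup Y G" "finite Y" and T: "subgroup T G" "torsion T" "normalizes Y T"
    and A: "subgroup A G" "A \<subseteq> T" "normalizes Y A" "commuting A"
    and commutators_in: "commutators_in T A" and dcc: "dcc {\<one>} A" and ndcc: "\<not> dcc A T"
  obtains U where "subgroup U G" "U \<subseteq> T" "commuting U" "normalizes Y U" "\<not> dcc {\<one>} U"
proof -
  note Tc = mem_carrier_of[OF T(1)]
  note Ac = mem_carrier_of[OF A(1)]
  have nzTA: "normalizes T A" using normalizes_above[OF commutators_in A(1) subset_refl A(2) sub_carrier[OF T(1)]] .
  define C where "C = {c \<in> T. \<forall>a\<in>A. conjg c a = a}"
  note cfi = centralizer_finite_index[OF T(1,2) A(1,2,4) nzTA dcc, folded C_def]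
  have C: "subgroup C G" and AC: "A \<subseteq> C" and "finite_index C T" by (rule cfi)+
  have CT: "C \<subseteq> T" by (auto simp: C_def)
  have nzTC: "normalizes T C" and nzYC: "normalizes Y C" using cfi(4) T Y A nzTA normalizes_self by auto
  from \<open>finite_index C T\<close> have "dcc C T" using finite_index_dcc T(1) by blast
  then have "\<not> dcc A C" using dcc_trans[OF C AC CT nzTC T(1) A(1)] ndcc by blast
  have cen: "a \<otimes> c = c \<otimes> a" if "a \<in> A" "c \<in> C" for a c
    using that conjg_eq_self_iff[of c a] Tc Ac CT by (auto simp: C_def)
  obtain U where "subgroup U G" "U \<subseteq> C" "commuting U" "normalizes Y U" "\<not> dcc {\<one>} U"
    by (rule central_extension_abelian[OF Y C torsion_mono[OF T(2) CT] nzYC A(1) AC A(3) cen commutators_in_mono[OF commutators_in CT subset_refl] dcc \<open>\<not> dcc A C\<close>])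
  then show ?thesis using that CT by blast
qed

section \<open>The derived series and cyclic subgroups\<close>

lemma derived_normalizes:
  assumes "H \<subseteq> carrier G" "S \<subseteq> carrier G" "normalizes S H" shows "normalizes S (derived G H)"
  unfolding derived_def
proof (rule normalizes_generate[OF derived_set_in_carrier[OF assms(1)] assms(2)], rule normalizesI)
  fix x a assume x: "x \<in> S" and "a \<in> derived_set G H"
  then obtain h k where hk: "h \<in> H" "k \<in> H" "a = h \<otimes> k \<otimes> inv h \<otimes> inv k" by blast
  have c: "x \<in> carrier G" "h \<in> carrier G" "k \<in> carrier G" using x hk assms by auto
  have "conjg x a = conjg x h \<otimes> conjg x k \<otimes> inv (conjg x h) \<otimes> inv (conjg x k)"
    using c hk(3) by (simp add: conjg_mult conjg_inv)
  moreover have "conjg x h \<in> H" "conjg x k \<in> H" using assms(3) x hk by (auto simp: normalizes_def)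
  ultimately show "conjg x a \<in> derived_set G H" by blast
qed

lemma derived_commutators_in: "H \<subseteq> carrier G \<Longrightarrow> commutators_in H (derived G H)"
  unfolding commutators_in_def derived_def conjg_def by (auto intro!: generate.incl)

lemma derived_subset: "subgroup H G \<Longrightarrow> derived G H \<subseteq> H"
  by (rule derived_incl) auto

definition derived_term :: "nat \<Rightarrow> 'a set" where "derived_term j = (derived G ^^ j) (carrier G)"

lemma derived_term_0: "derived_term 0 = carrier G" by (simp add: derived_term_def)

lemma derived_term_subgroup: "subgroup (derived_term j) G"
  unfolding derived_term_def by (rule exp_of_derived_is_subgroup[OF subgroup_self])

lemma derived_term_Suc: "derived_term (Suc j) = derived G (derived_term j)" by (simp add: derived_term_def)

lemma derived_term_Suc_subset: "derived_term (Suc j) \<subseteq> derived_term j" unfolding derived_term_Suc by (rule derived_subset[OF derived_term_subgroup])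

lemma derived_term_commutators_in: "commutators_in (derived_term j) (derived_term (Suc j))" unfolding derived_term_Suc by (rule derived_commutators_in[OF sub_carrier[OF derived_term_subgroup]])

lemma derived_term_normal_in: "normal_in (derived_term j) (carrier G)"
proof -
  have "normalizes (carrier G) (derived_term j)"
  proof (induction j)
    case 0 then show ?case by (simp add: derived_term_0 normalizes_def)
  next
    case (Suc j) then show ?case unfolding derived_term_Suc by (intro derived_normalizes sub_carrier[OF derived_term_subgroup]) auto
  qed
  then show ?thesis using derived_term_subgroup[of j] sub_carrier[OF derived_term_subgroup] subgroup_self by (auto simp: normal_in_def)
qed

lemma solvable_derived_term: "solvable G \<Longrightarrow> \<exists>n. derived_term n = {\<one>}"
  unfolding derived_term_def using solvable_iff_trivial_derived_seq by simp

lemma commutators_in_subset_self: "subgroup A G \<Longrightarrow> commutators_in A A"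
  unfolding commutators_in_def by (auto intro: sub_mult sub_conjg sub_inv)

text \<open>The induction climbs down the derived series. If the factor from
  \<open>derived_term (Suc j)\<close> to \<open>derived_term j\<close> violates the minimal
  condition, that factor is taken as the new section. Otherwise the section found for
  \<open>j\<close> sits above an abelian factor with the minimal condition, and
  \<open>normal_abelian_extension\<close> in the quotient converts it.\<close>

lemma invariant_nondcc_section:
  assumes Y: "subgroup Y G" "finite Y" and torsion: "torsion (carrier G)"
  shows "dcc (derived_term j) (carrier G) \<or>
    (\<exists>T. subgroup T G \<and> derived_term j \<subseteq> T \<and> normalizes Y T \<and> commutators_in T (derived_term j) \<and> \<not> dcc (derived_term j) T)"
proof (induction j)
  case 0
  show ?case using finite_index_dcc[OF finite_index_subset, of "carrier G" "carrier G"] dccI[of "carrier G" "carrier G"]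
    by (metis derived_term_0 order.strict_iff_order subset_antisym)
next
  case (Suc j)
  note D = derived_term_subgroup[of j] derived_term_normal_in[of j]
  note D' = derived_term_subgroup[of "Suc j"] derived_term_normal_in[of "Suc j"]
  note sub = derived_term_Suc_subset[of j]
  have nzYD: "normalizes Y (derived_term j)" using D(2) normalizes_mono sub_carrier[OF Y(1)] by (auto simp: normal_in_def)
  show ?case
  proof (cases "dcc (derived_term (Suc j)) (derived_term j)")
    case False
    then show ?thesis using D sub nzYD derived_term_commutators_in by blast
  next
    case dccD: True
    show ?thesis
    proof (cases "dcc (derived_term j) (carrier G)")
      case True
      have "dcc (derived_term (Suc j)) (carrier G)"
        using dcc_trans[OF D(1) sub sub_carrier[OF D(1)] _ subgroup_self D'(1) dccD True] D(2) by (simp add: normal_in_def)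
      then show ?thesis by blast
    next
      case False
      then obtain T where T: "subgroup T G" "derived_term j \<subseteq> T" "normalizes Y T" "commutators_in T (derived_term j)" "\<not> dcc (derived_term j) T"
        using Suc by blast
      obtain Q :: "'a set monoid" and f where Q: "partial_epi G Q (carrier G) f"
        and ker: "\<And>x. x \<in> carrier G \<Longrightarrow> f x = \<one>\<^bsub>Q\<^esub> \<longleftrightarrow> x \<in> derived_term (Suc j)"
        using quotient_exists[OF D'(2)] by metis
      interpret E: partial_epi G Q "carrier G" f by (rule Q)
      note Tc = sub_carrier[OF T(1)] and Dc = sub_carrier[OF D(1)] and Yc = sub_carrier[OF Y(1)]
      have pb1: "E.pullback {\<one>\<^bsub>Q\<^esub>} = derived_term (Suc j)" using ker sub_carrier[OF D'(1)] by (auto simp: E.pullback_def)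
      have pbD: "E.pullback (f ` derived_term j) = derived_term j" using E.pullback_image[OF D(1) Dc] pb1 sub by simp
      have pbT: "E.pullback (f ` T) = T" using E.pullback_image[OF T(1) Tc] pb1 sub T(2) by (metis subset_trans)
      have sg: "subgroup (f ` Y) Q" "subgroup (f ` T) Q" "subgroup (f ` derived_term j) Q"
        using E.image_subgroup Y T D Tc Dc Yc by auto
      have ab: "E.Q.commuting (f ` derived_term j)" using E.commuting_image[OF Dc] derived_term_commutators_in pb1 by simp
      have cinT: "E.Q.commutators_in (f ` T) (f ` derived_term j)"
        unfolding E.Q.commutators_in_def
      proof (intro ballI)
        fix a b assume "a \<in> f ` T" "b \<in> f ` T"
        then obtain x y where xy: "x \<in> T" "y \<in> T" "a = f x" "b = f y" by auto
        then have c: "x \<in> carrier G" "y \<in> carrier G" using Tc by auto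
        have "E.Q.conjg a b \<otimes>\<^bsub>Q\<^esub> inv\<^bsub>Q\<^esub> b = f (conjg x y \<otimes> inv y)"
          using xy c by (simp add: E.hom E.f_conjg E.f_inv)
        moreover have "conjg x y \<otimes> inv y \<in> derived_term j" using T(4) xy by (auto simp: commutators_in_def)
        ultimately show "E.Q.conjg a b \<otimes>\<^bsub>Q\<^esub> inv\<^bsub>Q\<^esub> b \<in> f ` derived_term j" by simp
      qed
      have d: "E.Q.dcc {\<one>\<^bsub>Q\<^esub>} (f ` derived_term j)"
        using E.dcc_pullback[OF E.Q.sub_carrier[OF sg(3)] E.Q.triv_subgroup] pb1 pbD dccD by simp
      have nd: "\<not> E.Q.dcc (f ` derived_term j) (f ` T)"
        using E.dcc_pullback[OF E.Q.sub_carrier[OF sg(2)] sg(3)] pbD pbT T(5) by simp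
      obtain U where U: "subgroup U Q" "U \<subseteq> f ` T" "E.Q.commuting U" "E.Q.normalizes (f ` Y) U" "\<not> E.Q.dcc {\<one>\<^bsub>Q\<^esub>} U"
      proof (rule E.Q.normal_abelian_extension[OF sg(1) _ sg(2) _ _ sg(3) _ _ ab cinT d nd])
        show "finite (f ` Y)" using Y by simp
        show "E.Q.torsion (f ` T)" using E.torsion_quotient[OF torsion] E.Q.torsion_mono E.Q.sub_carrier[OF sg(2)] by blast
        show "E.Q.normalizes (f ` Y) (f ` T)" using E.normalizes_image[OF Yc Tc T(3)] .
        show "f ` derived_term j \<subseteq> f ` T" using T(2) by blast
        show "E.Q.normalizes (f ` Y) (f ` derived_term j)" using E.normalizes_image[OF Yc Dc nzYD] .
      qed blast
      have "subgroup (E.pullback U) G" using E.pullback_subgroup U by blast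
      moreover have "derived_term (Suc j) \<subseteq> E.pullback U" using pb1 E.pullback_mono[of "{\<one>\<^bsub>Q\<^esub>}" U] E.Q.sub_one[OF U(1)] by simp
      moreover have "normalizes Y (E.pullback U)"
        using E.normalizes_pullback[OF Yc _ Yc U(4)] Yc by (auto simp: normalizes_def)
      moreover have "commutators_in (E.pullback U) (derived_term (Suc j))" using E.commutators_in_pullback[OF E.Q.sub_carrier[OF U(1)] U(3)] pb1 by simp
      moreover have "\<not> dcc (derived_term (Suc j)) (E.pullback U)"
        using E.dcc_pullback[OF E.Q.sub_carrier[OF U(1)] E.Q.triv_subgroup] pb1 U(5) by simp
      ultimately show ?thesis by blast
    qed
  qed
qed

lemma commutators_in_one_commuting: "commutators_in T {\<one>} \<Longrightarrow> T \<subseteq> carrier G \<Longrightarrow> commuting T"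
  unfolding commuting_def commutators_in_commutator using commutator_one_iff by blast

text \<open>If one prime has infinitely many elements, a pigeonhole on components in the finite
  group \<open>H\<close> yields an element none of whose conjugates has such a component; if
  infinitely many primes occur, one that is absent from \<open>H \<inter> T\<close> serves. The
  orbit of the element generates a finite group since \<open>T\<close> is abelian and
  torsion.\<close>

lemma invariant_finite_disjoint:
  assumes Y: "subgroup Y G" "finite Y" and T: "subgroup T G" "torsion T" "commuting T" "normalizes Y T"
    and inf: "infinite (socle T)" and H: "subgroup H G" "finite H"
  obtains B where "subgroup B G" "finite B" "B \<subseteq> T" "normalizes Y B" "B \<inter> H = {\<one>}" "B \<noteq> {\<one>}"
proof -
  note Tc = mem_carrier_of[OF T(1)]
  note Yc = mem_carrier_of[OF Y(1)]
  note goal = that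
  \<comment> \<open>It is enough to find \<open>t\<close> whose whole orbit lies in a subgroup
    \<open>R\<close> meeting \<open>H\<close> trivially.\<close>
  have orbit: thesis if t: "t \<in> T" "t \<noteq> \<one>" and R: "subgroup R G" "R \<inter> H \<subseteq> {\<one>}" "\<And>y. y \<in> Y \<Longrightarrow> conjg y t \<in> R" for t R
  proof -
    let ?O = "(\<lambda>y. conjg y t) ` Y"
    have OT: "?O \<subseteq> T" using normalizesD[OF T(4)] t by auto
    have Oc: "?O \<subseteq> carrier G" using OT Tc by auto
    have nzO: "normalizes Y ?O"
    proof (rule normalizesI)
      fix y v assume y: "y \<in> Y" "v \<in> ?O"
      then obtain z where z: "z \<in> Y" "v = conjg z t" by auto
      then have "conjg y v = conjg (y \<otimes> z) t" using y Yc t Tc by (simp add: conjg_conjg)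
      then show "conjg y v \<in> ?O" using sub_mult[OF Y(1) y(1) z(1)] by auto
    qed
    have "t \<in> ?O" using sub_one[OF Y(1)] t(1) Tc by (intro image_eqI[of _ _ \<one>]) auto
    then have tg: "t \<in> generate G ?O" by (rule generate.incl)
    have "?O \<subseteq> R" using R(3) by auto
    then have "generate G ?O \<subseteq> R" using generate_subgroup_incl[OF _ R(1)] by blast
    then have "generate G ?O \<inter> H = {\<one>}"
      using R(2) sub_one[OF H(1)] sub_one[OF generate_is_subgroup[OF Oc]] by blast
    then show thesis
      using goal[of "generate G ?O"] generate_is_subgroup[OF Oc] commuting_fin_gen_finite[OF T(1-3) _ OT] Y(2)
        generate_subgroup_incl[OF OT T(1)] normalizes_generate[OF Oc sub_carrier[OF Y(1)] nzO] tg t(2) by auto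
  qed
  from infinite_socle_cases[OF T(1) inf] show thesis
  proof (elim disjE exE conjE)
    fix p :: nat assume p: "Factorial_Ring.prime p" and ip: "infinite (torsion_part T p)"
    define U where "U = torsion_part T p"
    have U: "subgroup U G" "U \<subseteq> T" unfolding U_def using torsion_part_subgroup[OF T(1,3)] by (auto simp: torsion_part_def)
    have abU: "commuting U" using commuting_mono[OF T(3) U(2)] .
    have perU: "torsion U" using torsion_mono[OF T(2) U(2)] .
    obtain R where R: "subgroup R G" "{\<one>} \<subseteq> R" "R \<subseteq> U" "R \<inter> (U \<inter> H) = {\<one>}" "U \<subseteq> (U \<inter> H) <#> R"
      by (rule complement_exists[OF U(1) perU triv_subgroup _ subgroup_Int[OF U(1) H(1)] _ commuting_commutators_in[OF abU sub_carrier[OF U(1)]] p])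
        (use sub_one[OF U(1)] sub_one[OF H(1)] in \<open>auto simp: U_def torsion_part_def\<close>)
    have nzU: "normalizes Y U" using normalizesD[OF T(4)] Yc Tc by (auto simp: normalizes_def U_def torsion_part_def simp flip: conjg_pow)
    obtain l where l: "\<And>u. u \<in> U \<Longrightarrow> l u \<in> U \<inter> H \<and> inv (l u) \<otimes> u \<in> R"
    proof -
      have "\<exists>l. l \<in> U \<inter> H \<and> inv l \<otimes> u \<in> R" if u: "u \<in> U" for u
      proof -
        have "u \<in> (U \<inter> H) <#> R" using u R(5) by blast
        then obtain a r where ar: "a \<in> U \<inter> H" "r \<in> R" "u = a \<otimes> r" by (rule set_multE)
        then have "inv a \<otimes> u = r" using mem_carrier_of[OF H(1)] mem_carrier_of[OF R(1)] by auto
        then show ?thesis using ar by blast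
      qed
      then show ?thesis using that by metis
    qed
    \<comment> \<open>\<open>l\<close> is a mere choice of a component, not a homomorphism. Equal
      components of the conjugates of \<open>u\<close> and \<open>v\<close> still put all conjugates
      of \<open>inv u \<otimes> v\<close> into \<open>R\<close>.\<close>
    define g where "g u = (\<lambda>y. if y \<in> Y then l (conjg y u) else \<one>)" for u
    have "g ` U \<subseteq> {h. \<forall>s. (s \<in> Y \<longrightarrow> h s \<in> H) \<and> (s \<notin> Y \<longrightarrow> h s = \<one>)}"
      using l normalizesD[OF nzU] by (auto simp: g_def)
    then have "finite (g ` U)" using finite_set_of_finite_funs[OF Y(2) H(2), of \<one>] finite_subset by blast
    then have "\<not> inj_on g U" using finite_imageD ip unfolding U_def by blast
    then obtain u v where uv: "u \<in> U" "v \<in> U" "u \<noteq> v" "g u = g v" by (auto simp: inj_on_def)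
    let ?w = "inv u \<otimes> v"
    have wU: "?w \<in> U" using sub_mult[OF U(1) sub_inv[OF U(1) uv(1)] uv(2)] .
    note c = mem_carrier_of[OF U(1) uv(1)] mem_carrier_of[OF U(1) uv(2)]
    have "?w \<noteq> \<one>" using uv(3) c by (metis inv_equality inv_inv inv_closed)
    moreover have "conjg y ?w \<in> R" if y: "y \<in> Y" for y
    proof -
      have k: "l (conjg y u) = l (conjg y v)" using fun_cong[OF uv(4), of y] y by (simp add: g_def)
      have yu: "conjg y u \<in> U" "conjg y v \<in> U" using normalizesD[OF nzU] y uv by auto
      have lc: "l (conjg y u) \<in> carrier G" using l[OF yu(1)] mem_carrier_of[OF H(1)] by blast
      have "inv (inv (l (conjg y u)) \<otimes> conjg y u) \<otimes> (inv (l (conjg y u)) \<otimes> conjg y v) \<in> R"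
        using l[OF yu(1)] l[OF yu(2)] k sub_mult[OF R(1)] sub_inv[OF R(1)] by metis
      also have "inv (inv (l (conjg y u)) \<otimes> conjg y u) \<otimes> (inv (l (conjg y u)) \<otimes> conjg y v) = conjg y ?w"
        using lc c y Yc by (simp add: inv_mult_group m_assoc conjg_mult conjg_inv)
      finally show ?thesis .
    qed
    ultimately show thesis using orbit[of ?w R] wU U(2) R by blast
  next
    assume ip: "infinite {p. Factorial_Ring.prime p \<and> torsion_part T p \<noteq> {\<one>}}"
    have HT: "subgroup (H \<inter> T) G" "commuting (H \<inter> T)" "torsion (H \<inter> T)" "finite (H \<inter> T)"
      using subgroup_Int[OF H(1) T(1)] commuting_mono[OF T(3)] torsion_mono[OF T(2)] H(2) by auto
    obtain m :: nat where m: "m > 0" "\<And>a. a \<in> H \<inter> T \<Longrightarrow> \<exists>k. a [^] (m ^ k) = \<one>"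
      using finite_socle_exponent[OF HT(1-3)] HT(4) finite_subset[of "socle (H \<inter> T)" "H \<inter> T"] by (auto simp: socle_def)
    have "infinite ({p. Factorial_Ring.prime p \<and> torsion_part T p \<noteq> {\<one>}} - {..m})"
      using Diff_infinite_finite[OF finite_atMost ip] .
    then have "{p. Factorial_Ring.prime p \<and> torsion_part T p \<noteq> {\<one>}} - {..m} \<noteq> {}" by (metis finite.emptyI)
    then obtain p where "p \<in> {p. Factorial_Ring.prime p \<and> torsion_part T p \<noteq> {\<one>}} - {..m}" by blast
    then have p: "Factorial_Ring.prime p" "torsion_part T p \<noteq> {\<one>}" "p > m" by auto
    have "\<not> p dvd m" using p m(1) by (auto dest: dvd_imp_le)
    have "torsion_part T p \<inter> H \<subseteq> {\<one>}"
    proof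
      fix a assume a: "a \<in> torsion_part T p \<inter> H"
      then obtain k where k: "a [^] (m ^ k) = \<one>" using m(2)[of a] by (auto simp: torsion_part_def)
      have "coprime p (m ^ k)" using prime_imp_coprime_nat[OF p(1) \<open>\<not> p dvd m\<close>] by simp
      then show "a \<in> {\<one>}" using coprime_pow_mem[OF triv_subgroup, of a p "m ^ k"] a k mem_carrier_of[OF H(1)] by (auto simp: torsion_part_def)
    qed
    moreover have "\<one> \<in> torsion_part T p" using sub_one[OF T(1)] by (simp add: torsion_part_def)
    then obtain t where t: "t \<in> torsion_part T p" "t \<noteq> \<one>" using p(2) by blast
    have "conjg y t \<in> torsion_part T p" if "y \<in> Y" for y
      using t normalizesD[OF T(4) that] Yc[OF that] Tc by (auto simp: torsion_part_def simp flip: conjg_pow)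
    ultimately show thesis using orbit[of t "torsion_part T p"] t torsion_part_subgroup[OF T(1,3)] by (auto simp: torsion_part_def)
  qed
qed

text \<open>The products built from \<open>Y\<close> and finite invariant subgroups of
  \<open>T\<close> stay finite, so the next subgroup can be chosen to avoid them. It is normalised
  by the whole product because \<open>T\<close> is abelian.\<close>

lemma finite_subgroup_subnormal_in:
  assumes Y: "subgroup Y G" "finite Y" and T: "subgroup T G" "torsion T" "commuting T" "normalizes Y T" "\<not> dcc {\<one>} T"
    and K: "subgroup K G" "Y \<subseteq> K" "T \<subseteq> K" "rcc K"
  shows "subnormal_in Y K"
proof -
  note Yc = mem_carrier_of[OF Y(1)] and Tc = mem_carrier_of[OF T(1)]
  have inf: "infinite (socle T)" using finite_socle_dcc[OF T(1,3,2)] T(5) by blast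
  define Inv where "Inv H \<longleftrightarrow> subgroup H G \<and> finite H \<and> H \<subseteq> Y <#> T" for H
  have YT: "subgroup (Y <#> T) G" using subgroup_set_mult[OF Y(1) T(1,4)] .
  have TYT: "T \<subseteq> Y <#> T" "Y \<subseteq> Y <#> T"
    using set_mult_ge2[OF Y(1) sub_carrier[OF T(1)]] set_mult_ge1[OF T(1) sub_carrier[OF Y(1)]] by auto
  have "\<exists>B. subgroup B G \<and> normalizes H B \<and> B \<inter> H = {\<one>} \<and> B \<noteq> {\<one>} \<and> Inv (H <#> B)" if H: "Inv H" for H
  proof -
    have H': "subgroup H G" "finite H" "H \<subseteq> Y <#> T" using H by (auto simp: Inv_def)
    obtain B where B: "subgroup B G" "finite B" "B \<subseteq> T" "normalizes Y B" "B \<inter> H = {\<one>}" "B \<noteq> {\<one>}"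
      using invariant_finite_disjoint[OF Y T(1-4) inf H'(1,2)] by blast
    have normalizes: "normalizes H B"
    proof (rule normalizesI)
      fix h b assume hb: "h \<in> H" "b \<in> B"
      then have "h \<in> Y <#> T" using H' by blast
      then obtain y t where y: "y \<in> Y" "t \<in> T" "h = y \<otimes> t" by (rule set_multE)
      have "b \<in> T" using hb B by blast
      then have "conjg t b = b" using y T(3) conjg_eq_self_iff Tc by (auto simp: commuting_def)
      then have "conjg h b = conjg y b" using y \<open>b \<in> T\<close> Yc Tc by (simp flip: conjg_conjg)
      then show "conjg h b \<in> B" using normalizesD[OF B(4) y(1) hb(2)] by simp
    qed
    have "Inv (H <#> B)" unfolding Inv_def
      using subgroup_set_mult[OF H'(1) B(1) normalizes] finite_set_mult[OF H'(2) B(2)] set_mult_le[OF YT H'(3)] B(3) TYT(1) by auto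
    then show ?thesis using B normalizes by blast
  qed
  moreover have "Inv Y" using Y TYT by (auto simp: Inv_def)
  ultimately obtain B where B: "\<And>n. subgroup (B n) G" "\<And>n. normalizes (partial_product Y B UNIV n) (B n)"
    "\<And>n. B n \<inter> partial_product Y B UNIV n = {\<one>}" "\<And>n::nat. B n \<noteq> {\<one>}" "\<And>n. Inv (partial_product Y B UNIV n)"
    using independent_sequence[of Inv Y] by metis
  have "Y <#> T \<subseteq> K" using set_mult_le[OF K(1-3)] .
  then show ?thesis using independent_imp_subnormal_in[OF Y(1) B(1-4) K(4)] B(5) unfolding Inv_def by blast
qed

lemma solvable_rcc_baer:
  assumes "torsion (carrier G)" "solvable G" "rcc (carrier G)" "\<not> dcc {\<one>} (carrier G)"
  shows "baer (carrier G)"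
  unfolding baer_def
proof
  fix x assume x: "x \<in> carrier G"
  obtain m :: nat where m: "x [^] m = \<one>" "m > 0" using assms(1) x unfolding torsion_def by blast
  have Y: "subgroup (powers x) G" "finite (powers x)" using powers_subgroup[OF x m] finite_powers[OF x m] by auto
  obtain n where n: "derived_term n = {\<one>}" using solvable_derived_term assms(2) by blast
  obtain T where T: "subgroup T G" "normalizes (powers x) T" "commutators_in T {\<one>}" "\<not> dcc {\<one>} T"
    using invariant_nondcc_section[OF Y assms(1), of n] n assms(4) by auto
  note Tc = sub_carrier[OF T(1)]
  show "subnormal_in (powers x) (carrier G)"
    using finite_subgroup_subnormal_in[OF Y T(1) torsion_mono[OF assms(1) Tc] commutators_in_one_commuting[OF T(3) Tc] T(2,4) subgroup_self sub_carrier[OF Y(1)] Tc assms(3)] .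
qed

section \<open>Actions on abelian subgroups\<close>

text \<open>The upper central series of \<open>A\<close> under the action of \<open>Y\<close>. For
  an abelian \<open>A\<close> normalised by \<open>Y\<close> and meeting it trivially, it reaches
  \<open>A\<close> after finitely many steps exactly when \<open>Y\<close> is subnormal in
  \<open>Y <#> A\<close>, so subnormality becomes nilpotency of an action.\<close>

primrec upper_series :: "'a set \<Rightarrow> 'a set \<Rightarrow> nat \<Rightarrow> 'a set" where
  "upper_series Y A 0 = {\<one>}"
| "upper_series Y A (Suc j) = {a \<in> A. \<forall>y\<in>Y. commutator y a \<in> upper_series Y A j}"

lemma commutator_mult_commuting:
  assumes A: "subgroup A G" "commuting A" "normalizes {y} A" and y: "y \<in> carrier G" and ab: "a \<in> A" "b \<in> A"
  shows "commutator y (a \<otimes> b) = commutator y a \<otimes> commutator y b" "commutator y a \<in> A" "commutator y (inv a) = inv (commutator y a)"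
proof -
  note c = mem_carrier_of[OF A(1) ab(1)] mem_carrier_of[OF A(1) ab(2)]
  have yA: "conjg y a \<in> A" "conjg y b \<in> A" using A(3) ab by (auto simp: normalizes_def)
  note cy = mem_carrier_of[OF A(1) yA(1)] mem_carrier_of[OF A(1) yA(2)]
  show kA: "commutator y a \<in> A" unfolding commutator_def using sub_mult[OF A(1) yA(1) sub_inv[OF A(1) ab(1)]] .
  have kB: "commutator y b \<in> A" unfolding commutator_def using sub_mult[OF A(1) yA(2) sub_inv[OF A(1) ab(2)]] .
  have "commutator y (a \<otimes> b) = conjg y a \<otimes> (commutator y b \<otimes> inv a)" unfolding commutator_def using y c by (simp add: conjg_mult inv_mult_group m_assoc)
  also have "commutator y b \<otimes> inv a = inv a \<otimes> commutator y b" using A(2) kB sub_inv[OF A(1) ab(1)] by (auto simp: commuting_def)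
  finally show "commutator y (a \<otimes> b) = commutator y a \<otimes> commutator y b" unfolding commutator_def using c cy by (simp add: m_assoc)
  have "commutator y (inv a) = inv (conjg y a) \<otimes> a" unfolding commutator_def using y c by (simp add: conjg_inv)
  also have "\<dots> = a \<otimes> inv (conjg y a)" using A(2) sub_inv[OF A(1) yA(1)] ab by (auto simp: commuting_def)
  finally show "commutator y (inv a) = inv (commutator y a)" unfolding commutator_def using c cy by (simp add: inv_mult_group)
qed

context
  fixes Y A :: "'a set"
  assumes Y: "subgroup Y G" and A: "subgroup A G" "commuting A" and YA: "normalizes Y A"
begin

lemma upper_series_basic: "subgroup (upper_series Y A j) G \<and> upper_series Y A j \<subseteq> A"
proof (induction j)
  case 0 then show ?case using triv_subgroup sub_one[OF A(1)] by simp
next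
  case (Suc j)
  have k: "commutator y (a \<otimes> b) = commutator y a \<otimes> commutator y b" "commutator y (inv a) = inv (commutator y a)" if "y \<in> Y" "a \<in> A" "b \<in> A" for y a b
    using commutator_mult_commuting[OF A _ _ that(2,3), of y] normalizes_mono[OF YA] that mem_carrier_of[OF Y] by auto
  have k1: "commutator y \<one> = \<one>" if "y \<in> Y" for y using mem_carrier_of[OF Y that] by (simp add: commutator_def)
  have sg: "subgroup (upper_series Y A j) G" using Suc by blast
  have "subgroup (upper_series Y A (Suc j)) G"
    by (rule subgroup_criterion) (auto simp: mem_carrier_of[OF A(1)] sub_one[OF A(1)] sub_inv[OF A(1)] sub_mult[OF A(1)] k k1 sub_one[OF sg] sub_inv[OF sg] sub_mult[OF sg])
  then show ?case by auto
qed

lemma upper_series_Suc: "upper_series Y A j \<subseteq> upper_series Y A (Suc j)"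
proof (induction j)
  case 0
  have "commutator y \<one> = \<one>" if "y \<in> Y" for y using mem_carrier_of[OF Y that] by (simp add: commutator_def)
  then show ?case using sub_one[OF A(1)] by auto
next
  case (Suc j)
  show ?case
  proof
    fix a assume "a \<in> upper_series Y A (Suc j)"
    then have "a \<in> A" "\<forall>y\<in>Y. commutator y a \<in> upper_series Y A (Suc j)" using Suc by auto
    then show "a \<in> upper_series Y A (Suc (Suc j))" by simp
  qed
qed

lemma upper_series_mono: "i \<le> j \<Longrightarrow> upper_series Y A i \<subseteq> upper_series Y A j"
  using upper_series_Suc by (rule lift_Suc_mono_le)

lemma upper_series_normalizes:
  assumes Z: "subgroup Z G" "normalizes Z Y" "normalizes Z A" shows "normalizes Z (upper_series Y A j)"
proof (induction j)
  case 0 then show ?case using mem_carrier_of[OF Z(1)] by (simp add: normalizes_def)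
next
  case (Suc j)
  show ?case
  proof (rule normalizesI)
    fix z a assume z: "z \<in> Z" and "a \<in> upper_series Y A (Suc j)"
    then have a: "a \<in> A" "\<And>y. y \<in> Y \<Longrightarrow> commutator y a \<in> upper_series Y A j" by auto
    have "commutator y (conjg z a) \<in> upper_series Y A j" if y: "y \<in> Y" for y
    proof -
      have y': "conjg (inv z) y \<in> Y" using normalizesD[OF Z(2) sub_inv[OF Z(1) z] y] .
      have "conjg z (commutator (conjg (inv z) y) a) \<in> upper_series Y A j" using normalizesD[OF Suc z a(2)[OF y']] .
      then show ?thesis using z y mem_carrier_of[OF Z(1)] mem_carrier_of[OF Y] mem_carrier_of[OF A(1) a(1)] by (simp add: conjg_commutator)
    qed
    then show "conjg z a \<in> upper_series Y A (Suc j)" using normalizesD[OF Z(3) z a(1)] by simp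
  qed
qed

lemma upper_series_mult_subgroup: "subgroup (Y <#> upper_series Y A j) G"
  using subgroup_set_mult[OF Y] upper_series_basic upper_series_normalizes[OF Y normalizes_self[OF Y] YA] by blast

lemma upper_series_mult_normal_in: "normal_in (Y <#> upper_series Y A j) (Y <#> upper_series Y A (Suc j))"
proof (rule normal_inI[OF upper_series_mult_subgroup upper_series_mult_subgroup set_mult_mono[OF subset_refl upper_series_Suc]], rule normalizesI)
  let ?Z = "upper_series Y A j"
  have Z: "subgroup ?Z G" "?Z \<subseteq> A" using upper_series_basic by auto
  note M = upper_series_mult_subgroup[of j]
  fix u v assume "u \<in> Y <#> upper_series Y A (Suc j)" and v: "v \<in> Y <#> ?Z"
  then obtain y a where u: "y \<in> Y" "a \<in> upper_series Y A (Suc j)" "u = y \<otimes> a" by (metis set_multE)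
  obtain x b where xb: "x \<in> Y" "b \<in> ?Z" "v = x \<otimes> b" using v by (metis set_multE)
  have aA: "a \<in> A" "b \<in> A" using u xb Z by auto
  have c: "y \<in> carrier G" "a \<in> carrier G" "x \<in> carrier G" "b \<in> carrier G" using u xb aA mem_carrier_of[OF Y] mem_carrier_of[OF A(1)] by auto
  have "conjg a b = b" using A(2) aA conjg_eq_self_iff[of a b] c by (auto simp: commuting_def)
  moreover have "conjg a x = x \<otimes> commutator (inv x) a" using c by (simp add: commutator_def conjg_def m_assoc)
  ultimately have "conjg a v = x \<otimes> (commutator (inv x) a \<otimes> b)" using c xb(3) by (simp add: conjg_mult m_assoc)
  moreover have "commutator (inv x) a \<in> ?Z" using u(2) sub_inv[OF Y xb(1)] by simp
  ultimately have "conjg a v \<in> Y <#> ?Z" using xb sub_mult[OF Z(1)] set_multI by metis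
  moreover have "y \<in> Y <#> ?Z" using set_mult_ge1[OF Z(1) sub_carrier[OF Y]] u by blast
  ultimately have "conjg y (conjg a v) \<in> Y <#> ?Z" using sub_conjg[OF M] by blast
  then show "conjg u v \<in> Y <#> ?Z" using u c xb by (simp add: conjg_conjg)
qed

lemma upper_series_0_mult: "Y <#> upper_series Y A 0 = Y"
proof
  show "Y <#> upper_series Y A 0 \<subseteq> Y" using mem_carrier_of[OF Y] by (auto simp: set_mult_def)
  show "Y \<subseteq> Y <#> upper_series Y A 0" using set_mult_ge1[OF triv_subgroup sub_carrier[OF Y]] by simp
qed

lemma upper_series_full_imp_subnormal_in:
  assumes "upper_series Y A c = A" shows "subnormal_in Y (Y <#> A)"
proof -
  have "subnormal_in Y (Y <#> upper_series Y A j)" for j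
  proof (induction j)
    case 0 then show ?case unfolding upper_series_0_mult using subnormal_in_refl[OF Y] .
  next
    case (Suc j) then show ?case using upper_series_mult_normal_in subnormal_in_normal_in_trans by blast
  qed
  then show ?thesis using assms by metis
qed

text \<open>Along a series starting at \<open>Y\<close>, the part in \<open>A\<close> climbs by at
  most one step at a time: if \<open>a\<close> normalises a term \<open>L\<close> above
  \<open>Y\<close>, then \<open>commutator y a = y \<otimes> conjg a (inv y)\<close> lies in
  \<open>L\<close>.\<close>

lemma subnormal_in_imp_upper_series_full:
  assumes disj: "Y \<inter> A = {\<one>}" and subnormal_in: "subnormal_in Y (Y <#> A)"
  obtains c where "upper_series Y A c = A"
proof -
  have "\<exists>c. L \<inter> A \<subseteq> upper_series Y A c \<and> Y \<subseteq> L" if "subnormal_in Y L" for L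
    using that
  proof (induction rule: subnormal_in_induct)
    case refl then show ?case using disj by (intro exI[of _ 0]) simp
  next
    case (step L M)
    then obtain c where c: "L \<inter> A \<subseteq> upper_series Y A c" "Y \<subseteq> L" by blast
    have LM: "subgroup L G" "subgroup M G" "L \<subseteq> M" "normalizes M L" using step by (auto simp: normal_in_def)
    have "M \<inter> A \<subseteq> upper_series Y A (Suc c)"
    proof
      fix a assume a: "a \<in> M \<inter> A"
      have "commutator y a \<in> upper_series Y A c" if y: "y \<in> Y" for y
      proof -
        have cc: "y \<in> carrier G" "a \<in> carrier G" using y a mem_carrier_of[OF Y] mem_carrier_of[OF A(1)] by auto
        have "commutator y a = y \<otimes> conjg a (inv y)" using cc by (simp add: commutator_def conjg_def m_assoc)
        moreover have "y \<in> L" "inv y \<in> L" using c y sub_inv[OF LM(1)] by auto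
        ultimately have "commutator y a \<in> L" using sub_mult[OF LM(1)] normalizesD[OF LM(4)] a by auto
        moreover have "commutator y a \<in> A" using sub_mult[OF A(1) normalizesD[OF YA y] sub_inv[OF A(1)]] a by (simp add: commutator_def)
        ultimately show ?thesis using c by blast
      qed
      then show "a \<in> upper_series Y A (Suc c)" using a by simp
    qed
    then show ?case using c LM by blast
  qed
  then obtain c where "(Y <#> A) \<inter> A \<subseteq> upper_series Y A c" using subnormal_in by blast
  moreover have "A \<subseteq> Y <#> A" using set_mult_ge2[OF Y sub_carrier[OF A(1)]] .
  ultimately have "upper_series Y A c = A" using upper_series_basic by blast
  then show ?thesis using that by blast
qed

end

lemma upper_series_subset_mono: "B \<subseteq> A \<Longrightarrow> upper_series Y B j \<subseteq> upper_series Y A j"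
  by (induction j) auto

lemma full_product_union_subset:
  assumes Y: "subgroup Y G" and B: "\<And>n. subgroup (B n) G" "\<And>n. normalizes (partial_product Y B UNIV n) (B n)" "\<And>n. B n \<inter> partial_product Y B UNIV n = {\<one>}"
    and A: "subgroup A G" "commuting A" "\<And>n. partial_product Y B UNIV n \<subseteq> A"
  shows "full_product Y B (I \<union> J) \<subseteq> full_product Y B I <#> full_product Y B J"
proof -
  note ctx = Y B
  note sg = full_product_subgroup[OF ctx]
  have hsA: "partial_product Y B J n \<subseteq> A" for J n using partial_product_aux[OF ctx] A(3) by blast
  have BA: "B n \<subseteq> A" for n
    using set_mult_ge2[OF partial_product_subgroup[OF ctx, of UNIV n] sub_carrier[OF B(1)]] A(3)[of "Suc n"] by auto
  have UA: "full_product Y B J \<subseteq> A" for J using hsA by (auto simp: full_product_def[OF ctx])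
  have M: "subgroup (full_product Y B I <#> full_product Y B J) G"
    using subgroup_set_mult[OF sg sg] commuting_normalizes[OF A(2) sub_carrier[OF A(1)] UA UA] by blast
  have le: "full_product Y B I \<subseteq> full_product Y B I <#> full_product Y B J" "full_product Y B J \<subseteq> full_product Y B I <#> full_product Y B J"
    using set_mult_ge1[OF sg sub_carrier[OF sg]] set_mult_ge2[OF sg sub_carrier[OF sg]] by auto
  have "partial_product Y B (I \<union> J) n \<subseteq> full_product Y B I <#> full_product Y B J" for n
  proof (induction n)
    case 0
    have "Y \<subseteq> full_product Y B I" using partial_product_ge[OF ctx] by (auto simp: full_product_def[OF ctx])
    then show ?case using le by simp
  next
    case (Suc n)
    have "n \<in> I \<union> J \<Longrightarrow> B n \<subseteq> full_product Y B I <#> full_product Y B J" using full_product_ge[OF ctx] le by blast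
    then show ?case using Suc set_mult_le[OF M] by auto
  qed
  then show ?thesis by (auto simp: full_product_def[OF ctx])
qed

text \<open>This provides the family required by
  \<open>product_cover_imp_subnormal_in\<close>.\<close>

lemma elementary_cover:
  assumes E: "subgroup E G" "commuting E" and p: "Factorial_Ring.prime (p::nat)" "\<And>x. x \<in> E \<Longrightarrow> x [^] p = \<one>" and inf: "infinite E"
  obtains F :: "nat set \<Rightarrow> 'a set" where "\<And>J. subgroup (F J) G" "F UNIV = E"
    "\<And>I J. I \<subset> J \<Longrightarrow> F I \<subset> F J" "\<And>I J. F (I \<union> J) \<subseteq> F I <#> F J"
proof -
  have perE: "torsion E" using p prime_gt_0_nat unfolding torsion_def by blast
  have "socle E = E" using p by (auto simp: socle_def)
  then have "infinite (socle E)" using inf by simp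
  then obtain B where B: "\<And>n. subgroup (B n) G" "\<And>n. normalizes (partial_product {\<one>} B UNIV n) (B n)"
    "\<And>n. B n \<inter> partial_product {\<one>} B UNIV n = {\<one>}" "\<And>n::nat. B n \<noteq> {\<one>}" "\<And>n. partial_product {\<one>} B UNIV n \<subseteq> E"
    using prime_order_sequence[OF E] by metis
  note ctx = triv_subgroup B(1-3)
  define U where "U = full_product {\<one>} B"
  have U: "subgroup (U J) G" for J unfolding U_def by (rule full_product_subgroup[OF ctx])
  have UE: "U J \<subseteq> E" for J unfolding U_def using partial_product_aux[OF ctx] B(5) by (fastforce simp: full_product_def[OF ctx])
  have UU: "U J \<subseteq> U UNIV" for J
    using partial_product_aux[OF ctx] by (auto simp: U_def full_product_def[OF ctx])
  have one: "{\<one>} \<subseteq> U UNIV" using sub_one[OF U] by simp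
  \<comment> \<open>The factors \<open>B n\<close> generate only a countable part of
    \<open>E\<close>. A complement \<open>K\<close>, kept in every \<open>F J\<close>, supplies the
    rest.\<close>
  obtain K where K: "subgroup K G" "{\<one>} \<subseteq> K" "K \<subseteq> E" "K \<inter> U UNIV = {\<one>}" "E \<subseteq> U UNIV <#> K"
    using complement_exists[OF E(1) perE triv_subgroup one U UE commuting_commutators_in[OF E(2) sub_carrier[OF E(1)]] p(1)] p(2) by auto
  have normalizes: "normalizes S T" if "S \<subseteq> E" "T \<subseteq> E" for S T using commuting_normalizes[OF E(2) sub_carrier[OF E(1)]] that by blast
  define F where "F J = U J <#> K" for J
  have F: "subgroup (F J) G" "F J \<subseteq> E" for J unfolding F_def
    using subgroup_set_mult[OF U K(1) normalizes[OF UE K(3)]] set_mult_le[OF E(1) UE K(3)] by auto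
  have FU: "F UNIV = E" using F(2)[of UNIV] K(5) by (auto simp: F_def)
  have UF: "U J \<subseteq> F J" "K \<subseteq> F J" for J unfolding F_def
    using set_mult_ge1[OF K(1) sub_carrier[OF U]] set_mult_ge2[OF U sub_carrier[OF K(1)]] by auto
  have strict: "F I \<subset> F J" if IJ: "I \<subset> J" for I J
  proof -
    have "U I \<subseteq> U J" unfolding U_def using full_product_psubset[OF ctx B(4) IJ] by blast
    then have le: "F I \<subseteq> F J" unfolding F_def by (intro set_mult_mono) auto
    obtain n where n: "n \<in> J" "n \<notin> I" using IJ by blast
    obtain b where b: "b \<in> B n" "b \<noteq> \<one>" using B(4)[of n] sub_one[OF B(1)] by blast
    have bU: "b \<in> U J" using full_product_ge[OF ctx n(1)] b by (auto simp: U_def)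
    have "b \<notin> F I"
    proof
      assume "b \<in> F I"
      then obtain u k where uk: "u \<in> U I" "k \<in> K" "b = u \<otimes> k" unfolding F_def by (rule set_multE)
      have "b \<in> U UNIV" "u \<in> U UNIV" using bU uk UU by blast+
      then have "k \<in> U UNIV" using uk sg_mult_left_iff[OF U] mem_carrier_of[OF K(1)] by blast
      then have "k = \<one>" using K(4) uk by blast
      then have "b \<in> U I" using uk mem_carrier_of[OF U] by simp
      then show False using full_product_not[OF ctx n(2)] b by (auto simp: U_def)
    qed
    then show ?thesis using le bU UF by blast
  qed
  have prod: "F (I \<union> J) \<subseteq> F I <#> F J" for I J
  proof -
    have M: "subgroup (F I <#> F J) G" using subgroup_set_mult[OF F(1) F(1) normalizes[OF F(2) F(2)]] .
    have le: "F I \<subseteq> F I <#> F J" "F J \<subseteq> F I <#> F J"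
      using set_mult_ge1[OF F(1) sub_carrier[OF F(1)]] set_mult_ge2[OF F(1) sub_carrier[OF F(1)]] by auto
    have "U (I \<union> J) \<subseteq> U I <#> U J" unfolding U_def by (rule full_product_union_subset[OF ctx E B(5)])
    also have "\<dots> \<subseteq> F I <#> F J" by (intro set_mult_mono UF)
    finally have "U (I \<union> J) \<subseteq> F I <#> F J" .
    then show ?thesis using set_mult_le[OF M, of "U (I \<union> J)" K] UF(2)[of I] le(1) by (simp add: F_def)
  qed
  show ?thesis using that[OF F(1) FU strict prod] .
qed

text \<open>If \<open>A\<close> is \<open>A^p\<close> times a finite group \<open>B\<close>, then it
  is \<open>A^(p^k)\<close> times \<open>B\<close> for every \<open>k\<close>. The powers of
  \<open>B\<close> stabilise, and from that point on \<open>p\<close>-th powers no longer shrink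
  \<open>A^(p^k)\<close>.\<close>

lemma p_divisible_part:
  assumes A: "subgroup A G" "commuting A" "torsion A" and p: "(p::nat) > 0" and finite_index: "finite_index (power_image A p) A"
  obtains k where "power_image A (p ^ k) = power_image A (p ^ Suc k)" "finite_index (power_image A (p ^ k)) A"
proof -
  note Ac = mem_carrier_of[OF A(1)]
  obtain S where S: "finite S" "S \<subseteq> A" "A \<subseteq> power_image A p <#> S" using finite_index unfolding finite_index_def by blast
  have Sc: "S \<subseteq> carrier G" using S Ac by auto
  define B where "B = generate G S"
  have B: "subgroup B G" "finite B" "B \<subseteq> A" "S \<subseteq> B"
    unfolding B_def using generate_is_subgroup[OF Sc] commuting_fin_gen_finite[OF A(1,3,2) S(1,2)] generate_subgroup_incl[OF S(2) A(1)]
    by (auto intro: generate.incl)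
  have decomp: "\<exists>b\<in>A. \<exists>s\<in>B. a = b [^] p \<otimes> s" if a: "a \<in> A" for a
  proof -
    have "a \<in> power_image A p <#> S" using a S by blast
    then obtain d s where "d \<in> power_image A p" "s \<in> S" "a = d \<otimes> s" by (rule set_multE)
    then show ?thesis using B by (auto simp: power_image_def)
  qed
  have fik: "A \<subseteq> power_image A (p ^ k) <#> B" for k
  proof (induction k)
    case 0
    have "power_image A (p ^ 0) = A" using Ac by (auto simp: power_image_def image_def)
    then show ?case using set_mult_ge1[OF B(1) sub_carrier[OF A(1)]] by simp
  next
    case (Suc k)
    show ?case
    proof
      fix a assume "a \<in> A"
      then obtain b s where bs: "b \<in> A" "s \<in> B" "a = b [^] p \<otimes> s" using decomp by blast
      then have "b \<in> power_image A (p ^ k) <#> B" using Suc by blast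
      then obtain d t where dt: "d \<in> power_image A (p ^ k)" "t \<in> B" "b = d \<otimes> t" by (rule set_multE)
      then obtain c where c: "c \<in> A" "d = c [^] (p ^ k)" by (auto simp: power_image_def)
      have tA: "t \<in> A" "d \<in> A" "s \<in> A" using dt B c sub_pow[OF A(1)] bs by auto
      have "b [^] p = d [^] p \<otimes> t [^] p" using commuting_pow_mult[OF A(2) sub_carrier[OF A(1)] tA(2,1)] dt by simp
      then have "a = c [^] (p ^ Suc k) \<otimes> (t [^] p \<otimes> s)"
        using bs(3) c Ac tA by (simp add: m_assoc nat_pow_pow mult.commute)
      moreover have "c [^] (p ^ Suc k) \<in> power_image A (p ^ Suc k)" using c by (auto simp: power_image_def)
      ultimately show "a \<in> power_image A (p ^ Suc k) <#> B"
        using set_multI sub_mult[OF B(1) sub_pow[OF B(1) dt(2)] bs(2)] by metis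
    qed
  qed
  have "power_image B (p ^ Suc n) \<subseteq> power_image B (p ^ n)" for n by (rule power_image_dvd[OF B(1)]) simp
  then obtain k where k: "\<And>n. n \<ge> k \<Longrightarrow> power_image B (p ^ n) = power_image B (p ^ k)"
    using antimono_finite_stable[OF B(2), of "\<lambda>n. power_image B (p ^ n)"] power_image_subset[OF B(1)] by metis
  have sg: "subgroup (power_image A n) G" for n by (rule power_image_subgroup[OF A(1,2)])
  have "power_image A (p ^ k) \<subseteq> power_image A (p ^ Suc k)"
  proof
    fix x assume "x \<in> power_image A (p ^ k)"
    then obtain a where a: "a \<in> A" "x = a [^] (p ^ k)" by (auto simp: power_image_def)
    obtain b s where bs: "b \<in> A" "s \<in> B" "a = b [^] p \<otimes> s" using decomp a by blast
    have sA: "s \<in> A" "b [^] p \<in> A" using bs B sub_pow[OF A(1)] by auto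
    have "x = (b [^] p) [^] (p ^ k) \<otimes> s [^] (p ^ k)"
      using commuting_pow_mult[OF A(2) sub_carrier[OF A(1)] sA(2,1)] a bs by simp
    moreover have "(b [^] p) [^] (p ^ k) \<in> power_image A (p ^ Suc k)"
      using bs Ac by (auto simp: power_image_def nat_pow_pow)
    moreover have "s [^] (p ^ k) \<in> power_image B (p ^ Suc k)" using k[of "Suc k"] bs by (auto simp: power_image_def)
    then have "s [^] (p ^ k) \<in> power_image A (p ^ Suc k)" using power_image_mono[OF B(3)] by blast
    ultimately show "x \<in> power_image A (p ^ Suc k)" using sub_mult[OF sg] by metis
  qed
  moreover have "power_image A (p ^ Suc k) \<subseteq> power_image A (p ^ k)" by (rule power_image_dvd[OF A(1)]) simp
  moreover have "finite_index (power_image A (p ^ k)) A" unfolding finite_index_def using fik[of k] B by blast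
  ultimately show ?thesis using that by blast
qed

section \<open>Actions through an abelian quotient on an abelian p-subgroup\<close>

context
  fixes Y N V K :: "'a set" and p :: nat
  assumes Y: "subgroup Y G" and N: "subgroup N G" "N \<subseteq> Y" "commutators_in Y N"
    and V: "subgroup V G" "commuting V" "normalizes Y V" and NV: "\<And>n v. n \<in> N \<Longrightarrow> v \<in> V \<Longrightarrow> conjg n v = v"
    and disj: "Y \<inter> V = {\<one>}"
    and p: "Factorial_Ring.prime p" "\<And>v. v \<in> V \<Longrightarrow> \<exists>k. v [^] (p ^ k) = \<one>"
    and K: "K = Y <#> V" "torsion K" "baer K" "rcc K"
begin

lemma action_K: "subgroup K G" "Y \<subseteq> K" "V \<subseteq> K"
  using subgroup_set_mult[OF Y V(1,3)] set_mult_ge1[OF V(1) sub_carrier[OF Y]] set_mult_ge2[OF Y sub_carrier[OF V(1)]]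
  by (auto simp: K(1))

lemma action_quotient:
  obtains Q :: "'a set monoid" and f where "partial_epi G Q Y f" "\<And>x. x \<in> Y \<Longrightarrow> f x = \<one>\<^bsub>Q\<^esub> \<longleftrightarrow> x \<in> N"
    "group.commuting Q (carrier Q)" "group.torsion Q (carrier Q)"
proof -
  have normalizes: "normalizes Y N" using normalizes_above[OF N(3,1) subset_refl N(2) sub_carrier[OF Y]] .
  obtain Q :: "'a set monoid" and f where Q: "partial_epi G Q Y f" and ker: "\<And>x. x \<in> Y \<Longrightarrow> f x = \<one>\<^bsub>Q\<^esub> \<longleftrightarrow> x \<in> N"
    using quotient_exists[OF normal_inI[OF N(1) Y N(2) normalizes]] by metis
  interpret E: partial_epi G Q Y f by (rule Q)
  have "E.pullback {\<one>\<^bsub>Q\<^esub>} = N" using ker N(2) by (auto simp: E.pullback_def)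
  then have "E.Q.commuting (carrier Q)" using E.commuting_image[of Y] N(3) E.onto by simp
  moreover have "E.Q.torsion (carrier Q)" using E.torsion_quotient torsion_mono[OF K(2) action_K(2)] by blast
  ultimately show ?thesis using that[OF Q ker] by blast
qed

text \<open>Put \<open>Q = Y/N\<close>. If \<open>Q/Q^p\<close> were infinite, a cover of this
  elementary abelian group would pull back to one of \<open>Y\<close>, and \<open>Y\<close> would be
  subnormal. So \<open>Q^p\<close> has finite index, some \<open>Q^(p^k)\<close> is
  \<open>p\<close>-divisible, and \<open>D\<close> is its preimage, in which \<open>p\<close>-th
  roots exist up to a factor in \<open>N\<close>.\<close>

lemma action_divisible_subgroup:
  assumes nsn: "\<not> subnormal_in Y K"
  obtains D where "subgroup D G" "N \<subseteq> D" "D \<subseteq> Y" "finite_index D Y" "\<And>x. x \<in> D \<Longrightarrow> \<exists>y\<in>D. \<exists>n\<in>N. x = y [^] p \<otimes> n"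
proof -
  note p0 = prime_gt_0_nat[OF p(1)]
  obtain Q :: "'a set monoid" and f where Q: "partial_epi G Q Y f" and ker: "\<And>x. x \<in> Y \<Longrightarrow> f x = \<one>\<^bsub>Q\<^esub> \<longleftrightarrow> x \<in> N"
    and Qab: "group.commuting Q (carrier Q)" "group.torsion Q (carrier Q)"
    using action_quotient by blast
  interpret E: partial_epi G Q Y f by (rule Q)
  note Qs = E.Q.subgroup_self
  have pb1: "E.pullback {\<one>\<^bsub>Q\<^esub>} = N" using ker N(2) by (auto simp: E.pullback_def)
  have Nle: "N \<subseteq> E.pullback S" if "subgroup S Q" for S
    using pb1 E.pullback_mono[of "{\<one>\<^bsub>Q\<^esub>}" S] E.Q.sub_one[OF that] by simp
  define P where "P = E.Q.power_image (carrier Q) p"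
  have P: "subgroup P Q" unfolding P_def by (rule E.Q.power_image_subgroup[OF Qs Qab(1)])
  have fiP: "E.Q.finite_index P (carrier Q)"
  proof (rule ccontr)
    assume nfi: "\<not> E.Q.finite_index P (carrier Q)"
    have nrmP: "E.Q.normal_in P (carrier Q)"
      by (rule E.Q.normal_inI[OF P Qs E.Q.sub_carrier[OF P] E.Q.commuting_normalizes[OF Qab(1)]]) (use E.Q.sub_carrier[OF P] in auto)
    obtain R :: "'a set set monoid" and h where R: "partial_epi Q R (carrier Q) h"
      and kerh: "\<And>x. x \<in> carrier Q \<Longrightarrow> h x = \<one>\<^bsub>R\<^esub> \<longleftrightarrow> x \<in> P"
      using E.Q.quotient_exists[OF nrmP] by metis
    interpret H: partial_epi Q R "carrier Q" h by (rule R)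
    have "H.pullback {\<one>\<^bsub>R\<^esub>} = P" using kerh E.Q.sub_carrier[OF P] by (auto simp: H.pullback_def)
    then have Rab: "H.Q.commuting (carrier R)"
      using H.commuting_image[of "carrier Q"] E.Q.commutators_in_mono[OF E.Q.commuting_commutators_in[OF Qab(1) subset_refl], of "carrier Q" P] E.Q.sub_one[OF P] H.onto
      by simp
    have Rp: "x [^]\<^bsub>R\<^esub> p = \<one>\<^bsub>R\<^esub>" if x: "x \<in> carrier R" for x
    proof -
      obtain q where q: "q \<in> carrier Q" "x = h q" using x H.onto by auto
      then have "q [^]\<^bsub>Q\<^esub> p \<in> P" by (auto simp: P_def E.Q.power_image_def)
      then show ?thesis using kerh[of "q [^]\<^bsub>Q\<^esub> p"] q by (simp add: H.f_pow)
    qed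
    have infR: "infinite (carrier R)"
    proof
      assume "finite (carrier R)"
      then have "finite (h ` carrier Q)" using H.onto by simp
      then have "E.Q.finite_index P (carrier Q)"
      proof (rule E.Q.finite_index_by_map[OF P subset_refl])
        fix s t assume st: "s \<in> carrier Q" "t \<in> carrier Q" "h s = h t"
        then have "h (s \<otimes>\<^bsub>Q\<^esub> inv\<^bsub>Q\<^esub> t) = \<one>\<^bsub>R\<^esub>" by (simp add: H.hom H.f_inv H.f_closed)
        then show "s \<otimes>\<^bsub>Q\<^esub> inv\<^bsub>Q\<^esub> t \<in> P" using kerh st by simp
      qed
      then show False using nfi by blast
    qed
    obtain F :: "nat set \<Rightarrow> 'a set set set" where F: "\<And>J. subgroup (F J) R" "F UNIV = carrier R"
      "\<And>I J. I \<subset> J \<Longrightarrow> F I \<subset> F J" "\<And>I J. F (I \<union> J) \<subseteq> F I <#>\<^bsub>R\<^esub> F J"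
      using H.Q.elementary_cover[OF H.Q.subgroup_self Rab p(1) Rp infR] by blast
    define F' where "F' J = E.pullback (H.pullback (F J))" for J
    have F': "subgroup (F' J) G" "N \<subseteq> F' J" "F' J \<subseteq> Y" for J
      unfolding F'_def using E.pullback_subgroup[OF H.pullback_subgroup[OF F(1)]] Nle[OF H.pullback_subgroup[OF F(1)]] E.pullback_subset by auto
    have "subnormal_in Y K"
    proof (rule product_cover_imp_subnormal_in[of F', OF F'(1) _ _ _ _ K(4) action_K(2)])
      show "normalizes Y (F' J)" for J using normalizes_above[OF N(3) F' sub_carrier[OF Y]] .
      show "F' UNIV = Y" by (simp add: F'_def F(2) H.pullback_carrier E.pullback_carrier)
      show "F' I \<subset> F' J" if "I \<subset> J" for I J unfolding F'_def
        by (intro E.pullback_psubset H.pullback_psubset F(3)[OF that] H.Q.sub_carrier[OF F(1)] H.pullback_subset)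
      show "F' (I \<union> J) \<subseteq> F' I <#> F' J" for I J
      proof
        fix x assume "x \<in> F' (I \<union> J)"
        then have x: "x \<in> Y" "h (f x) \<in> F (I \<union> J)" by (auto simp: F'_def E.pullback_def H.pullback_def)
        then have "h (f x) \<in> F I <#>\<^bsub>R\<^esub> F J" using F(4) by blast
        then obtain a b where ab: "a \<in> F I" "b \<in> F J" "h (f x) = a \<otimes>\<^bsub>R\<^esub> b" by (rule H.Q.set_multE)
        have abc: "a \<in> carrier R" "b \<in> carrier R" using ab H.Q.mem_carrier_of[OF F(1)] by auto
        obtain q where q: "q \<in> carrier Q" "a = h q" using abc H.onto by auto
        obtain y where y: "y \<in> Y" "q = f y" using q E.onto by auto
        have "h (f (inv y \<otimes> x)) = inv\<^bsub>R\<^esub> a \<otimes>\<^bsub>R\<^esub> (a \<otimes>\<^bsub>R\<^esub> b)"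
          using x y q ab sub_inv[OF Y y(1)] by (simp add: E.hom E.f_inv E.f_closed H.hom H.f_inv)
        then have "h (f (inv y \<otimes> x)) = b" using abc by simp
        then have "inv y \<otimes> x \<in> F' J" using sub_mult[OF Y sub_inv[OF Y y(1)] x(1)] ab
          by (auto simp: F'_def E.pullback_def H.pullback_def)
        moreover have "y \<in> F' I" using y q ab by (auto simp: F'_def E.pullback_def H.pullback_def)
        moreover have "x = y \<otimes> (inv y \<otimes> x)" using x y mem_carrier_of[OF Y] by simp
        ultimately show "x \<in> F' I <#> F' J" using set_multI by metis
      qed
    qed
    then show False using nsn by blast
  qed
  obtain k where k: "E.Q.power_image (carrier Q) (p ^ k) = E.Q.power_image (carrier Q) (p ^ Suc k)"
    "E.Q.finite_index (E.Q.power_image (carrier Q) (p ^ k)) (carrier Q)"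
    using E.Q.p_divisible_part[OF Qs Qab p0] fiP unfolding P_def by blast
  define J where "J = E.Q.power_image (carrier Q) (p ^ k)"
  have J: "subgroup J Q" unfolding J_def by (rule E.Q.power_image_subgroup[OF Qs Qab(1)])
  have Jdiv: "E.Q.power_image J p = J"
    unfolding J_def E.Q.power_image_power_image[OF Qs] using k(1) by (simp add: mult.commute)
  define D where "D = E.pullback J"
  have D: "subgroup D G" "N \<subseteq> D" "D \<subseteq> Y" unfolding D_def using E.pullback_subgroup[OF J] Nle[OF J] E.pullback_subset by auto
  have fiD: "finite_index D Y" unfolding D_def using E.finite_index_pullback[OF J] k(2) by (simp add: J_def)
  have "\<exists>y\<in>D. \<exists>n\<in>N. x = y [^] p \<otimes> n" if x: "x \<in> D" for x
  proof -
    have xY: "x \<in> Y" "f x \<in> J" using x by (auto simp: D_def E.pullback_def)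
    then obtain j where j: "j \<in> J" "f x = j [^]\<^bsub>Q\<^esub> p" using Jdiv by (auto simp: E.Q.power_image_def)
    have "j \<in> f ` Y" using E.Q.mem_carrier_of[OF J j(1)] E.onto by simp
    then obtain y where y: "y \<in> Y" "j = f y" by blast
    have yp: "y [^] p \<in> Y" using sub_pow[OF Y y(1)] .
    have "f (inv (y [^] p) \<otimes> x) = \<one>\<^bsub>Q\<^esub>" using j y xY yp sub_inv[OF Y yp] by (simp add: E.hom E.f_inv E.f_pow E.f_closed)
    then have "inv (y [^] p) \<otimes> x \<in> N" using ker sub_mult[OF Y sub_inv[OF Y yp] xY(1)] by blast
    moreover have "x = y [^] p \<otimes> (inv (y [^] p) \<otimes> x)" using mem_carrier_of[OF Y] xY yp by simp
    moreover have "y \<in> D" using y j by (auto simp: D_def E.pullback_def)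
    ultimately show ?thesis by blast
  qed
  then show ?thesis using that[OF D fiD] by blast
qed

context
  fixes D :: "'a set"
  assumes D: "subgroup D G" "N \<subseteq> D" "D \<subseteq> Y" "finite_index D Y"
    and div: "\<And>x. x \<in> D \<Longrightarrow> \<exists>y\<in>D. \<exists>n\<in>N. x = y [^] p \<otimes> n"
begin

lemma action_D_normal: "normalizes Y D"
  using normalizes_above[OF N(3) D(1-3) sub_carrier[OF Y]] .

text \<open>\<open>D\<close> is then normal in \<open>K\<close>, and \<open>Y\<close> arises from it
  by adjoining finitely many elements. Each of these generates a subnormal cyclic group that
  normalises the subgroup reached so far, since this contains \<open>N\<close>; so the joins stay
  subnormal.\<close>

lemma action_trivial_imp_subnormal_in:
  assumes triv: "\<And>x v. x \<in> D \<Longrightarrow> v \<in> V \<Longrightarrow> conjg x v = v"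
  shows "subnormal_in Y K"
proof -
  note Yc = mem_carrier_of[OF Y] and Vc = mem_carrier_of[OF V(1)] and Dc = mem_carrier_of[OF D(1)]
  have "normal_in D K"
  proof (rule normal_inI[OF D(1) action_K(1)])
    show "D \<subseteq> K" using D action_K by blast
    show "normalizes K D"
    proof (rule normalizesI)
      fix u x assume u: "u \<in> K" and x: "x \<in> D"
      then obtain y v where yv: "y \<in> Y" "v \<in> V" "u = y \<otimes> v" unfolding K(1) by (metis set_multE)
      have "conjg v x = x" using triv[OF x yv(2)] conjg_fix_sym Dc[OF x] Vc[OF yv(2)] by blast
      then have "conjg u x = conjg y x" using yv Yc Vc Dc x by (simp flip: conjg_conjg)
      then show "conjg u x \<in> D" using normalizesD[OF action_D_normal yv(1) x] by simp
    qed
  qed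
  then have snD: "subnormal_in D K" by (rule normal_in_imp_subnormal_in)
  obtain S where S: "finite S" "S \<subseteq> Y" "Y \<subseteq> D <#> S" using D(4) unfolding finite_index_def by blast
  have "\<exists>E. subgroup E G \<and> D \<subseteq> E \<and> S \<subseteq> E \<and> E \<subseteq> Y \<and> subnormal_in E K"
    using S(1,2)
  proof (induction S)
    case empty then show ?case using D snD by blast
  next
    case (insert x S)
    then obtain E where E: "subgroup E G" "D \<subseteq> E" "S \<subseteq> E" "E \<subseteq> Y" "subnormal_in E K" by blast
    have x: "x \<in> Y" "x \<in> K" "x \<in> carrier G" using insert action_K Yc by auto
    have P: "subgroup (powers x) G" "powers x \<subseteq> Y" using torsion_powers_subgroup[OF K(2) action_K(1) x(2)] powers_le[OF Y x(1)] by auto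
    have normalizes: "normalizes (powers x) E" using normalizes_above[OF N(3) E(1) _ E(4) sub_carrier[OF Y]] D(2) E(2) normalizes_mono P(2) by blast
    have "subnormal_in (powers x <#> E) K" using subnormal_in_join[OF _ E(5) normalizes] K(3) x(2) unfolding baer_def by blast
    moreover have "E \<subseteq> powers x <#> E" "x \<in> powers x <#> E"
      using set_mult_ge2[OF P(1) sub_carrier[OF E(1)]] set_mult_ge1[OF E(1) sub_carrier[OF P(1)]] powers_self[OF x(3)] by auto
    ultimately show ?case
      using subgroup_set_mult[OF P(1) E(1) normalizes] E(2,3) set_mult_le[OF Y P(2) E(4)] by (intro exI[of _ "powers x <#> E"]) auto
  qed
  then obtain E where E: "subgroup E G" "D \<subseteq> E" "S \<subseteq> E" "E \<subseteq> Y" "subnormal_in E K" by blast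
  have "Y \<subseteq> E" using S(3) set_mult_le[OF E(1-3)] by blast
  then show ?thesis using E by (metis subset_antisym)
qed

lemma action_act_N:
  assumes "y \<in> D" "n \<in> N" "v \<in> V" shows "conjg (y \<otimes> n) v = conjg y v" "conjg (n \<otimes> y) v = conjg y v"
proof -
  have c: "y \<in> carrier G" "n \<in> carrier G" "v \<in> carrier G" using assms mem_carrier_of[OF D(1)] mem_carrier_of[OF N(1)] mem_carrier_of[OF V(1)] by auto
  show "conjg (y \<otimes> n) v = conjg y v" using NV assms c by (simp flip: conjg_conjg)
  have "conjg y v \<in> V" using normalizesD[OF V(3)] D(3) assms by blast
  then show "conjg (n \<otimes> y) v = conjg y v" using NV assms c by (simp flip: conjg_conjg)
qed

lemma action_commutator_V: "y \<in> D \<Longrightarrow> v \<in> V \<Longrightarrow> commutator y v \<in> V"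
  using normalizesD[OF V(3)] D(3) sub_mult[OF V(1)] sub_inv[OF V(1)] unfolding commutator_def by blast

lemma action_commutator_hom: "y \<in> D \<Longrightarrow> a \<in> V \<Longrightarrow> b \<in> V \<Longrightarrow> commutator y (a \<otimes> b) = commutator y a \<otimes> commutator y b"
  "y \<in> D \<Longrightarrow> a \<in> V \<Longrightarrow> commutator y (inv a) = inv (commutator y a)"
  using commutator_mult_commuting[OF V(1,2), of y a] normalizes_mono[OF V(3), of "{y}"] D(3) mem_carrier_of[OF D(1)] by auto

lemma action_commutator_one: "y \<in> D \<Longrightarrow> commutator y \<one> = \<one>"
  using mem_carrier_of[OF D(1)] by (simp add: commutator_def)

text \<open>In characteristic \<open>p\<close>, \<open>y\<^sup>p - 1\<close> is divisible by \<open>(y - 1)\<^sup>2\<close>; \<open>commutator y\<close> plays the role of \<open>y - 1\<close>.\<close>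
lemma action_commutator_pow:
  assumes y: "y \<in> D" "n \<in> N" and W: "subgroup W G" "W \<subseteq> V" "normalizes D W"
    and w: "w \<in> V" "commutator y (commutator y w) \<in> W" "commutator y w [^] p = \<one>"
  shows "commutator (y [^] p \<otimes> n) w \<in> W"
proof -
  note Vc = mem_carrier_of[OF V(1)] and yc = mem_carrier_of[OF D(1) y(1)]
  let ?d = "commutator y w" and ?e = "commutator y (commutator y w)"
  have dV: "?d \<in> V" "?e \<in> V" using action_commutator_V y(1) w(1) by auto
  have c: "w \<in> carrier G" "?d \<in> carrier G" "?e \<in> carrier G" using Vc w(1) dV by auto
  have yw: "conjg y w = ?d \<otimes> w" using yc c by (simp add: commutator_def m_assoc)
  have yd: "conjg y ?d = ?e \<otimes> ?d" using yc c by (simp add: commutator_def[of y "commutator y w"] m_assoc)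
  \<comment> \<open>Modulo \<open>W\<close>, the power \<open>y^i\<close> moves \<open>w\<close> by
    \<open>d^i\<close>, because the second commutator is already in \<open>W\<close>. At
    \<open>i = p\<close> the factor \<open>d^p\<close> disappears.\<close>
  have "\<exists>e\<in>W. conjg (y [^] i) w = e \<otimes> (?d [^] i \<otimes> w)" for i :: nat
  proof (induction i)
    case 0 then show ?case using sub_one[OF W(1)] c by (intro bexI[of _ \<one>]) auto
  next
    case (Suc i)
    then obtain e where e: "e \<in> W" "conjg (y [^] i) w = e \<otimes> (?d [^] i \<otimes> w)" by blast
    have ec: "e \<in> carrier G" using e W mem_carrier_of by blast
    have yeW: "conjg y e \<in> W" using normalizesD[OF W(3) y(1) e(1)] .
    have "conjg (y [^] Suc i) w = conjg y (e \<otimes> (?d [^] i \<otimes> w))" using e yc c by (simp only: conjg_pow_Suc)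
    also have "\<dots> = conjg y e \<otimes> ((?e \<otimes> ?d) [^] i \<otimes> (?d \<otimes> w))"
      using ec c yc yw yd by (simp add: conjg_mult conjg_pow)
    also have "(?e \<otimes> ?d) [^] i = ?e [^] i \<otimes> ?d [^] i" using commuting_pow_mult[OF V(2) sub_carrier[OF V(1)] dV(2,1)] .
    finally have "conjg (y [^] Suc i) w = (conjg y e \<otimes> ?e [^] i) \<otimes> (?d [^] Suc i \<otimes> w)"
      using ec c yc by (simp add: m_assoc)
    moreover have "conjg y e \<otimes> ?e [^] i \<in> W" using sub_mult[OF W(1) yeW sub_pow[OF W(1) w(2)]] .
    ultimately show ?case by blast
  qed
  then obtain e where "e \<in> W" "conjg (y [^] p) w = e \<otimes> (?d [^] p \<otimes> w)" by blast
  then have e: "e \<in> W" "conjg (y [^] p) w = e \<otimes> w" using w(3) c by auto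
  have "conjg (y [^] p \<otimes> n) w = e \<otimes> w" using action_act_N(1)[OF sub_pow[OF D(1) y(1)] y(2) w(1)] e by simp
  then have "commutator (y [^] p \<otimes> n) w = e" unfolding commutator_def using e W mem_carrier_of c by (simp add: m_assoc mem_carrier_of[OF W(1)])
  then show ?thesis using e by simp
qed

text \<open>Induction on the exponent of \<open>v\<close>. A root \<open>y\<close> of
  \<open>x\<close> moves \<open>v\<close> by an element killed by \<open>p\<close>, which
  \<open>y\<close> fixes by assumption. So \<open>commutator y (commutator y v)\<close> is trivial,
  and then \<open>commutator x v\<close> is trivial too.\<close>

lemma action_trivial_on_torsion_part:
  assumes triv: "\<And>x v. x \<in> D \<Longrightarrow> v \<in> torsion_part V p \<Longrightarrow> conjg x v = v" and x: "x \<in> D" and v: "v \<in> V"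
  shows "conjg x v = v"
proof -
  note Vc = mem_carrier_of[OF V(1)] and Dc = mem_carrier_of[OF D(1)]
  have "\<forall>x\<in>D. \<forall>v\<in>V. v [^] (p ^ k) = \<one> \<longrightarrow> conjg x v = v" for k
  proof (induction k)
    case 0 then show ?case using Vc Dc by auto
  next
    case (Suc k)
    show ?case
    proof (intro ballI impI)
      fix x v assume x: "x \<in> D" and v: "v \<in> V" "v [^] (p ^ Suc k) = \<one>"
      obtain y n where yn: "y \<in> D" "n \<in> N" "x = y [^] p \<otimes> n" using div[OF x] by blast
      note c = Vc[OF v(1)] Dc[OF yn(1)]
      have dV: "commutator y v \<in> V" using action_commutator_V[OF yn(1) v(1)] .
      have "(v [^] p) [^] (p ^ k) = \<one>" using v c by (simp add: nat_pow_pow)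
      then have fix0: "conjg y (v [^] p) = v [^] p" using Suc yn(1) sub_pow[OF V(1) v(1)] by blast
      have yvV: "conjg y v \<in> V" using normalizesD[OF V(3)] yn D(3) v by blast
      have dp: "commutator y v [^] p = \<one>"
        unfolding commutator_def commuting_pow_div[OF V(2,1) yvV v(1)] using fix0 c by (simp flip: conjg_pow)
      then have "conjg y (commutator y v) = commutator y v" using triv[OF yn(1)] dV by (simp add: torsion_part_def)
      then have "commutator y (commutator y v) = \<one>" using Vc[OF dV] by (simp add: commutator_def)
      then have "commutator x v \<in> {\<one>}"
        using action_commutator_pow[OF yn(1,2) triv_subgroup _ _ v(1) _ dp] yn(3) sub_one[OF V(1)] Dc by (simp add: normalizes_def)
      then show "conjg x v = v" using Dc[OF x] c by (simp add: commutator_def) (metis conjg_closed inv_equality inv_inv inv_closed)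
    qed
  qed
  then show ?thesis using p(2)[OF v] x v by blast
qed

text \<open>Inclusion alone need not be dense, as a section may have prime order. What can be
  refined is a section on which \<open>D\<close> acts non-trivially.\<close>

definition acts_between :: "'a set \<Rightarrow> 'a set \<Rightarrow> bool" where
  "acts_between W1 W2 \<longleftrightarrow> subgroup W1 G \<and> subgroup W2 G \<and> W1 \<subseteq> W2 \<and> W2 \<subseteq> torsion_part V p \<and> normalizes D W1 \<and> normalizes D W2 \<and>
    (\<exists>x\<in>D. \<exists>w\<in>W2. commutator x w \<notin> W1)"

text \<open>As \<open>K\<close> is \<open>baer\<close>, \<open>powers z\<close> is subnormal and its
  upper series in \<open>V\<close> reaches \<open>V\<close>. The length \<open>c\<close> depends on
  \<open>z\<close>.\<close>

lemma action_nilpotent: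
  assumes z: "z \<in> D"
  obtains c where "\<And>u. u \<in> V \<Longrightarrow> (commutator z ^^ c) u = \<one>"
proof -
  have zK: "z \<in> K" "z \<in> Y" using z D action_K by auto
  have P: "subgroup (powers z) G" "powers z \<subseteq> Y" "powers z \<subseteq> K"
    using torsion_powers_subgroup[OF K(2) action_K(1) zK(1)] powers_le[OF Y zK(2)] powers_le[OF action_K(1) zK(1)] by auto
  have normalizes: "normalizes (powers z) V" using normalizes_mono[OF V(3) P(2)] .
  have "subnormal_in (powers z) K" using K(3) zK unfolding baer_def by blast
  then have "subnormal_in (powers z) (powers z <#> V)"
    by (rule subnormal_in_restrict[OF _ subgroup_set_mult[OF P(1) V(1) normalizes] set_mult_ge1[OF V(1) sub_carrier[OF P(1)]] set_mult_le[OF action_K(1) P(3) action_K(3)]])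
  moreover have "powers z \<inter> V = {\<one>}" using disj P sub_one[OF P(1)] sub_one[OF V(1)] by blast
  ultimately obtain c where c: "upper_series (powers z) V c = V" using subnormal_in_imp_upper_series_full[OF P(1) V(1,2) normalizes] by blast
  have zz: "z \<in> powers z" using powers_self mem_carrier_of[OF D(1) z] by blast
  have "u \<in> upper_series (powers z) V j \<Longrightarrow> (commutator z ^^ j) u = \<one>" for u j
  proof (induction j arbitrary: u)
    case 0 then show ?case by simp
  next
    case (Suc j)
    then have "commutator z u \<in> upper_series (powers z) V j" using zz by simp
    then show ?case using Suc.IH by (simp add: funpow_swap1)
  qed
  then show ?thesis using that c by metis
qed

text \<open>Conjugation by an element of \<open>D\<close> changes \<open>z\<close> only by a factor
  in \<open>N\<close>, which acts trivially. Hence the image of \<open>commutator z\<close> is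
  invariant under all of \<open>D\<close>.\<close>

lemma action_image_subgroup:
  assumes z: "z \<in> D" and W: "subgroup W G" "W \<subseteq> V" "normalizes D W"
  shows "subgroup (commutator z ` W) G" "commutator z ` W \<subseteq> W" "normalizes D (commutator z ` W)"
proof -
  note Vc = mem_carrier_of[OF V(1)] and Dc = mem_carrier_of[OF D(1)]
  have WV: "w \<in> V" if "w \<in> W" for w using that W by blast
  show sub: "commutator z ` W \<subseteq> W" using normalizesD[OF W(3) z] sub_mult[OF W(1)] sub_inv[OF W(1)] unfolding commutator_def by blast
  show "subgroup (commutator z ` W) G"
  proof (rule subgroup_criterion)
    show "commutator z ` W \<subseteq> carrier G" using sub sub_carrier[OF W(1)] by blast
    show "\<one> \<in> commutator z ` W" using action_commutator_one[OF z] sub_one[OF W(1)] by (metis imageI)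
    show "inv a \<in> commutator z ` W" if "a \<in> commutator z ` W" for a
      using that action_commutator_hom(2)[OF z] WV sub_inv[OF W(1)] by (auto simp flip: action_commutator_hom(2)[OF z] intro!: imageI)
    show "a \<otimes> b \<in> commutator z ` W" if "a \<in> commutator z ` W" "b \<in> commutator z ` W" for a b
      using that WV sub_mult[OF W(1)] by (auto simp flip: action_commutator_hom(1)[OF z] intro!: imageI)
  qed
  show "normalizes D (commutator z ` W)"
  proof (rule normalizesI)
    fix t a assume t: "t \<in> D" and "a \<in> commutator z ` W"
    then obtain w where w: "w \<in> W" "a = commutator z w" by blast
    have tw: "conjg t w \<in> W" using normalizesD[OF W(3) t w(1)] .
    have c: "t \<in> carrier G" "z \<in> carrier G" "w \<in> carrier G" using Dc t z Vc WV w by auto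
    have kN: "commutator t z \<in> N" using N(3) t z D(3) by (auto simp: commutators_in_commutator)
    have "conjg t z = commutator t z \<otimes> z" using c by (simp add: commutator_def m_assoc)
    then have "conjg (conjg t z) (conjg t w) = conjg z (conjg t w)" using action_act_N(2)[OF z kN WV[OF tw]] by simp
    then have "commutator (conjg t z) (conjg t w) = commutator z (conjg t w)" by (simp add: commutator_def)
    then have "conjg t a = commutator z (conjg t w)" using w c by (simp add: conjg_commutator)
    then show "conjg t a \<in> commutator z ` W" using tw by blast
  qed
qed

lemma action_mult_subgroup:
  assumes "subgroup W G" "W \<subseteq> V" "normalizes D W" "subgroup W' G" "W' \<subseteq> V" "normalizes D W'"
  shows "subgroup (W <#> W') G" "W <#> W' \<subseteq> V" "normalizes D (W <#> W')" "W \<subseteq> W <#> W'" "W' \<subseteq> W <#> W'"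
proof -
  show "subgroup (W <#> W') G"
    using subgroup_set_mult assms commuting_normalizes[OF V(2) sub_carrier[OF V(1)]] by blast
  show "W <#> W' \<subseteq> V" using set_mult_le[OF V(1)] assms by blast
  show "W \<subseteq> W <#> W'" by (rule set_mult_ge1[OF assms(4) sub_carrier[OF assms(1)]])
  show "W' \<subseteq> W <#> W'" by (rule set_mult_ge2[OF assms(1) sub_carrier[OF assms(4)]])
  show "normalizes D (W <#> W')"
  proof (rule normalizesI)
    fix t a assume t: "t \<in> D" and "a \<in> W <#> W'"
    then obtain u v where uv: "u \<in> W" "v \<in> W'" "a = u \<otimes> v" by (metis set_multE)
    then have "conjg t a = conjg t u \<otimes> conjg t v" using mem_carrier_of[OF D(1) t] mem_carrier_of[OF assms(1)] mem_carrier_of[OF assms(4)] by (simp add: conjg_mult)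
    then show "conjg t a \<in> W <#> W'" using normalizesD[OF assms(3) t uv(1)] normalizesD[OF assms(6) t uv(2)] set_multI by metis
  qed
qed

text \<open>The middle term is \<open>M = W1 [y,W2]\<close> for a root \<open>y\<close> of the
  element \<open>x\<close> that acts non-trivially. The action on \<open>M/W1\<close> is
  non-trivial, since otherwise \<open>commutator x w\<close> would fall into \<open>W1\<close>. If
  the action on \<open>W2/M\<close> were trivial, a root \<open>z\<close> of \<open>y\<close> would
  satisfy \<open>[z,W2] \<subseteq> M \<subseteq> W1 [z,[z,W2]]\<close>, because
  \<open>y - 1\<close> is a multiple of the square of \<open>z - 1\<close>. Iteration and the
  unipotence of \<open>z\<close> give \<open>[z,W2] \<subseteq> W1\<close>, so that \<open>y\<close>
  too would act trivially on \<open>W2/W1\<close>.\<close>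

lemma acts_between_dense:
  assumes "acts_between W1 W2" shows "\<exists>W. acts_between W1 W \<and> acts_between W W2"
proof -
  have W: "subgroup W1 G" "subgroup W2 G" "W1 \<subseteq> W2" "W2 \<subseteq> torsion_part V p" "normalizes D W1" "normalizes D W2"
    using assms by (auto simp: acts_between_def)
  obtain x w where xw: "x \<in> D" "w \<in> W2" "commutator x w \<notin> W1" using assms by (auto simp: acts_between_def)
  have WV: "W1 \<subseteq> V" "W2 \<subseteq> V" using W by (auto simp: torsion_part_def)
  have ep: "u [^] p = \<one>" if "u \<in> W2" for u using that W by (auto simp: torsion_part_def)
  \<comment> \<open>Two successive roots are taken: \<open>y\<close> defines the middle term, and
    \<open>z\<close> serves to refute a trivial action above it.\<close>
  obtain y n where y: "y \<in> D" "n \<in> N" "x = y [^] p \<otimes> n" using div[OF xw(1)] by blast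
  obtain z n' where z: "z \<in> D" "n' \<in> N" "y = z [^] p \<otimes> n'" using div[OF y(1)] by blast
  note Iy = action_image_subgroup[OF y(1) W(2) WV(2) W(6)]
  have IyV: "commutator y ` W2 \<subseteq> V" using Iy WV by blast
  define M where "M = W1 <#> commutator y ` W2"
  note M = action_mult_subgroup[OF W(1) WV(1) W(5) Iy(1) IyV Iy(3), folded M_def]
  have MW2: "M \<subseteq> W2" unfolding M_def using set_mult_le[OF W(2,3) Iy(2)] .
  have yyw: "commutator y (commutator y w) \<notin> W1"
    using action_commutator_pow[OF y(1,2) W(1) WV(1) W(5), of w] y(3) xw WV ep Iy(2) by blast
  have "commutator y w \<in> M" using M(5) xw(2) by blast
  then have "\<exists>x\<in>D. \<exists>w\<in>M. commutator x w \<notin> W1" using y(1) yyw by blast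
  then have "acts_between W1 M" unfolding acts_between_def
    using W M MW2 by (intro conjI) auto
  moreover have "acts_between M W2"
  proof (rule ccontr)
    assume "\<not> acts_between M W2"
    then have all: "commutator t u \<in> M" if "t \<in> D" "u \<in> W2" for t u using that M W MW2 unfolding acts_between_def by blast
    note Iz = action_image_subgroup[OF z(1) W(2) WV(2) W(6)]
    have IzV: "commutator z ` W2 \<subseteq> V" using Iz WV by blast
    note Izz = action_image_subgroup[OF z(1) Iz(1) IzV Iz(3)]
    have IzzV: "commutator z ` commutator z ` W2 \<subseteq> V" using Izz IzV by blast
    define L where "L = W1 <#> commutator z ` commutator z ` W2"
    note L = action_mult_subgroup[OF W(1) WV(1) W(5) Izz(1) IzzV Izz(3), folded L_def]
    have "commutator y u \<in> L" if u: "u \<in> W2" for u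
    proof -
      have "commutator z (commutator z u) \<in> L" using L(5) u by blast
      moreover have "commutator z u [^] p = \<one>" using ep Iz(2) u by blast
      ultimately show ?thesis using action_commutator_pow[OF z(1,2) L(1-3), of u] z(3) u WV by blast
    qed
    then have "M \<subseteq> L" unfolding M_def using set_mult_le[OF L(1) L(4)] by blast
    then have zL: "commutator z u \<in> L" if "u \<in> W2" for u using all[OF z(1) that] by blast
    have fW: "(commutator z ^^ k) u \<in> W2" if "u \<in> W2" for k u by (induction k) (use that Iz(2) in auto)
    \<comment> \<open>Substituting the inclusion into itself pushes \<open>[z,W2]\<close>
      arbitrarily deep modulo \<open>W1\<close>, until unipotence makes the deep part
      trivial.\<close>
    have it: "\<forall>u\<in>W2. commutator z u \<in> W1 <#> (commutator z ^^ Suc k) ` W2" for k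
    proof (induction k)
      case 0
      have "commutator z ` W2 \<subseteq> W1 <#> commutator z ` W2" using set_mult_ge2[OF W(1) sub_carrier[OF Iz(1)]] .
      then show ?case by auto
    next
      case (Suc k)
      show ?case
      proof
        fix u assume "u \<in> W2"
        then have "commutator z u \<in> L" by (rule zL)
        then obtain w1 a where a: "w1 \<in> W1" "a \<in> commutator z ` commutator z ` W2" "commutator z u = w1 \<otimes> a" unfolding L_def by (rule set_multE)
        then obtain u' where u': "u' \<in> W2" "a = commutator z (commutator z u')" by auto
        have "commutator z u' \<in> W1 <#> (commutator z ^^ Suc k) ` W2" using Suc u' by blast
        then obtain w2 b where b: "w2 \<in> W1" "b \<in> (commutator z ^^ Suc k) ` W2" "commutator z u' = w2 \<otimes> b" by (rule set_multE)
        then obtain v where v: "v \<in> W2" "b = (commutator z ^^ Suc k) v" by auto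
        have bW: "b \<in> W2" using fW[OF v(1)] v by blast
        have zw: "commutator z w2 \<in> W1" using normalizesD[OF W(5) z(1) b(1)] sub_mult[OF W(1)] sub_inv[OF W(1)] b unfolding commutator_def by blast
        have "a = commutator z w2 \<otimes> commutator z b" using u' b action_commutator_hom(1)[OF z(1)] WV bW by auto
        then have "commutator z u = (w1 \<otimes> commutator z w2) \<otimes> commutator z b"
          using a zw bW Iz(2) mem_carrier_of[OF W(1)] mem_carrier_of[OF W(2)] by (simp add: m_assoc image_subset_iff)
        moreover have "commutator z b = (commutator z ^^ Suc (Suc k)) v" using v by simp
        ultimately show "commutator z u \<in> W1 <#> (commutator z ^^ Suc (Suc k)) ` W2"
          using set_multI[of "w1 \<otimes> commutator z w2" W1 "commutator z b"] sub_mult[OF W(1) a(1) zw] v(1) by auto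
      qed
    qed
    obtain c where c: "\<And>u. u \<in> V \<Longrightarrow> (commutator z ^^ c) u = \<one>" using action_nilpotent[OF z(1)] by blast
    have zW1: "commutator z u \<in> W1" if u: "u \<in> W2" for u
    proof -
      have "commutator z u \<in> W1 <#> (commutator z ^^ Suc c) ` W2" using it u by blast
      then obtain w1 a where a: "w1 \<in> W1" "a \<in> (commutator z ^^ Suc c) ` W2" "commutator z u = w1 \<otimes> a" by (rule set_multE)
      then obtain v where v: "v \<in> W2" "a = (commutator z ^^ Suc c) v" by auto
      then have "a = \<one>" using c[of v] WV action_commutator_one[OF z(1)] by auto
      then show ?thesis using a mem_carrier_of[OF W(1)] by simp
    qed
    have "commutator y u \<in> W1" if u: "u \<in> W2" for u
    proof -
      have "commutator z (commutator z u) \<in> W1" using zW1 Iz(2) u by blast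
      moreover have "commutator z u [^] p = \<one>" using ep Iz(2) u by blast
      ultimately show ?thesis using action_commutator_pow[OF z(1,2) W(1) WV(1) W(5), of u] z(3) u WV by blast
    qed
    then show False using yyw Iy(2) xw(2) by blast
  qed
  ultimately show ?thesis by blast
qed

lemma acts_between_psubset: "acts_between W1 W2 \<Longrightarrow> W1 \<subset> W2"
proof -
  assume "acts_between W1 W2"
  then have W: "subgroup W2 G" "W1 \<subseteq> W2" "normalizes D W2" and "\<exists>x\<in>D. \<exists>w\<in>W2. commutator x w \<notin> W1" by (auto simp: acts_between_def)
  then obtain x w where xw: "x \<in> D" "w \<in> W2" "commutator x w \<notin> W1" by blast
  have "commutator x w \<in> W2" unfolding commutator_def using sub_mult[OF W(1) normalizesD[OF W(3) xw(1,2)] sub_inv[OF W(1) xw(2)]] .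
  then show ?thesis using W xw by blast
qed

text \<open>Going up a series from \<open>D <#> H\<close>, a commutator of \<open>D\<close> with an
  element of the next term lies in the term below, so a second commutator with the same
  \<open>y\<close> lies in \<open>H\<close>. Divisibility turns two steps into one:
  \<open>commutator x u\<close> is in \<open>H\<close> already, whatever the length of the
  series.\<close>

lemma action_subnormal_in_trivial:
  assumes H: "subgroup H G" "H \<subseteq> torsion_part V p" "normalizes D H" and subnormal_in: "subnormal_in (D <#> H) K"
    and x: "x \<in> D" and u: "u \<in> torsion_part V p"
  shows "commutator x u \<in> H"
proof -
  have HV: "H \<subseteq> V" using H by (auto simp: torsion_part_def)
  note Hc = sub_carrier[OF H(1)] and Dc = sub_carrier[OF D(1)]
  have U: "torsion_part V p \<subseteq> V" "subgroup (torsion_part V p) G" using torsion_part_subgroup[OF V(1,2)] by (auto simp: torsion_part_def)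
  have DL: "D \<subseteq> D <#> H" using set_mult_ge1[OF H(1) Dc] .
  have "D <#> H \<subseteq> L \<and> (\<forall>x\<in>D. \<forall>u\<in>torsion_part V p \<inter> L. commutator x u \<in> H)" if "subnormal_in (D <#> H) L" for L
    using that
  proof (induction rule: subnormal_in_induct)
    case refl
    have "u \<in> H" if u: "u \<in> torsion_part V p" "u \<in> D <#> H" for u
    proof -
      obtain d h where dh: "d \<in> D" "h \<in> H" "u = d \<otimes> h" using u(2) by (rule set_multE)
      have "d \<in> V" using u(1) dh U HV sg_mult_right_iff[OF V(1), of h d] Dc by auto
      then have "d = \<one>" using disj dh D(3) by blast
      then show ?thesis using dh Hc by auto
    qed
    then show ?case using normalizesD[OF H(3)] sub_mult[OF H(1)] sub_inv[OF H(1)] unfolding commutator_def by blast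
  next
    case (step L M)
    have LM: "subgroup L G" "subgroup M G" "L \<subseteq> M" "normalizes M L" using step by (auto simp: normal_in_def)
    have "commutator x u \<in> H" if x: "x \<in> D" and u: "u \<in> torsion_part V p" "u \<in> M" for x u
    proof -
      obtain y n where y: "y \<in> D" "n \<in> N" "x = y [^] p \<otimes> n" using div[OF x] by blast
      have uV: "u \<in> V" using u U by blast
      have yu: "commutator y u \<in> torsion_part V p"
      proof -
        have "conjg y u \<in> torsion_part V p"
          using u normalizesD[OF V(3)] y D(3) mem_carrier_of[OF D(1)] mem_carrier_of[OF V(1)] by (auto simp: torsion_part_def simp flip: conjg_pow)
        then show ?thesis unfolding commutator_def using sub_mult[OF U(2)] sub_inv[OF U(2)] u by blast
      qed
      have cc: "y \<in> carrier G" "u \<in> carrier G" using y uV Dc mem_carrier_of[OF V(1)] by auto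
      have "commutator y u = y \<otimes> conjg u (inv y)" using cc by (simp add: commutator_def conjg_def m_assoc)
      moreover have "y \<in> L" using y DL step by blast
      ultimately have "commutator y u \<in> L" using sub_mult[OF LM(1)] sub_inv[OF LM(1)] normalizesD[OF LM(4) u(2)] by simp
      then have "commutator y (commutator y u) \<in> H" using step y yu by blast
      moreover have "commutator y u [^] p = \<one>" using yu by (simp add: torsion_part_def)
      ultimately show ?thesis using action_commutator_pow[OF y(1,2) H(1) HV H(3) uV] y(3) by blast
    qed
    then show ?case using step LM by blast
  qed
  from this[OF subnormal_in] show ?thesis using x u U action_K(3) by blast
qed

text \<open>One application of density splits off \<open>W\<close>. The chain is built below
  \<open>W\<close>, and the non-trivial action that remains above \<open>W\<close> keeps every
  \<open>D <#> H r\<close> from being subnormal.\<close>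

lemma action_contradiction:
  assumes nsn: "\<not> subnormal_in Y K" shows False
proof -
  have U: "torsion_part V p \<subseteq> V" "subgroup (torsion_part V p) G" using torsion_part_subgroup[OF V(1,2)] by (auto simp: torsion_part_def)
  have nzU: "normalizes D (torsion_part V p)"
    using normalizesD[OF V(3)] D(3) mem_carrier_of[OF D(1)] mem_carrier_of[OF V(1)] by (auto simp: normalizes_def torsion_part_def simp flip: conjg_pow)
  obtain x v where xv: "x \<in> D" "v \<in> torsion_part V p" "conjg x v \<noteq> v"
    using action_trivial_imp_subnormal_in action_trivial_on_torsion_part nsn by blast
  have "commutator x v \<noteq> \<one>"
    using xv U mem_carrier_of[OF V(1)] mem_carrier_of[OF D(1)] by (metis conjg_eq_self_iff commutator_one_iff subsetD)
  then have "acts_between {\<one>} (torsion_part V p)"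
    unfolding acts_between_def using triv_subgroup U nzU sub_one[OF U(2)] xv mem_carrier_of[OF D(1)] by (auto simp: normalizes_def)
  then obtain W where W: "acts_between {\<one>} W" "acts_between W (torsion_part V p)" using acts_between_dense by blast
  obtain x u where xu: "x \<in> D" "u \<in> torsion_part V p" "commutator x u \<notin> W" using W(2) by (auto simp: acts_between_def)
  obtain H :: "real \<Rightarrow> 'a set" and C where H: "strict_mono H"
    "\<And>r. H r = \<Union>(C r)" "\<And>r. C r \<noteq> {}"
    "\<And>r U. U \<in> C r \<Longrightarrow> {\<one>} \<subseteq> U \<and> U \<subseteq> W \<and> (\<exists>V. acts_between U V)"
    "\<And>r U V. U \<in> C r \<Longrightarrow> V \<in> C r \<Longrightarrow> U \<subseteq> V \<or> V \<subseteq> U"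
    using dense_imp_real_chain[of acts_between, OF acts_between_psubset acts_between_dense W(1)] by metis
  have Hsg: "subgroup (H r) G" for r unfolding H(2)
    by (rule subgroup_Union_chain[OF H(3)]) (use H(4,5) in \<open>auto simp: acts_between_def\<close>)
  have HW: "H r \<subseteq> W" for r using H(2,4) by blast
  have HU: "H r \<subseteq> torsion_part V p" for r using HW W(2) by (auto simp: acts_between_def)
  have Hnz: "normalizes D (H r)" for r
  proof (rule normalizesI)
    fix t a assume t: "t \<in> D" and "a \<in> H r"
    then obtain S where S: "S \<in> C r" "a \<in> S" using H(2) by blast
    then have "normalizes D S" using H(4) by (auto simp: acts_between_def)
    then show "conjg t a \<in> H r" using S H(2) normalizesD t by blast
  qed
  have Lsg: "subgroup (D <#> H r) G" for r using subgroup_set_mult[OF D(1) Hsg Hnz] .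
  have nsnL: "\<not> subnormal_in (D <#> H r) K" for r
    using action_subnormal_in_trivial[OF Hsg HU Hnz _ xu(1,2)] HW xu(3) by blast
  have "strict_mono (\<lambda>r. D <#> H r)"
  proof (rule strict_monoI)
    fix r s :: real assume "r < s"
    then have rs: "H r \<subset> H s" by (rule strict_monoD[OF H(1)])
    then obtain a where a: "a \<in> H s" "a \<notin> H r" by blast
    have aV: "a \<in> V" using a HU U by blast
    have "a \<notin> D <#> H r"
    proof
      assume "a \<in> D <#> H r"
      then obtain d h where dh: "d \<in> D" "h \<in> H r" "a = d \<otimes> h" by (rule set_multE)
      have hV: "h \<in> V" using dh HU U by blast
      have "d \<in> V" using aV dh sg_mult_right_iff[OF V(1) hV] mem_carrier_of[OF D(1)] by blast
      then have "d = \<one>" using disj dh D(3) by blast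
      then show False using dh a mem_carrier_of[OF Hsg] by auto
    qed
    moreover have "a \<in> D <#> H s" using set_mult_ge2[OF D(1) sub_carrier[OF Hsg]] a by blast
    moreover have "D <#> H r \<subseteq> D <#> H s" using rs by (intro set_mult_mono) auto
    ultimately show "D <#> H r \<subset> D <#> H s" by blast
  qed
  moreover have "D <#> H r \<subseteq> K" for r
    using set_mult_le[OF action_K(1), of D "H r"] D(3) action_K(2,3) HU[of r] U(1) by blast
  ultimately show False using rccD[OF K(4)] Lsg nsnL by metis
qed

end

lemma abelian_action_subnormal_in: "subnormal_in Y K"
  using action_divisible_subgroup action_contradiction by metis

end

section \<open>From abelian quotients to soluble groups acting, and from p-groups to torsion
  groups\<close>

definition good :: "'a set \<Rightarrow> bool" where
  "good K \<longleftrightarrow> subgroup K G \<and> torsion K \<and> baer K \<and> rcc K"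

lemma good_mono: "good K \<Longrightarrow> subgroup L G \<Longrightarrow> L \<subseteq> K \<Longrightarrow> good L"
  unfolding good_def using torsion_mono baer_mono rcc_mono by blast

text \<open>Subnormality of the derived subgroup \<open>N\<close> of \<open>Y\<close> gives a finite
  series \<open>Z j\<close> in \<open>A\<close> on whose factors \<open>N\<close> acts trivially, so
  \<open>Y\<close> acts on each factor through an abelian quotient. That case is applied to
  \<open>Y <#> Z (Suc j)\<close> modulo \<open>Z j\<close>.\<close>

lemma p_group_action_step:
  assumes Y: "subgroup Y G" and A: "subgroup A G" "commuting A" "normalizes Y A" and disj: "Y \<inter> A = {\<one>}"
    and p: "Factorial_Ring.prime (p::nat)" "\<And>v. v \<in> A \<Longrightarrow> \<exists>k. v [^] (p ^ k) = \<one>"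
    and good: "good (Y <#> A)" and N: "subnormal_in (derived G Y) (derived G Y <#> A)"
  shows "subnormal_in Y (Y <#> A)"
proof -
  let ?N = "derived G Y"
  note Yc = sub_carrier[OF Y] and Ac = sub_carrier[OF A(1)]
  have N': "subgroup ?N G" "?N \<subseteq> Y" "normalizes Y ?N" "commutators_in Y ?N"
    using derived_is_subgroup[OF Yc] derived_subset[OF Y] derived_normalizes[OF Yc Yc normalizes_self[OF Y]] derived_commutators_in[OF Yc] by auto
  have nzN: "normalizes ?N A" using normalizes_mono[OF A(3) N'(2)] .
  have "?N \<inter> A = {\<one>}" using disj N'(2) sub_one[OF N'(1)] sub_one[OF A(1)] by blast
  then obtain c where c: "upper_series ?N A c = A" using subnormal_in_imp_upper_series_full[OF N'(1) A(1,2) nzN _ N] by blast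
  define Z where "Z j = upper_series ?N A j" for j
  have Z: "subgroup (Z j) G" "Z j \<subseteq> A" for j unfolding Z_def using upper_series_basic[OF N'(1) A(1,2) nzN] by auto
  have ZS: "Z j \<subseteq> Z (Suc j)" for j unfolding Z_def by (rule upper_series_Suc[OF N'(1) A(1,2) nzN])
  have nzZ: "normalizes Y (Z j)" for j unfolding Z_def by (rule upper_series_normalizes[OF N'(1) A(1,2) nzN Y N'(3) A(3)])
  have YZ: "subgroup (Y <#> Z j) G" for j using subgroup_set_mult[OF Y Z(1) nzZ] .
  have step: "subnormal_in (Y <#> Z j) (Y <#> Z (Suc j))" for j
  proof -
    define K where "K = Y <#> Z (Suc j)"
    have K: "subgroup K G" "Y \<subseteq> K" "Z (Suc j) \<subseteq> K" unfolding K_def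
      using YZ set_mult_ge1[OF Z(1) Yc] set_mult_ge2[OF Y sub_carrier[OF Z(1)]] by auto
    have ZK: "Z j \<subseteq> K" using ZS K by blast
    have "normalizes K (Z j)"
    proof (rule normalizesI)
      fix u b assume u: "u \<in> K" and b: "b \<in> Z j"
      then obtain y a where ya: "y \<in> Y" "a \<in> Z (Suc j)" "u = y \<otimes> a" unfolding K_def by (metis set_multE)
      have c: "y \<in> carrier G" "a \<in> carrier G" "b \<in> carrier G" using ya Yc Z Ac b by blast+
      have "a \<in> A" "b \<in> A" using ya b Z by blast+
      then have "conjg a b = b" using A(2) conjg_eq_self_iff[of a b] c by (auto simp: commuting_def)
      then have "conjg u b = conjg y b" using ya c by (simp flip: conjg_conjg)
      then show "conjg u b \<in> Z j" using normalizesD[OF nzZ ya(1) b] by simp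
    qed
    then have normal_in: "normal_in (Z j) K" using normal_inI[OF Z(1) K(1) ZK] by blast
    obtain Q :: "'a set monoid" and f where Q: "partial_epi G Q K f" and ker: "\<And>x. x \<in> K \<Longrightarrow> f x = \<one>\<^bsub>Q\<^esub> \<longleftrightarrow> x \<in> Z j"
      using quotient_exists[OF normal_in] by metis
    interpret E: partial_epi G Q K f by (rule Q)
    have pb1: "E.pullback {\<one>\<^bsub>Q\<^esub>} = Z j" using ker ZK by (auto simp: E.pullback_def)
    let ?V = "f ` Z (Suc j)"
    have NK: "?N \<subseteq> K" using N' K by blast
    have goodK: "good K" using good_mono[OF good K(1)] set_mult_mono[OF subset_refl Z(2)] by (simp add: K_def)
    have carr: "carrier Q = f ` Y <#>\<^bsub>Q\<^esub> ?V"
    proof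
      show "carrier Q \<subseteq> f ` Y <#>\<^bsub>Q\<^esub> ?V"
      proof
        fix q assume "q \<in> carrier Q"
        then obtain x where x: "x \<in> K" "q = f x" using E.onto by auto
        then obtain y a where ya: "y \<in> Y" "a \<in> Z (Suc j)" "x = y \<otimes> a" unfolding K_def by (metis set_multE)
        then have "y \<in> K" "a \<in> K" using K by auto
        then have "q = f y \<otimes>\<^bsub>Q\<^esub> f a" using x ya E.hom by simp
        then show "q \<in> f ` Y <#>\<^bsub>Q\<^esub> ?V" using E.Q.set_multI[OF imageI[OF ya(1)] imageI[OF ya(2)], of f f] by simp
      qed
      show "f ` Y <#>\<^bsub>Q\<^esub> ?V \<subseteq> carrier Q" using K by (intro E.Q.set_mult_le[OF E.Q.subgroup_self]) auto
    qed
    have snQ: "E.Q.subnormal_in (f ` Y) (carrier Q)"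
    proof (rule E.Q.abelian_action_subnormal_in[where N = "f ` ?N" and V = ?V and p = p])
      show "subgroup (f ` Y) Q" "subgroup (f ` ?N) Q" "subgroup ?V Q"
        using E.image_subgroup Y N'(1) Z(1) K NK by auto
      show "f ` ?N \<subseteq> f ` Y" using N' by blast
      show "E.Q.commutators_in (f ` Y) (f ` ?N)"
        unfolding E.Q.commutators_in_commutator
      proof (intro ballI)
        fix a b assume "a \<in> f ` Y" "b \<in> f ` Y"
        then obtain x y where xy: "x \<in> Y" "y \<in> Y" "a = f x" "b = f y" by auto
        then have xyK: "x \<in> K" "y \<in> K" using K by auto
        have "E.Q.commutator a b = f (commutator x y)"
          using xy xyK by (simp add: E.Q.commutator_def commutator_def E.hom E.f_conjg E.f_inv sub_conjg[OF K(1)] sub_inv[OF K(1)])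
        then show "E.Q.commutator a b \<in> f ` ?N" using N'(4) xy by (auto simp: commutators_in_commutator)
      qed
      show "E.Q.commuting ?V"
        unfolding E.Q.commuting_def using A(2) Z(2) K(3) by (auto simp: commuting_def subset_iff simp flip: E.hom)
      show "E.Q.normalizes (f ` Y) ?V" using E.normalizes_image[OF K(2,3) nzZ] .
      show "E.Q.conjg n v = v" if nv: "n \<in> f ` ?N" "v \<in> ?V" for n v
      proof -
        obtain x a where xa: "x \<in> ?N" "a \<in> Z (Suc j)" "n = f x" "v = f a" using nv by auto
        then have xaK: "x \<in> K" "a \<in> K" using NK K by auto
        have "commutator x a \<in> Z j" using xa by (auto simp: Z_def)
        then have "f (commutator x a) = \<one>\<^bsub>Q\<^esub>" using ker ZK by blast
        moreover have "f (commutator x a) = E.Q.commutator n v"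
          using xa xaK by (simp add: E.Q.commutator_def commutator_def E.hom E.f_conjg E.f_inv sub_conjg[OF K(1)] sub_inv[OF K(1)])
        moreover have "n \<in> carrier Q" "v \<in> carrier Q" using xa xaK by auto
        ultimately show ?thesis using E.Q.commutator_one_iff E.Q.conjg_eq_self_iff by simp
      qed
      show "f ` Y \<inter> ?V = {\<one>\<^bsub>Q\<^esub>}"
      proof
        show "f ` Y \<inter> ?V \<subseteq> {\<one>\<^bsub>Q\<^esub>}"
        proof
          fix q assume "q \<in> f ` Y \<inter> ?V"
          then obtain y a where ya: "y \<in> Y" "a \<in> Z (Suc j)" "q = f y" "f y = f a" by auto
          have yK: "y \<in> K" "a \<in> K" using ya K by auto
          have "f (y \<otimes> inv a) = \<one>\<^bsub>Q\<^esub>" using ya yK by (simp add: E.hom E.f_inv sub_inv[OF K(1)] E.f_closed)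
          then have "y \<otimes> inv a \<in> Z j" using ker sub_mult[OF K(1) yK(1) sub_inv[OF K(1) yK(2)]] by blast
          then have "y \<otimes> inv a \<in> A" using Z by blast
          moreover have "inv a \<in> A" using sub_inv[OF A(1)] ya Z by blast
          ultimately have "y \<in> A" using sg_mult_right_iff[OF A(1)] ya Yc by blast
          then have "y = \<one>" using disj ya by blast
          then show "q \<in> {\<one>\<^bsub>Q\<^esub>}" using ya by simp
        qed
        show "{\<one>\<^bsub>Q\<^esub>} \<subseteq> f ` Y \<inter> ?V" using sub_one[OF Y] sub_one[OF Z(1)] E.f_one by (metis Int_iff empty_subsetI imageI insert_subset)
      qed
      show "Factorial_Ring.prime p" by (rule p(1))
      show "\<exists>k. v [^]\<^bsub>Q\<^esub> (p ^ k) = \<one>\<^bsub>Q\<^esub>" if v: "v \<in> ?V" for v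
      proof -
        obtain a where a: "a \<in> Z (Suc j)" "v = f a" using v by blast
        then obtain k where "a [^] (p ^ k) = \<one>" using p(2) Z by blast
        then have "v [^]\<^bsub>Q\<^esub> (p ^ k) = \<one>\<^bsub>Q\<^esub>" using a K by (auto simp flip: E.f_pow)
        then show ?thesis by blast
      qed
      show "carrier Q = f ` Y <#>\<^bsub>Q\<^esub> ?V" by (rule carr)
      show "E.Q.torsion (carrier Q)" "E.Q.baer (carrier Q)" "E.Q.rcc (carrier Q)"
        using goodK E.torsion_quotient E.baer_quotient E.rcc_quotient by (auto simp: good_def)
    qed
    have "subnormal_in (E.pullback (f ` Y)) K" using E.subnormal_in_pullback_iff[OF E.image_subgroup[OF Y K(2)]] snQ by blast
    moreover have "E.pullback (f ` Y) = Y <#> Z j"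
    proof
      show "E.pullback (f ` Y) \<subseteq> Y <#> Z j"
      proof
        fix x assume "x \<in> E.pullback (f ` Y)"
        then obtain y where y: "x \<in> K" "y \<in> Y" "f x = f y" by (auto simp: E.pullback_def)
        have yK: "y \<in> K" using y K by blast
        have "f (inv y \<otimes> x) = \<one>\<^bsub>Q\<^esub>" using y yK by (simp add: E.hom E.f_inv sub_inv[OF K(1)] E.f_closed)
        then have "inv y \<otimes> x \<in> Z j" using ker sub_mult[OF K(1) sub_inv[OF K(1) yK] y(1)] by blast
        moreover have "x = y \<otimes> (inv y \<otimes> x)" using y yK mem_carrier_of[OF K(1)] by simp
        ultimately show "x \<in> Y <#> Z j" using set_multI y(2) by metis
      qed
      show "Y <#> Z j \<subseteq> E.pullback (f ` Y)"
      proof (rule set_mult_le[OF E.pullback_subgroup[OF E.image_subgroup[OF Y K(2)]]])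
        show "Y \<subseteq> E.pullback (f ` Y)" using K by (auto simp: E.pullback_def)
        show "Z j \<subseteq> E.pullback (f ` Y)"
          using pb1 E.pullback_mono[of "{\<one>\<^bsub>Q\<^esub>}" "f ` Y"] E.Q.sub_one[OF E.image_subgroup[OF Y K(2)]] by simp
      qed
    qed
    ultimately show ?thesis by (simp add: K_def)
  qed
  have "subnormal_in Y (Y <#> Z j)" for j
  proof (induction j)
    case 0
    have "Y <#> Z 0 = Y" unfolding Z_def using upper_series_0_mult[OF Y A(1-3)] by simp
    then show ?case using subnormal_in_refl[OF Y] by simp
  next
    case (Suc j) then show ?case using step subnormal_in_trans by blast
  qed
  then show ?thesis using c by (metis Z_def)
qed

lemma p_group_action_subnormal_in:
  assumes "subgroup Y G" and A: "subgroup A G" "commuting A" and "normalizes Y A" and "Y \<inter> A = {\<one>}"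
    and p: "Factorial_Ring.prime (p::nat)" "\<And>v. v \<in> A \<Longrightarrow> \<exists>k. v [^] (p ^ k) = \<one>"
    and "good (Y <#> A)" and "(derived G ^^ n) Y = {\<one>}"
  shows "subnormal_in Y (Y <#> A)"
  using assms(1,4,5,8,9)
proof (induction n arbitrary: Y)
  case 0
  have "{\<one>} <#> A = A" using mem_carrier_of[OF A(1)] by (auto simp: set_mult_def)
  moreover have "normal_in {\<one>} A" using triv_subgroup A(1) sub_one[OF A(1)] mem_carrier_of[OF A(1)] by (auto simp: normal_in_def normalizes_def)
  ultimately show ?case using 0 normal_in_imp_subnormal_in by simp
next
  case (Suc n)
  note Yc = sub_carrier[OF Suc.prems(1)]
  let ?N = "derived G Y"
  have N: "subgroup ?N G" "?N \<subseteq> Y" using derived_is_subgroup[OF Yc] derived_subset[OF Suc.prems(1)] by auto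
  have normalizes: "normalizes ?N A" using normalizes_mono[OF Suc.prems(2) N(2)] .
  have "subnormal_in ?N (?N <#> A)"
  proof (rule Suc.IH[OF N(1) normalizes])
    show "?N \<inter> A = {\<one>}" using Suc.prems(3) N sub_one[OF N(1)] by blast
    show "good (?N <#> A)"
      using good_mono[OF Suc.prems(4) subgroup_set_mult[OF N(1) A(1) normalizes] set_mult_mono[OF N(2) subset_refl]] .
    show "(derived G ^^ n) ?N = {\<one>}" using Suc.prems(5) by (simp add: funpow_swap1)
  qed
  then show ?case using p_group_action_step[OF Suc.prems(1) A Suc.prems(2,3) p Suc.prems(4)] by blast
qed

text \<open>If infinitely many primes occur in \<open>A\<close>, the subgroups
  \<open>torsion_part A p\<close> supply an independent family over \<open>Y\<close>. If finitely
  many occur, the lengths of the upper series of the primary parts have a maximum.\<close>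

lemma torsion_action_subnormal_in:
  assumes Y: "subgroup Y G" and A: "subgroup A G" "commuting A" "normalizes Y A" and disj: "Y \<inter> A = {\<one>}"
    and good: "good (Y <#> A)" and solv: "(derived G ^^ n) Y = {\<one>}"
  shows "subnormal_in Y (Y <#> A)"
proof -
  note Yc = mem_carrier_of[OF Y] and Ac = mem_carrier_of[OF A(1)]
  define K where "K = Y <#> A"
  have K: "subgroup K G" "Y \<subseteq> K" "A \<subseteq> K" "torsion K" "rcc K" unfolding K_def
    using good set_mult_ge1[OF A(1) sub_carrier[OF Y]] set_mult_ge2[OF Y sub_carrier[OF A(1)]] by (auto simp: good_def)
  have perA: "torsion A" using torsion_mono[OF K(4,3)] .
  define P where "P = {p::nat. Factorial_Ring.prime p \<and> torsion_part A p \<noteq> {\<one>}}"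
  have torY: "normalizes Y (torsion_part A m)" for m
    using normalizesD[OF A(3)] Yc Ac by (auto simp: normalizes_def torsion_part_def simp flip: conjg_pow)
  have tsg: "subgroup (torsion_part A m) G" "torsion_part A m \<subseteq> A" for m using torsion_part_subgroup[OF A(1,2)] by (auto simp: torsion_part_def)
  show ?thesis
  proof (cases "finite P")
    case False
    \<comment> \<open>The exponent \<open>m\<close> ensures that new primes are available: for a
      prime \<open>p > m\<close>, the elements of order \<open>p\<close> in \<open>A\<close> avoid
      \<open>Y <#> torsion_part A m\<close>, because \<open>Y\<close> meets \<open>A\<close>
      trivially.\<close>
    define Inv where "Inv H \<longleftrightarrow> subgroup H G \<and> (\<exists>m>0. H \<subseteq> Y <#> torsion_part A m)" for H
    have "\<exists>B. subgroup B G \<and> normalizes H B \<and> B \<inter> H = {\<one>} \<and> B \<noteq> {\<one>} \<and> Inv (H <#> B)" if H: "Inv H" for H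
    proof -
      obtain m where m: "subgroup H G" "m > 0" "H \<subseteq> Y <#> torsion_part A m" using H by (auto simp: Inv_def)
      have "infinite (P - {..m})" using Diff_infinite_finite[OF finite_atMost False] .
      then obtain p where "p \<in> P - {..m}" by (metis equals0I finite.emptyI)
      then have p: "Factorial_Ring.prime p" "torsion_part A p \<noteq> {\<one>}" "m < p" by (auto simp: P_def)
      have normalizes: "normalizes H (torsion_part A p)"
      proof (rule normalizesI)
        fix h b assume hb: "h \<in> H" "b \<in> torsion_part A p"
        then obtain y a where ya: "y \<in> Y" "a \<in> torsion_part A m" "h = y \<otimes> a" using m(3) by (meson set_multE subsetD)
        have c: "a \<in> A" "b \<in> A" using hb ya tsg by auto
        then have "conjg a b = b" using A(2) conjg_eq_self_iff[of a b] Ac by (auto simp: commuting_def)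
        then have "conjg h b = conjg y b" using ya c Yc Ac by (simp flip: conjg_conjg)
        then show "conjg h b \<in> torsion_part A p" using normalizesD[OF torY ya(1) hb(2)] by simp
      qed
      have "torsion_part A p \<inter> H \<subseteq> {\<one>}"
      proof
        fix b assume b: "b \<in> torsion_part A p \<inter> H"
        then have "b \<in> Y <#> torsion_part A m" using m(3) by blast
        then obtain y a where ya: "y \<in> Y" "a \<in> torsion_part A m" "b = y \<otimes> a" by (rule set_multE)
        have aA: "a \<in> A" "b \<in> A" using ya b tsg by auto
        then have "y \<in> A" using ya sg_mult_right_iff[OF A(1) aA(1)] Yc by blast
        then have "y = \<one>" using disj ya by blast
        then have "b \<in> torsion_part A m" using ya Ac aA by simp
        moreover have "\<not> p dvd m" using p(3) m(2) by (auto dest: dvd_imp_le)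
        then have "coprime p m" using prime_imp_coprime_nat[OF p(1)] by blast
        ultimately show "b \<in> {\<one>}" using coprime_pow_mem[OF triv_subgroup Ac[OF aA(2)], of p m] b by (auto simp: torsion_part_def)
      qed
      then have "torsion_part A p \<inter> H = {\<one>}" using sub_one[OF tsg(1)] sub_one[OF m(1)] by blast
      moreover have "Inv (H <#> torsion_part A p)" unfolding Inv_def
      proof (intro conjI exI)
        show "subgroup (H <#> torsion_part A p) G" using subgroup_set_mult[OF m(1) tsg(1) normalizes] .
        show "m * p > 0" using m(2) p(3) by simp
        have M: "subgroup (Y <#> torsion_part A (m * p)) G" using subgroup_set_mult[OF Y tsg(1) torY] .
        have le: "torsion_part A m \<subseteq> torsion_part A (m * p)"
        proof
          fix a assume a: "a \<in> torsion_part A m"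
          then have "a \<in> carrier G" using Ac by (simp add: torsion_part_def)
          then have "a [^] (m * p) = (a [^] m) [^] p" by (simp only: nat_pow_pow)
          then show "a \<in> torsion_part A (m * p)" using a by (simp add: torsion_part_def)
        qed
        have le': "torsion_part A p \<subseteq> torsion_part A (m * p)"
        proof
          fix a assume a: "a \<in> torsion_part A p"
          then have "a \<in> carrier G" using Ac by (simp add: torsion_part_def)
          then have "a [^] (p * m) = (a [^] p) [^] m" by (simp only: nat_pow_pow)
          then show "a \<in> torsion_part A (m * p)" using a by (simp add: torsion_part_def mult.commute)
        qed
        show "H <#> torsion_part A p \<subseteq> Y <#> torsion_part A (m * p)"
          using set_mult_le[OF M] m(3) set_mult_mono[OF subset_refl le] le' set_mult_ge2[OF Y sub_carrier[OF tsg(1)]]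
          by (meson subset_trans)
      qed
      ultimately show ?thesis using tsg normalizes p(2) by blast
    qed
    moreover have "Inv Y" using Y set_mult_ge1[OF tsg(1) sub_carrier[OF Y]] unfolding Inv_def by (auto intro!: exI[of _ 1])
    ultimately obtain B where B: "\<And>n. subgroup (B n) G" "\<And>n. normalizes (partial_product Y B UNIV n) (B n)"
      "\<And>n. B n \<inter> partial_product Y B UNIV n = {\<one>}" "\<And>n::nat. B n \<noteq> {\<one>}" "\<And>n. Inv (partial_product Y B UNIV n)"
      using independent_sequence[of Inv Y] by metis
    have "partial_product Y B UNIV n \<subseteq> K" for n
      using B(5)[of n] set_mult_mono[OF subset_refl tsg(2)] unfolding Inv_def K_def by (meson subset_trans)
    then show ?thesis using independent_imp_subnormal_in[OF Y B(1-4) K(5)] by (simp add: K_def)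
  next
    case True
    define Z where "Z j = upper_series Y A j" for j
    have Z: "subgroup (Z j) G" "Z j \<subseteq> A" for j unfolding Z_def using upper_series_basic[OF Y A] by auto
    define Ap where "Ap p = {a \<in> A. \<exists>k. a [^] (p ^ k) = \<one>}" for p :: nat
    have Ap: "\<exists>c. Ap p \<subseteq> Z c" if p: "Factorial_Ring.prime p" for p
    proof -
      have sg: "subgroup (Ap p) G"
      proof (rule subgroup_criterion)
        show "Ap p \<subseteq> carrier G" using Ac by (auto simp: Ap_def)
        show "\<one> \<in> Ap p" using sub_one[OF A(1)] by (auto simp: Ap_def)
        show "inv x \<in> Ap p" if "x \<in> Ap p" for x
          using that sub_inv[OF A(1)] Ac by (auto simp: Ap_def nat_pow_inv)
        show "x \<otimes> y \<in> Ap p" if xy: "x \<in> Ap p" "y \<in> Ap p" for x y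
        proof -
          obtain k l where kl: "x \<in> A" "x [^] (p ^ k) = \<one>" "y \<in> A" "y [^] (p ^ l) = \<one>" using xy by (auto simp: Ap_def)
          have "x [^] (p ^ (k + l)) = \<one>" using kl Ac by (simp only: power_add nat_pow_pow[symmetric] nat_pow_one)
          moreover have "y [^] (p ^ (l + k)) = \<one>" using kl Ac by (simp only: power_add nat_pow_pow[symmetric] nat_pow_one)
          ultimately have "(x \<otimes> y) [^] (p ^ (k + l)) = \<one>"
            using commuting_pow_mult[OF A(2) sub_carrier[OF A(1)] kl(1,3)] by (simp add: add.commute)
          then show ?thesis using sub_mult[OF A(1) kl(1,3)] by (auto simp: Ap_def)
        qed
      qed
      have le: "Ap p \<subseteq> A" by (auto simp: Ap_def)
      have normalizes: "normalizes Y (Ap p)" using normalizesD[OF A(3)] Yc Ac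
        by (auto simp: normalizes_def Ap_def conjg_pow[symmetric]) (metis conjg_one)
      have dj: "Y \<inter> Ap p = {\<one>}" using disj le sub_one[OF sg] by blast
      have gd: "good (Y <#> Ap p)"
        using good_mono[OF good subgroup_set_mult[OF Y sg normalizes] set_mult_mono[OF subset_refl le]] .
      have "subnormal_in Y (Y <#> Ap p)"
        by (rule p_group_action_subnormal_in[OF Y sg commuting_mono[OF A(2) le] normalizes dj p _ gd solv]) (auto simp: Ap_def)
      then obtain c where "upper_series Y (Ap p) c = Ap p" using subnormal_in_imp_upper_series_full[OF Y sg commuting_mono[OF A(2) le] normalizes dj] by blast
      then have "Ap p \<subseteq> Z c" using upper_series_subset_mono[OF le, of Y c] by (simp add: Z_def)
      then show ?thesis by blast
    qed
    then obtain c where c: "\<And>p. Factorial_Ring.prime p \<Longrightarrow> Ap p \<subseteq> Z (c p)" by metis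
    \<comment> \<open>The inserted \<open>0\<close> covers the case that \<open>P\<close> is
      empty.\<close>
    define C where "C = Max (insert 0 (c ` P))"
    have all: "Ap p \<subseteq> Z C" if p: "Factorial_Ring.prime p" for p
    proof (cases "p \<in> P")
      case True
      then have "c p \<le> C" using \<open>finite P\<close> by (auto simp: C_def)
      then have "Z (c p) \<subseteq> Z C" unfolding Z_def by (rule upper_series_mono[OF Y A])
      then show ?thesis using c[OF p] by blast
    next
      case False
      then have t1: "torsion_part A p = {\<one>}" using p by (simp add: P_def)
      have "a \<in> A \<Longrightarrow> a [^] (p ^ k) = \<one> \<Longrightarrow> a = \<one>" for a k
      proof (induction k)
        case 0 then show ?case using Ac by simp
      next
        case (Suc k)
        then have "(a [^] (p ^ k)) [^] p = \<one>" using Ac by (simp add: nat_pow_pow mult.commute)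
        then have "a [^] (p ^ k) \<in> torsion_part A p" using sub_pow[OF A(1)] Suc by (simp add: torsion_part_def)
        then show ?case using t1 Suc by simp
      qed
      then show ?thesis using sub_one[OF Z(1)] by (auto simp: Ap_def)
    qed
    have "a \<in> A \<Longrightarrow> n > 0 \<Longrightarrow> a [^] n = \<one> \<Longrightarrow> a \<in> Z C" for a and n :: nat
    proof (induction n arbitrary: a rule: less_induct)
      case (less n)
      have ac: "a \<in> carrier G" using less.prems Ac by blast
      show ?case
      proof (cases "n = 1")
        case True then show ?thesis using less.prems ac sub_one[OF Z(1)] by simp
      next
        case False
        then obtain p where p: "Factorial_Ring.prime p" "p dvd n" using prime_factor_nat by blast
        then have p1: "p > 1" using prime_gt_1_nat by blast
        have "\<not> is_unit p" using p1 by simp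
        then obtain l where l: "n = p ^ multiplicity p n * l" "\<not> p dvd l"
          using multiplicity_decompose'[of n p] less.prems(2) by auto
        define e where "e = multiplicity p n"
        have n: "n = p ^ e * l" using l by (simp add: e_def)
        have "e \<noteq> 0"
        proof
          assume "e = 0"
          then have "n = l" using n by simp
          then show False using l p by simp
        qed
        then have "p ^ e > 1" using p1 by (metis one_less_power neq0_conv)
        moreover have "l > 0" using n less.prems by (metis mult_0_right neq0_conv)
        ultimately have ln: "l > 0" "l < n" using n by auto
        have "(a [^] (p ^ e)) [^] l = \<one>" using less.prems n ac by (simp add: nat_pow_pow)
        then have 1: "a [^] (p ^ e) \<in> Z C" using less.IH[OF ln(2) sub_pow[OF A(1) less.prems(1)] ln(1)] by blast
        have "(a [^] l) [^] (p ^ e) = \<one>" using less.prems n ac by (simp add: nat_pow_pow mult.commute)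
        then have "a [^] l \<in> Ap p" using sub_pow[OF A(1) less.prems(1)] by (auto simp: Ap_def)
        then have 2: "a [^] l \<in> Z C" using all[OF p(1)] by blast
        have "coprime (p ^ e) l" using prime_imp_coprime_nat[OF p(1) l(2)] by simp
        then show ?thesis using coprime_pow_mem[OF Z(1) ac 1 2] by blast
      qed
    qed
    then have "A \<subseteq> Z C" using perA unfolding torsion_def by blast
    then have "upper_series Y A C = A" using Z(2)[of C] by (simp add: Z_def subset_antisym)
    then show ?thesis by (rule upper_series_full_imp_subnormal_in[OF Y A])
  qed
qed

end

lemma (in partial_epi) derived_image:
  assumes H: "subgroup H G" "H \<subseteq> K" shows "(derived Q ^^ n) (f ` H) \<subseteq> f ` ((derived G ^^ n) H)"
proof -
  have one: "derived Q (f ` L) \<subseteq> f ` derived G L" if L: "subgroup L G" "L \<subseteq> K" for L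
  proof -
    have D: "subgroup (derived G L) G" "derived G L \<subseteq> K"
      using G.derived_is_subgroup[OF G.sub_carrier[OF L(1)]] G.derived_subset[OF L(1)] L(2) by auto
    show ?thesis unfolding derived_def[of Q]
    proof (rule Q.generate_subgroup_incl[OF _ image_subgroup[OF D]], rule subsetI)
      fix z assume "z \<in> derived_set Q (f ` L)"
      then obtain h k where hk: "h \<in> L" "k \<in> L"
        "z = f h \<otimes>\<^bsub>Q\<^esub> f k \<otimes>\<^bsub>Q\<^esub> inv\<^bsub>Q\<^esub> f h \<otimes>\<^bsub>Q\<^esub> inv\<^bsub>Q\<^esub> f k" by blast
      then have "h \<in> K" "k \<in> K" using L by auto
      then have "z = f (h \<otimes> k \<otimes> inv h \<otimes> inv k)"
        using hk by (simp add: hom f_inv G.sub_mult[OF sub] G.sub_inv[OF sub])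
      moreover have "h \<otimes> k \<otimes> inv h \<otimes> inv k \<in> derived G L"
        using hk unfolding derived_def by (auto intro!: generate.incl)
      ultimately show "z \<in> f ` derived G L" by blast
    qed
  qed
  show ?thesis
  proof (induction n)
    case (Suc n)
    have S: "subgroup ((derived G ^^ n) H) G" using G.exp_of_derived_is_subgroup[OF H(1)] .
    have "(derived G ^^ n) H \<subseteq> H" for n
    proof (induction n)
      case (Suc n)
      then show ?case using G.derived_subset[OF G.exp_of_derived_is_subgroup[OF H(1)], of n] by auto
    qed simp
    then have "(derived G ^^ n) H \<subseteq> K" using H(2) by blast
    then show ?case using Q.mono_derived[OF Suc] one[OF S] by auto
  qed simp
qed

context group
begin

text \<open>The subgroups \<open>H <#> derived_term j\<close> descend from the whole group to
  \<open>H\<close>. Each step is governed by the action of \<open>H <#> derived_term (Suc j)\<close>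
  on an abelian factor of the derived series.\<close>

lemma good_all_subnormal_in:
  assumes good: "good (carrier G)" and solv: "solvable G" and H: "subgroup H G"
  shows "subnormal_in H (carrier G)"
proof -
  obtain n where n: "derived_term n = {\<one>}" using solvable_derived_term solv by blast
  have normalizesD': "normalizes S (derived_term j)" if "S \<subseteq> carrier G" for S j using derived_term_normal_in[of j] normalizes_mono that by (auto simp: normal_in_def)
  have HD: "subgroup (H <#> derived_term j) G" for j using subgroup_set_mult[OF H derived_term_subgroup normalizesD'[OF sub_carrier[OF H]]] .
  have "subnormal_in (H <#> derived_term j) (carrier G)" for j
  proof (induction j)
    case 0
    have "H <#> carrier G = carrier G"
      using set_mult_ge2[OF H subset_refl] set_mult_le[OF subgroup_self sub_carrier[OF H] subset_refl] by blast
    then show ?case using subnormal_in_refl[OF subgroup_self] by (simp add: derived_term_0)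
  next
    case (Suc j)
    \<comment> \<open>\<open>L\<close> and \<open>A\<close> need not meet trivially, so their
      intersection \<open>M\<close> is factored out. It is normal in \<open>K\<close>:
      \<open>L\<close> normalises both \<open>L\<close> and \<open>A\<close>, and \<open>A\<close>
      normalises \<open>M\<close> because \<open>M\<close> contains the commutators of
      \<open>A\<close>.\<close>
    define K L A M where "K = H <#> derived_term j" and "L = H <#> derived_term (Suc j)" and "A = derived_term j" and "M = L \<inter> A"
    have K: "subgroup K G" and L: "subgroup L G" and A: "subgroup A G"
      unfolding K_def L_def A_def by (rule HD derived_term_subgroup)+
    have M: "subgroup M G" unfolding M_def using L A by (rule subgroup_Int)
    have AK: "A \<subseteq> K" unfolding A_def K_def using set_mult_ge2[OF H sub_carrier[OF derived_term_subgroup]] .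
    have LK: "L \<subseteq> K" unfolding L_def K_def using set_mult_mono[OF subset_refl derived_term_Suc_subset] .
    have HL: "H \<subseteq> L" unfolding L_def using set_mult_ge1[OF derived_term_subgroup sub_carrier[OF H]] .
    have DL: "derived_term (Suc j) \<subseteq> L" unfolding L_def using set_mult_ge2[OF H sub_carrier[OF derived_term_subgroup]] .
    have DM: "derived_term (Suc j) \<subseteq> M" unfolding M_def A_def using DL derived_term_Suc_subset by blast
    have MA: "M \<subseteq> A" "M \<subseteq> L" "M \<subseteq> K" using AK by (auto simp: M_def)
    have Kc: "K \<subseteq> carrier G" using sub_carrier[OF K] .
    have nzKA: "normalizes K A" unfolding A_def by (rule normalizesD'[OF Kc])
    have nzAM: "normalizes A M"
      using normalizes_above[OF _ M _ MA(1) sub_carrier[OF A]] derived_term_commutators_in[of j] DM by (simp add: A_def)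
    have nzLM: "normalizes L M" unfolding M_def
      using normalizes_self[OF L] normalizes_mono[OF nzKA LK] by (rule normalizes_Int)
    have "normalizes K M"
    proof (rule normalizesI)
      fix u m assume u: "u \<in> K" and m: "m \<in> M"
      then obtain h a where ha: "h \<in> H" "a \<in> A" "u = h \<otimes> a" unfolding K_def A_def by (metis set_multE)
      have "conjg a m \<in> M" using normalizesD[OF nzAM ha(2) m] .
      then have "conjg h (conjg a m) \<in> M" using normalizesD[OF nzLM] HL ha(1) by blast
      then show "conjg u m \<in> M" using ha mem_carrier_of[OF H] mem_carrier_of[OF A] mem_carrier_of[OF M m] by (simp add: conjg_conjg)
    qed
    then have normal_in: "normal_in M K" using normal_inI[OF M K MA(3)] by blast
    obtain Q :: "'a set monoid" and f where Q: "partial_epi G Q K f" and ker: "\<And>x. x \<in> K \<Longrightarrow> f x = \<one>\<^bsub>Q\<^esub> \<longleftrightarrow> x \<in> M"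
      using quotient_exists[OF normal_in] by metis
    interpret E: partial_epi G Q K f by (rule Q)
    have pb1: "E.pullback {\<one>\<^bsub>Q\<^esub>} = M" using ker MA(3) by (auto simp: E.pullback_def)
    have sg: "subgroup (f ` L) Q" "subgroup (f ` A) Q" using E.image_subgroup L A LK AK by auto
    have carr: "f ` L <#>\<^bsub>Q\<^esub> f ` A = carrier Q"
    proof
      show "f ` L <#>\<^bsub>Q\<^esub> f ` A \<subseteq> carrier Q" using LK AK by (intro E.Q.set_mult_le[OF E.Q.subgroup_self]) auto
      show "carrier Q \<subseteq> f ` L <#>\<^bsub>Q\<^esub> f ` A"
      proof
        fix q assume "q \<in> carrier Q"
        then obtain x where x: "x \<in> K" "q = f x" using E.onto by auto
        then obtain h a where ha: "h \<in> H" "a \<in> A" "x = h \<otimes> a" unfolding K_def A_def by (metis set_multE)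
        have "h \<in> L" "h \<in> K" "a \<in> K" using ha HL LK AK by auto
        then show "q \<in> f ` L <#>\<^bsub>Q\<^esub> f ` A" using ha x E.hom E.Q.set_multI by (metis imageI)
      qed
    qed
    have goodK: "good K" using good_mono[OF good K Kc] .
    have "E.Q.subnormal_in (f ` L) (f ` L <#>\<^bsub>Q\<^esub> f ` A)"
    proof (rule E.Q.torsion_action_subnormal_in[OF sg, where n = n])
      show "E.Q.commuting (f ` A)"
        using E.commuting_image[OF AK] commutators_in_mono[OF derived_term_commutators_in[of j] subset_refl DM] pb1 by (simp add: A_def)
      show "E.Q.normalizes (f ` L) (f ` A)" using E.normalizes_image[OF LK AK normalizes_mono[OF nzKA LK]] .
      show "f ` L \<inter> f ` A = {\<one>\<^bsub>Q\<^esub>}"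
      proof
        show "{\<one>\<^bsub>Q\<^esub>} \<subseteq> f ` L \<inter> f ` A" using E.Q.sub_one[OF sg(1)] E.Q.sub_one[OF sg(2)] by blast
        show "f ` L \<inter> f ` A \<subseteq> {\<one>\<^bsub>Q\<^esub>}"
        proof
          fix q assume "q \<in> f ` L \<inter> f ` A"
          then obtain l a where la: "l \<in> L" "a \<in> A" "q = f a" "f l = f a" by auto
          have c: "l \<in> K" "a \<in> K" using la LK AK by auto
          have "f (inv l \<otimes> a) = \<one>\<^bsub>Q\<^esub>" using la c by (simp add: E.hom E.f_inv sub_inv[OF K] E.f_closed)
          then have "inv l \<otimes> a \<in> L" using ker sub_mult[OF K sub_inv[OF K c(1)] c(2)] MA(2) by blast
          then have "a \<in> L" using sg_mult_left_iff[OF L sub_inv[OF L la(1)]] mem_carrier_of[OF A la(2)] by blast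
          then have "a \<in> M" using la by (simp add: M_def)
          then show "q \<in> {\<one>\<^bsub>Q\<^esub>}" using la ker[OF c(2)] by simp
        qed
      qed
      show "E.Q.good (f ` L <#>\<^bsub>Q\<^esub> f ` A)" unfolding carr
        using goodK E.torsion_quotient E.baer_quotient E.rcc_quotient E.Q.subgroup_self by (auto simp: good_def E.Q.good_def)
      have "(derived G ^^ n) L \<subseteq> {\<one>}"
        using mono_exp_of_derived[OF sub_carrier[OF L], of n] n by (simp add: derived_term_def)
      then have "(derived Q ^^ n) (f ` L) \<subseteq> f ` {\<one>}" using E.derived_image[OF L LK, of n] by blast
      then show "(derived Q ^^ n) (f ` L) = {\<one>\<^bsub>Q\<^esub>}"
        using E.Q.sub_one[OF E.Q.exp_of_derived_is_subgroup[OF sg(1)], of n] by auto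
    qed
    then have "subnormal_in (E.pullback (f ` L)) K" using E.subnormal_in_pullback_iff[OF sg(1)] carr by simp
    then have "subnormal_in L K" using E.pullback_image[OF L LK] pb1 MA(2) by simp
    then show ?case using Suc subnormal_in_trans unfolding K_def L_def by blast
  qed
  from this[of n] show ?thesis
    using n upper_series_0_mult[OF H triv_subgroup] by (simp add: set_mult_def mem_carrier_of[OF H])
qed

lemma rcc_imp_dcc_or_all_subnormal_in:
  assumes "torsion (carrier G)" "solvable G" "rcc (carrier G)" "\<not> dcc {\<one>} (carrier G)" "subgroup H G"
  shows "subnormal_in H (carrier G)"
  using good_all_subnormal_in[OF _ assms(2,5)] solvable_rcc_baer[OF assms(1-4)] assms(1,3) subgroup_self by (simp add: good_def)

section \<open>Chernikov groups and chain conditions\<close>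

text \<open>The centralizer \<open>C\<close> of \<open>A\<close> in \<open>L\<close> is nilpotent of class two, so the preimage of a divisible subgroup
  of \<open>C/A\<close> is abelian: write one argument as a power killing the other.\<close>
lemma abelian_finite_index_step:
  assumes torsion: "torsion (carrier G)" and dcc: "dcc {\<one>} (carrier G)"
    and A: "normal_in A (carrier G)" "commuting A" and L: "normal_in L (carrier G)" "A \<subseteq> L" "commutators_in L A" "finite_index L (carrier G)"
  obtains M where "normal_in M (carrier G)" "commuting M" "finite_index M (carrier G)"
proof -
  have Ag: "subgroup A G" "A \<subseteq> carrier G" "normalizes (carrier G) A" using A by (auto simp: normal_in_def)
  have Lg: "subgroup L G" "L \<subseteq> carrier G" "normalizes (carrier G) L" using L by (auto simp: normal_in_def)
  note Ac = mem_carrier_of[OF Ag(1)] and Lc = mem_carrier_of[OF Lg(1)]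
  have one: "{\<one>} \<subseteq> S" if "subgroup S G" for S using sub_one[OF that] by simp
  have dccA: "dcc {\<one>} A" using dcc_mono[OF dcc subset_refl Ag(2)] .
  define C where "C = {c \<in> L. \<forall>a\<in>A. conjg c a = a}"
  note cfi = centralizer_finite_index[OF Lg(1) torsion_mono[OF torsion Lg(2)] Ag(1) L(2) A(2) normalizes_mono[OF Ag(3) Lg(2)] dccA, folded C_def]
  have C: "subgroup C G" "A \<subseteq> C" "finite_index C L" "normalizes (carrier G) C"
    using cfi(1-3) cfi(4)[OF subgroup_self Lg(3) Ag(3)] by auto
  have CL: "C \<subseteq> L" by (auto simp: C_def)
  note Cc = mem_carrier_of[OF C(1)]
  have centralizer_of: "a \<otimes> c = c \<otimes> a" if "a \<in> A" "c \<in> C" for a c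
    using that conjg_eq_self_iff[of c a] Cc Ac by (auto simp: C_def)
  have kkA: "commutator c d \<in> A" if "c \<in> C" "d \<in> C" for c d using L(3) that CL by (auto simp: commutators_in_commutator)
  obtain Q :: "'a set monoid" and f where Q: "partial_epi G Q C f" and ker: "\<And>x. x \<in> C \<Longrightarrow> f x = \<one>\<^bsub>Q\<^esub> \<longleftrightarrow> x \<in> A"
    using quotient_exists[OF normal_inI[OF Ag(1) C(1,2) normalizes_mono[OF Ag(3) sub_carrier[OF C(1)]]]] by metis
  interpret E: partial_epi G Q C f by (rule Q)
  note Qs = E.Q.subgroup_self
  have pb1: "E.pullback {\<one>\<^bsub>Q\<^esub>} = A" using ker C(2) by (auto simp: E.pullback_def)
  have abQ: "E.Q.commuting (carrier Q)" using E.commuting_image[of C] commutators_in_mono[OF L(3) CL subset_refl] pb1 E.onto by simp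
  have dccQ: "E.Q.dcc {\<one>\<^bsub>Q\<^esub>} (carrier Q)"
    using E.dcc_pullback[OF subset_refl E.Q.triv_subgroup] pb1 E.pullback_carrier dcc_mono[OF dcc one[OF Ag(1)] sub_carrier[OF C(1)]] by simp
  obtain k where k: "k > 0" "\<And>l. l > 0 \<Longrightarrow> E.Q.power_image (carrier Q) (k * l) = E.Q.power_image (carrier Q) k"
    using E.Q.power_image_stable[OF Qs abQ dccQ] by blast
  define J where "J = E.Q.power_image (carrier Q) k"
  have J: "subgroup J Q" unfolding J_def by (rule E.Q.power_image_subgroup[OF Qs abQ])
  define M where "M = E.pullback J"
  have M: "subgroup M G" "M \<subseteq> C" unfolding M_def using E.pullback_subgroup[OF J] E.pullback_subset by auto
  have root: "\<exists>z\<in>C. \<exists>a\<in>A. y = z [^] l \<otimes> a" if yl: "f y \<in> E.Q.power_image (carrier Q) l" "y \<in> C" for y and l :: nat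
  proof -
    obtain q where q: "q \<in> carrier Q" "f y = q [^]\<^bsub>Q\<^esub> l" using yl(1) by (auto simp: E.Q.power_image_def)
    have "q \<in> f ` C" using q E.onto by simp
    then obtain z where z: "z \<in> C" "q = f z" by blast
    have zl: "z [^] l \<in> C" using sub_pow[OF C(1) z(1)] .
    have "f (inv (z [^] l) \<otimes> y) = \<one>\<^bsub>Q\<^esub>" using q z zl yl(2) by (simp add: E.hom E.f_inv E.f_pow sub_inv[OF C(1)] E.f_closed)
    then have "inv (z [^] l) \<otimes> y \<in> A" using ker sub_mult[OF C(1) sub_inv[OF C(1) zl] yl(2)] by blast
    moreover have "y = z [^] l \<otimes> (inv (z [^] l) \<otimes> y)" using Cc zl yl(2) by simp
    ultimately show ?thesis using z by blast
  qed
  \<comment> \<open>\<open>Q\<close> is a quotient of \<open>C\<close> only, so there is no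
    conjugation by \<open>carrier G\<close> on it. Instead elements of \<open>M\<close> are written
    as \<open>z [^] k \<otimes> a\<close>, a form that conjugation preserves.\<close>
  have "normalizes (carrier G) M"
  proof (rule normalizesI)
    fix g x assume g: "g \<in> carrier G" and x: "x \<in> M"
    then have "f x \<in> E.Q.power_image (carrier Q) k" "x \<in> C" by (auto simp: M_def J_def E.pullback_def)
    then obtain z a where za: "z \<in> C" "a \<in> A" "x = z [^] k \<otimes> a" using root by blast
    have gz: "conjg g z \<in> C" "conjg g a \<in> A" using normalizesD[OF C(4) g] normalizesD[OF Ag(3) g] za by auto
    have "conjg g x = conjg g z [^] k \<otimes> conjg g a" using g za Cc Ac by (simp add: conjg_mult conjg_pow)
    moreover have "f (conjg g z [^] k \<otimes> conjg g a) = f (conjg g z) [^]\<^bsub>Q\<^esub> k"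
      using gz C(2) ker[of "conjg g a"] sub_pow[OF C(1) gz(1)] by (auto simp: E.hom E.f_pow)
    moreover have "conjg g z [^] k \<otimes> conjg g a \<in> C" using sub_mult[OF C(1) sub_pow[OF C(1) gz(1)]] gz C(2) by blast
    ultimately show "conjg g x \<in> M" using gz by (auto simp: M_def J_def E.pullback_def E.Q.power_image_def)
  qed
  then have nrmM: "normal_in M (carrier G)" using normal_inI[OF M(1) subgroup_self sub_carrier[OF M(1)]] by blast
  have abM: "commuting M" unfolding commuting_def
  proof (intro ballI)
    fix x y assume xy: "x \<in> M" "y \<in> M"
    have c: "x \<in> C" "y \<in> C" using xy M by auto
    \<comment> \<open>The order of \<open>x\<close> is the right exponent for the root:
      \<open>y\<close> is an \<open>l\<close>-th power modulo \<open>A\<close>, and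
      \<open>commutator x z\<close> is killed by \<open>l\<close>.\<close>
    obtain l :: nat where l: "l > 0" "x [^] l = \<one>" using torsion Cc[OF c(1)] unfolding torsion_def by blast
    have "J \<subseteq> E.Q.power_image (carrier Q) l"
      using k(2)[OF l(1)] E.Q.power_image_dvd[OF Qs, of l "k * l"] by (simp add: J_def)
    then have "f y \<in> E.Q.power_image (carrier Q) l" using xy by (auto simp: M_def E.pullback_def)
    then obtain z a where za: "z \<in> C" "a \<in> A" "y = z [^] l \<otimes> a" using root c by blast
    note cc = Cc[OF c(1)] Cc[OF za(1)] Ac[OF za(2)]
    have "commutator x z [^] l = commutator (x [^] l) z" using commutator_pow[of x z l] centralizer_of[OF kkA[OF c(1) za(1)] c(1)] cc by simp
    also have "\<dots> = \<one>" using l cc by (simp add: commutator_def)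
    finally have 1: "commutator x z [^] l = \<one>" .
    have inv: "commutator z x = inv (commutator x z)" using cc by (simp add: commutator_def conjg_def inv_mult_group m_assoc)
    have "commutator (z [^] l) x = commutator z x [^] l" using commutator_pow[of z x l] centralizer_of[OF kkA[OF za(1) c(1)] za(1)] cc by simp
    also have "\<dots> = \<one>" using inv 1 cc by (simp add: nat_pow_inv)
    finally have "z [^] l \<otimes> x = x \<otimes> z [^] l" using commutator_one_iff cc by simp
    moreover have "a \<otimes> x = x \<otimes> a" using centralizer_of za c by blast
    ultimately show "x \<otimes> y = y \<otimes> x" using za(3) cc by (metis m_assoc nat_pow_closed)
  qed
  have "E.Q.finite_index J (carrier Q)"
  proof -
    have "finite (E.Q.torsion_part (carrier Q) k)" using E.Q.finite_torsion_part[OF Qs abQ E.Q.dcc_finite_socle[OF Qs abQ dccQ] k(1)] .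
    moreover have "carrier Q \<subseteq> J <#>\<^bsub>Q\<^esub> E.Q.torsion_part (carrier Q) k"
    proof
      fix t assume t: "t \<in> carrier Q"
      obtain j c where "j \<in> J" "c \<in> E.Q.torsion_part (carrier Q) k" "t = j \<otimes>\<^bsub>Q\<^esub> c"
        using E.Q.power_image_torsion_part_decomp[OF Qs abQ k(2)[OF k(1)] t] unfolding J_def by blast
      then show "t \<in> J <#>\<^bsub>Q\<^esub> E.Q.torsion_part (carrier Q) k" using E.Q.set_multI by blast
    qed
    ultimately show ?thesis unfolding E.Q.finite_index_def by (intro exI[of _ "E.Q.torsion_part (carrier Q) k"]) (auto simp: E.Q.torsion_part_def)
  qed
  then have "finite_index M C" unfolding M_def by (rule E.finite_index_pullback[OF J])
  then have "finite_index M L" using finite_index_trans[OF _ C(3) sub_carrier[OF M(1)] CL Lg(2,1)] by blast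
  then have "finite_index M (carrier G)" using finite_index_trans[OF _ L(4) sub_carrier[OF M(1)] Lg(2) subset_refl subgroup_self] by blast
  then show ?thesis using that nrmM abM by blast
qed

text \<open>In the quotient by \<open>derived_term (Suc j)\<close>, the subgroup \<open>L\<close> of
  finite index is abelian modulo an abelian normal subgroup, and
  \<open>abelian_finite_index_step\<close> replaces it by an abelian one. Where the series becomes
  trivial, \<open>L\<close> itself is abelian.\<close>

lemma solvable_dcc_abelian_finite_index:
  assumes torsion: "torsion (carrier G)" and dcc: "dcc {\<one>} (carrier G)" and solv: "solvable G"
  obtains M where "normal_in M (carrier G)" "commuting M" "finite_index M (carrier G)"
proof -
  have "\<exists>L. normal_in L (carrier G) \<and> derived_term j \<subseteq> L \<and> commutators_in L (derived_term j) \<and> finite_index L (carrier G)" for j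
  proof (induction j)
    case 0
    show ?case using derived_term_normal_in[of 0] derived_term_0 finite_index_refl[OF subgroup_self] commutators_in_subset_self[OF subgroup_self] by (intro exI[of _ "carrier G"]) simp
  next
    case (Suc j)
    then obtain L where L: "normal_in L (carrier G)" "derived_term j \<subseteq> L" "commutators_in L (derived_term j)" "finite_index L (carrier G)" by blast
    note D = derived_term_subgroup[of j] derived_term_normal_in[of j]
    note D' = derived_term_subgroup[of "Suc j"] derived_term_normal_in[of "Suc j"]
    note sub = derived_term_Suc_subset[of j]
    obtain Q :: "'a set monoid" and f where Q: "partial_epi G Q (carrier G) f"
      and ker: "\<And>x. x \<in> carrier G \<Longrightarrow> f x = \<one>\<^bsub>Q\<^esub> \<longleftrightarrow> x \<in> derived_term (Suc j)"
      using quotient_exists[OF D'(2)] by metis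
    interpret E: partial_epi G Q "carrier G" f by (rule Q)
    have Lg: "subgroup L G" "L \<subseteq> carrier G" using L by (auto simp: normal_in_def)
    note Dc = sub_carrier[OF D(1)]
    have pb1: "E.pullback {\<one>\<^bsub>Q\<^esub>} = derived_term (Suc j)" using ker sub_carrier[OF D'(1)] by (auto simp: E.pullback_def)
    obtain M where M: "E.Q.normal_in M (carrier Q)" "E.Q.commuting M" "E.Q.finite_index M (carrier Q)"
    proof (rule E.Q.abelian_finite_index_step)
      show "E.Q.torsion (carrier Q)" using E.torsion_quotient torsion by blast
      show "E.Q.dcc {\<one>\<^bsub>Q\<^esub>} (carrier Q)"
        using E.dcc_pullback[OF subset_refl E.Q.triv_subgroup] pb1 E.pullback_carrier
          dcc_mono[OF dcc _ subset_refl, of "derived_term (Suc j)"] sub_one[OF D'(1)] by simp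
      show "E.Q.normal_in (f ` derived_term j) (carrier Q)" using E.image_normal_in[OF D(2) subset_refl] E.onto by simp
      show "E.Q.commuting (f ` derived_term j)" using E.commuting_image[OF Dc] derived_term_commutators_in pb1 by simp
      show "E.Q.normal_in (f ` L) (carrier Q)" using E.image_normal_in[OF L(1) subset_refl] E.onto by simp
      show "f ` derived_term j \<subseteq> f ` L" using L by blast
      show "E.Q.commutators_in (f ` L) (f ` derived_term j)" unfolding E.Q.commutators_in_def
      proof (intro ballI)
        fix a b assume "a \<in> f ` L" "b \<in> f ` L"
        then obtain x y where xy: "x \<in> L" "y \<in> L" "a = f x" "b = f y" by auto
        then have c: "x \<in> carrier G" "y \<in> carrier G" using Lg by auto
        have "E.Q.conjg a b \<otimes>\<^bsub>Q\<^esub> inv\<^bsub>Q\<^esub> b = f (conjg x y \<otimes> inv y)"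
          using xy c by (simp add: E.hom E.f_conjg E.f_inv)
        moreover have "conjg x y \<otimes> inv y \<in> derived_term j" using L(3) xy by (auto simp: commutators_in_def)
        ultimately show "E.Q.conjg a b \<otimes>\<^bsub>Q\<^esub> inv\<^bsub>Q\<^esub> b \<in> f ` derived_term j" by simp
      qed
      show "E.Q.finite_index (f ` L) (carrier Q)" using E.finite_index_image[OF Lg(2) L(4)] .
    qed blast
    have Mg: "subgroup M Q" "M \<subseteq> carrier Q" using M by (auto simp: E.Q.normal_in_def)
    have "normal_in (E.pullback M) (carrier G)" using E.pullback_normal_in[OF M(1)] E.pullback_carrier by simp
    moreover have "derived_term (Suc j) \<subseteq> E.pullback M" using pb1 E.pullback_mono[of "{\<one>\<^bsub>Q\<^esub>}" M] E.Q.sub_one[OF Mg(1)] by simp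
    moreover have "commutators_in (E.pullback M) (derived_term (Suc j))" using E.commutators_in_pullback[OF Mg(2) M(2)] pb1 by simp
    moreover have "finite_index (E.pullback M) (carrier G)" using E.finite_index_pullback[OF Mg(1) M(3)] .
    ultimately show ?case by blast
  qed
  moreover obtain n where "derived_term n = {\<one>}" using solvable_derived_term solv by blast
  ultimately obtain L where "normal_in L (carrier G)" "commutators_in L {\<one>}" "finite_index L (carrier G)" by metis
  then show ?thesis using that commutators_in_one_commuting by (auto simp: normal_in_def)
qed

section \<open>Index, the minimal condition and Chernikov groups in internal terms\<close>

lemma finite_rcosets_iff_finite_index:
  assumes H: "subgroup H G" and K: "subgroup K G" "H \<subseteq> K"
  shows "finite (rcosets\<^bsub>G\<lparr>carrier := K\<rparr>\<^esub> H) \<longleftrightarrow> finite_index H K"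
proof -
  have eq: "rcosets\<^bsub>G\<lparr>carrier := K\<rparr>\<^esub> H = (\<lambda>x. H #> x) ` K"
    by (auto simp: RCOSETS_def r_coset_def)
  have Hc: "H \<subseteq> carrier G" using sub_carrier[OF H] .
  show ?thesis unfolding eq
  proof
    assume "finite ((\<lambda>x. H #> x) ` K)"
    then show "finite_index H K"
    proof (rule finite_index_by_map[OF H sub_carrier[OF K(1)]])
      fix s t assume st: "s \<in> K" "t \<in> K" "H #> s = H #> t"
      have c: "s \<in> carrier G" "t \<in> carrier G" using st mem_carrier_of[OF K(1)] by auto
      have "s \<in> H #> t" using st(3) rcos_self[OF c(1) H] by simp
      then obtain h where "h \<in> H" "s = h \<otimes> t" by (auto simp: r_coset_def)
      then show "s \<otimes> inv t \<in> H" using c Hc by (auto simp: m_assoc)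
    qed
  next
    assume "finite_index H K"
    then obtain S where S: "finite S" "S \<subseteq> K" "K \<subseteq> H <#> S" unfolding finite_index_def by blast
    have "(\<lambda>x. H #> x) ` K \<subseteq> (\<lambda>x. H #> x) ` S"
    proof (rule image_subsetI)
      fix x assume "x \<in> K"
      then have "x \<in> H <#> S" using S by blast
      then obtain h s where partial_product: "h \<in> H" "s \<in> S" "x = h \<otimes> s" by (rule set_multE)
      have sc: "s \<in> carrier G" using partial_product S mem_carrier_of[OF K(1)] by blast
      have "x \<in> H #> s" using partial_product by (auto simp: r_coset_def)
      then have "H #> s = H #> x" using repr_independence[OF _ sc H] by blast
      then show "H #> x \<in> (\<lambda>x. H #> x) ` S" using partial_product by blast
    qed
    then show "finite ((\<lambda>x. H #> x) ` K)" using S(1) finite_surj by blast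
  qed
qed

lemma infinite_index_iff:
  "subgroup H G \<Longrightarrow> subgroup K G \<Longrightarrow> H \<subseteq> K \<Longrightarrow> infinite_index G H K \<longleftrightarrow> \<not> finite_index H K"
  unfolding infinite_index_def using finite_rcosets_iff_finite_index by blast

lemma min_on_subgroups_iff:
  assumes A: "subgroup A G"
  shows "min_on_subgroups (G\<lparr>carrier := A\<rparr>) \<longleftrightarrow> dcc {\<one>} A"
proof -
  have *: "subgroup H (G\<lparr>carrier := A\<rparr>) \<longleftrightarrow> subgroup H G \<and> H \<subseteq> A" for H
    using subgroup_incl[OF _ A] incl_subgroup[OF A] subgroup.subset[of H "G\<lparr>carrier := A\<rparr>"] by auto
  have **: "monotone (<) (>) (H :: nat \<Rightarrow> 'a set) \<longleftrightarrow> (\<forall>n. H (Suc n) \<subset> H n)" for H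
  proof
    assume "\<forall>n. H (Suc n) \<subset> H n"
    then have H: "H (Suc n) \<subset> H n" for n by blast
    have "H n \<subset> H m" if "m < n" for m n
    proof -
      have "H n \<subseteq> H (Suc m)"
        by (rule lift_Suc_antimono_le[of H]) (use H that in auto)
      then show ?thesis using H[of m] by blast
    qed
    then show "monotone (<) (>) H" by (simp add: monotone_def)
  qed (auto simp: monotone_def)
  have "subgroup H G \<and> H \<subseteq> A \<longleftrightarrow> subgroup H G \<and> {\<one>} \<subseteq> H \<and> H \<subseteq> A" for H using sub_one[of H] by auto
  then show ?thesis unfolding min_on_subgroups_def dcc_def * ** by simp
qed

lemma chernikov_iff:
  "chernikov_group G \<longleftrightarrow> (\<exists>A. normal_in A (carrier G) \<and> commuting A \<and> finite_index A (carrier G) \<and> dcc {\<one>} A)"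
proof -
  have "A \<lhd> G \<and> comm_group (G\<lparr>carrier := A\<rparr>) \<and> finite (rcosets A) \<and> min_on_subgroups (G\<lparr>carrier := A\<rparr>)
    \<longleftrightarrow> normal_in A (carrier G) \<and> commuting A \<and> finite_index A (carrier G) \<and> dcc {\<one>} A" for A
  proof (cases "subgroup A G")
    case True
    have "A \<lhd> G \<longleftrightarrow> normal_in A (carrier G)" using normal_carrier_update_iff[OF subgroup_self True] by simp
    moreover have "comm_group (G\<lparr>carrier := A\<rparr>) \<longleftrightarrow> commuting A"
    proof
      assume "comm_group (G\<lparr>carrier := A\<rparr>)"
      then interpret A: comm_group "G\<lparr>carrier := A\<rparr>" .
      show "commuting A" using A.m_comm by (simp add: commuting_def)
    next
      assume ab: "commuting A"
      interpret A: group "G\<lparr>carrier := A\<rparr>" by (rule subgroup_imp_group[OF True])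
      show "comm_group (G\<lparr>carrier := A\<rparr>)"
        by (rule A.group_comm_groupI) (use ab in \<open>auto simp: commuting_def\<close>)
    qed
    moreover have "finite (rcosets A) \<longleftrightarrow> finite_index A (carrier G)"
      using finite_rcosets_iff_finite_index[OF True subgroup_self sub_carrier[OF True]] by simp
    ultimately show ?thesis using min_on_subgroups_iff[OF True] by simp
  next
    case False
    then show ?thesis by (auto simp: normal_in_def dest: normal_imp_subgroup)
  qed
  then show ?thesis unfolding chernikov_group_def by simp
qed

lemma chernikov_dcc: "chernikov_group G \<Longrightarrow> dcc {\<one>} (carrier G)"
  unfolding chernikov_iff
proof (elim exE conjE)
  fix A assume A: "normal_in A (carrier G)" "finite_index A (carrier G)" "dcc {\<one>} A"
  have "subgroup A G" "A \<subseteq> carrier G" "normalizes (carrier G) A" using A(1) by (auto simp: normal_in_def)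
  then show "dcc {\<one>} (carrier G)"
    using dcc_trans[OF _ _ _ _ subgroup_self triv_subgroup A(3) finite_index_dcc[OF A(2) subgroup_self]] sub_one[of A] by simp
qed

text \<open>Intersecting with an abelian subgroup \<open>A\<close> of finite index keeps the indices
  infinite. The divisible parts \<open>D n\<close> of the intersections ascend, and at each step a
  new element of the socle of \<open>A\<close> must appear: otherwise two consecutive parts agree,
  and the index is finite because \<open>B (Suc n)\<close> is its divisible part times a finite
  group. Infinitely many new elements contradict the finiteness of the socle.\<close>

lemma chernikov_no_ascending:
  assumes torsion: "torsion (carrier G)" and ch: "chernikov_group G"
    and H: "\<And>n::nat. subgroup (H n) G" "\<And>n. H n \<subseteq> H (Suc n)" "\<And>n. \<not> finite_index (H n) (H (Suc n))"
  shows False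
proof -
  obtain A where A: "normal_in A (carrier G)" "commuting A" "finite_index A (carrier G)" "dcc {\<one>} A" using ch unfolding chernikov_iff by blast
  have Ag: "subgroup A G" using A(1) by (simp add: normal_in_def)
  define B where "B n = H n \<inter> A" for n
  have B: "subgroup (B n) G" "B n \<subseteq> A" "B n \<subseteq> H n" "B n \<subseteq> B (Suc n)" for n
    using subgroup_Int[OF H(1) Ag] H(2)[of n] by (auto simp: B_def)
  have Bab: "commuting (B n)" and Bdcc: "dcc {\<one>} (B n)" for n
    using commuting_mono[OF A(2) B(2)] dcc_mono[OF A(4) subset_refl B(2)] by auto
  note Bc = mem_carrier_of[OF B(1)]
  have fiBH: "finite_index (B n) (H n)" for n
  proof -
    obtain S where S: "finite S" "S \<subseteq> carrier G" "carrier G \<subseteq> A <#> S" using A(3) unfolding finite_index_def by blast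
    have "\<exists>s. s \<in> S \<and> h \<otimes> inv s \<in> A" if h: "h \<in> H n" for h
    proof -
      have "h \<in> A <#> S" using S mem_carrier_of[OF H(1) h] by blast
      then obtain a s where as: "a \<in> A" "s \<in> S" "h = a \<otimes> s" by (rule set_multE)
      then have "h \<otimes> inv s = a" using S mem_carrier_of[OF Ag] by (auto simp: m_assoc)
      then show ?thesis using as by blast
    qed
    then obtain r where r: "\<And>h. h \<in> H n \<Longrightarrow> r h \<in> S \<and> h \<otimes> inv (r h) \<in> A" by metis
    have "r ` H n \<subseteq> S" using r by blast
    then have "finite (r ` H n)" using S(1) finite_subset by blast
    then show ?thesis
    proof (rule finite_index_by_map[OF B(1) sub_carrier[OF H(1)]])
      fix s t assume st: "s \<in> H n" "t \<in> H n" "r s = r t"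
      have c: "s \<in> carrier G" "t \<in> carrier G" "r t \<in> carrier G" using st mem_carrier_of[OF H(1)] r S(2) by blast+
      have "s \<otimes> inv (r t) \<otimes> inv (t \<otimes> inv (r t)) \<in> A"
        using r[OF st(1)] r[OF st(2)] st(3) sub_mult[OF Ag] sub_inv[OF Ag] by metis
      moreover have "s \<otimes> inv (r t) \<otimes> inv (t \<otimes> inv (r t)) = s \<otimes> inv t" using c by (simp add: inv_mult_group m_assoc)
      moreover have "s \<otimes> inv t \<in> H n" using sub_mult[OF H(1) st(1) sub_inv[OF H(1) st(2)]] .
      ultimately show "s \<otimes> inv t \<in> B n" by (simp add: B_def)
    qed
  qed
  have nfi: "\<not> finite_index (B n) (B (Suc n))" for n
  proof
    assume "finite_index (B n) (B (Suc n))"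
    then have "finite_index (B n) (H (Suc n))"
      using finite_index_trans[OF _ fiBH sub_carrier[OF B(1)] B(3) sub_carrier[OF H(1)] H(1)] by blast
    then show False using finite_index_subset[OF _ B(3)] H(3) by blast
  qed
  have "\<exists>k>0. \<forall>l>0. power_image (B n) (k * l) = power_image (B n) k" for n
    using power_image_stable[OF B(1) Bab Bdcc] by metis
  then obtain k where k: "\<And>n. k n > 0" "\<And>n l. l > 0 \<Longrightarrow> power_image (B n) (k n * l) = power_image (B n) (k n)" by metis
  define D where "D n = power_image (B n) (k n)" for n
  have D: "subgroup (D n) G" "D n \<subseteq> B n" for n
    unfolding D_def using power_image_subgroup[OF B(1) Bab] power_image_subset[OF B(1)] by auto
  have Ddiv: "power_image (D n) l = D n" if "l > 0" for n l
    unfolding D_def power_image_power_image[OF B(1)] using k(2) that by simp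
  have Dmono: "D n \<subseteq> D (Suc n)" for n
  proof -
    have "D n = power_image (D n) (k (Suc n))" using Ddiv k(1) by simp
    also have "\<dots> \<subseteq> power_image (B (Suc n)) (k (Suc n))" using D(2)[of n] B(4)[of n] by (intro power_image_mono) blast
    finally show ?thesis by (simp add: D_def)
  qed
  have new: "\<exists>x. x \<in> D (Suc n) \<and> x \<notin> D n \<and> x \<in> socle A" for n
  proof (rule ccontr)
    assume "\<not> ?thesis"
    then have old: "\<And>x. x \<in> D (Suc n) \<Longrightarrow> x \<in> socle A \<Longrightarrow> x \<in> D n" by blast
    have DA: "D m \<subseteq> A" for m using D B by blast
    have "x \<in> D (Suc n) \<Longrightarrow> l > 0 \<Longrightarrow> x [^] l = \<one> \<Longrightarrow> x \<in> D n" for x and l :: nat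
    proof (induction l arbitrary: x rule: less_induct)
      case (less l)
      have xc: "x \<in> carrier G" "x \<in> A" using mem_carrier_of[OF D(1) less.prems(1)] DA less.prems(1) by auto
      show ?case
      proof (cases "l = 1")
        case True then show ?thesis using less.prems xc sub_one[OF D(1)] by simp
      next
        case False
        then obtain p where p: "Factorial_Ring.prime p" "p dvd l" using prime_factor_nat by blast
        then obtain m where m: "l = p * m" by auto
        have p0: "p > 0" using prime_gt_0_nat[OF p(1)] .
        have m0: "0 < m" "m < l" using m less.prems prime_gt_1_nat[OF p(1)] by auto
        have "(x [^] p) [^] m = \<one>" using less.prems m xc by (simp add: nat_pow_pow)
        then have "x [^] p \<in> D n" using less.IH[OF m0(2) sub_pow[OF D(1) less.prems(1)] m0(1)] by blast
        \<comment> \<open>Divisibility of \<open>D n\<close> provides some \<open>d\<close> with the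
          same \<open>p\<close>-th power as \<open>x\<close>. The quotient of the two lies in the
          socle, where nothing new occurs by assumption.\<close>
        then have "x [^] p \<in> power_image (D n) p" using Ddiv[OF p0] by simp
        then obtain d where d: "d \<in> D n" "x [^] p = d [^] p" by (auto simp: power_image_def)
        have dA: "d \<in> A" "d \<in> D (Suc n)" using d DA Dmono by blast+
        have "(x \<otimes> inv d) [^] p = \<one>"
          using commuting_pow_div[OF A(2) Ag xc(2) dA(1), of p] d(2) mem_carrier_of[OF Ag dA(1)] by simp
        then have "x \<otimes> inv d \<in> socle A" using p(1) sub_mult[OF Ag xc(2) sub_inv[OF Ag dA(1)]] by (auto simp: socle_def)
        then have "x \<otimes> inv d \<in> D n" using old sub_mult[OF D(1) less.prems(1) sub_inv[OF D(1) dA(2)]] by blast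
        then show ?thesis using sg_mult_right_iff[OF D(1) sub_inv[OF D(1) d(1)] xc(1)] by blast
      qed
    qed
    then have DD: "D (Suc n) \<subseteq> D n" using torsion mem_carrier_of[OF D(1)] unfolding torsion_def by blast
    have fin: "finite (torsion_part (B (Suc n)) (k (Suc n)))"
      using finite_torsion_part[OF B(1) Bab dcc_finite_socle[OF B(1) Bab Bdcc] k(1)] .
    have "B (Suc n) \<subseteq> B n <#> torsion_part (B (Suc n)) (k (Suc n))"
    proof
      fix b assume b: "b \<in> B (Suc n)"
      obtain j c where jc: "j \<in> power_image (B (Suc n)) (k (Suc n))" "c \<in> torsion_part (B (Suc n)) (k (Suc n))" "b = j \<otimes> c"
        using power_image_torsion_part_decomp[OF B(1) Bab k(2)[OF k(1)] b] by blast
      have "j \<in> B n" using jc(1) DD D(2) unfolding D_def by blast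
      then show "b \<in> B n <#> torsion_part (B (Suc n)) (k (Suc n))" using jc set_multI by metis
    qed
    then have "finite_index (B n) (B (Suc n))" unfolding finite_index_def using fin
      by (intro exI[of _ "torsion_part (B (Suc n)) (k (Suc n))"]) (auto simp: torsion_part_def)
    then show False using nfi by blast
  qed
  then obtain x where x: "\<And>n. x n \<in> D (Suc n) \<and> x n \<notin> D n \<and> x n \<in> socle A" by metis
  have mono: "m \<le> n \<Longrightarrow> D m \<subseteq> D n" for m n using Dmono by (rule lift_Suc_mono_le)
  have "inj x"
  proof (rule linorder_injI)
    fix m n :: nat assume "m < n"
    then have "x m \<in> D n" using x[of m] mono[of "Suc m" n] by auto
    then show "x m \<noteq> x n" using x[of n] by metis
  qed
  moreover have "range x \<subseteq> socle A" using x by blast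
  ultimately have "infinite (socle A)" using range_inj_infinite infinite_super by blast
  then show False using dcc_finite_socle[OF Ag A(2,4)] by blast
qed

text \<open>The subgroups \<open>H r\<close> with \<open>r\<close> between \<open>a\<close> and
  \<open>b\<close> would be determined by their traces on a finite set of coset representatives, but
  there are infinitely many of them.\<close>

lemma real_chain_infinite_index:
  fixes H :: "real \<Rightarrow> 'a set"
  assumes H: "strict_mono H" "\<And>r. subgroup (H r) G" and "a < b"
  shows "\<not> finite_index (H a) (H b)"
proof
  assume "finite_index (H a) (H b)"
  then obtain S where S: "finite S" "S \<subseteq> H b" "H b \<subseteq> H a <#> S" unfolding finite_index_def by blast
  have lt: "H r \<subset> H s" if "r < s" for r s using strict_monoD[OF H(1) that] .
  have "inj_on (\<lambda>r. S \<inter> H r) {a<..<b}"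
  proof (rule linorder_inj_onI)
    fix r s :: real assume rs: "r < s" "r \<in> {a<..<b}" "s \<in> {a<..<b}"
    obtain h where h: "h \<in> H s" "h \<notin> H r" using lt[OF rs(1)] by blast
    have "h \<in> H b" using h lt[of s b] rs by auto
    then have "h \<in> H a <#> S" using S(3) by blast
    then obtain c t where ct: "c \<in> H a" "t \<in> S" "h = c \<otimes> t" by (rule set_multE)
    have c: "c \<in> H r" "c \<in> H s" using ct lt[of a r] lt[of a s] rs by auto
    have tc: "t \<in> carrier G" using ct S mem_carrier_of[OF H(2)] by blast
    have "t \<in> H s" "t \<notin> H r"
      using h ct sg_mult_left_iff[OF H(2) c(1) tc] sg_mult_left_iff[OF H(2) c(2) tc] by auto
    then show "S \<inter> H r \<noteq> S \<inter> H s" using ct by blast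
  qed auto
  moreover have "(\<lambda>r. S \<inter> H r) ` {a<..<b} \<subseteq> Pow S" by blast
  then have "finite ((\<lambda>r. S \<inter> H r) ` {a<..<b})" using S(1) finite_subset finite_Pow_iff by metis
  ultimately have "finite {a<..<b}" by (rule finite_imageD[rotated])
  then show False using infinite_Ioo[OF \<open>a < b\<close>] by blast
qed

lemma weak_double_chain_imp_rcc:
  assumes "weak_double_chain_condition G (non_subnormal_subgroups G)"
  shows "real_chain_condition (non_subnormal_subgroups G)"
  unfolding real_chain_condition_def
proof (intro notI, elim exE conjE)
  fix H :: "real \<Rightarrow> 'a set" assume H: "range H \<subseteq> non_subnormal_subgroups G" "strict_mono H"
  have sg: "subgroup (H r) G" for r using H(1) by (auto simp: non_subnormal_subgroups_def)
  define I where "I k = H (real_of_int k)" for k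
  have lt: "H r \<subset> H s" if "r < s" for r s using strict_monoD[OF H(2) that] .
  have "range I \<subseteq> non_subnormal_subgroups G" using H(1) by (auto simp: I_def)
  moreover have "strict_mono I" unfolding strict_mono_def I_def using lt by simp
  moreover have "infinite_index G (I k) (I (k + 1))" for k
    using real_chain_infinite_index[OF H(2) sg, of "real_of_int k" "real_of_int (k + 1)"]
      infinite_index_iff[OF sg sg] lt[of "real_of_int k" "real_of_int (k + 1)"] by (auto simp: I_def)
  ultimately show False using assms unfolding weak_double_chain_condition_def by blast
qed

end

lemma weak_maximal_imp_double:
  "weak_maximal_condition G P \<Longrightarrow> weak_double_chain_condition G P"
  unfolding weak_double_chain_condition_def
proof (intro notI, elim exE conjE)
  fix H :: "int \<Rightarrow> 'a set"
  assume m: "weak_maximal_condition G P" and H: "range H \<subseteq> P" "strict_mono H" "\<forall>k. infinite_index G (H k) (H (k + 1))"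
  have "range (\<lambda>n. H (int n)) \<subseteq> P" using H(1) by auto
  moreover have "strict_mono (\<lambda>n. H (int n))" using H(2) by (simp add: strict_mono_def)
  moreover have "infinite_index G (H (int n)) (H (int (Suc n)))" for n
    using H(3)[rule_format, of "int n"] by (simp add: add.commute)
  ultimately show False using m unfolding weak_maximal_condition_def by blast
qed

lemma weak_minimal_imp_double:
  "weak_minimal_condition G P \<Longrightarrow> weak_double_chain_condition G P"
  unfolding weak_double_chain_condition_def
proof (intro notI, elim exE conjE)
  fix H :: "int \<Rightarrow> 'a set"
  assume m: "weak_minimal_condition G P" and H: "range H \<subseteq> P" "strict_mono H" "\<forall>k. infinite_index G (H k) (H (k + 1))"
  have "range (\<lambda>n. H (- int n)) \<subseteq> P" using H(1) by auto
  moreover have "monotone (<) (>) (\<lambda>n. H (- int n))" using H(2) by (simp add: strict_mono_def monotone_def)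
  moreover have "infinite_index G (H (- int (Suc n))) (H (- int n))" for n
    using H(3)[rule_format, of "- int (Suc n)"] by simp
  ultimately show False using m unfolding weak_minimal_condition_def by blast
qed

theorem theorem5p5:
  fixes G :: "('a, 'b) monoid_scheme"
  assumes "group G" and "periodic_group G" and "solvable G"
  shows "(weak_minimal_condition G (non_subnormal_subgroups G) \<longleftrightarrow> weak_maximal_condition G (non_subnormal_subgroups G)) \<and>
         (weak_maximal_condition G (non_subnormal_subgroups G) \<longleftrightarrow> weak_double_chain_condition G (non_subnormal_subgroups G)) \<and>
         (weak_double_chain_condition G (non_subnormal_subgroups G) \<longleftrightarrow> real_chain_condition (non_subnormal_subgroups G)) \<and>
         (real_chain_condition (non_subnormal_subgroups G) \<longleftrightarrow>
            chernikov_group G \<or> (\<forall>H. subgroup H G \<longrightarrow> subnormal H G))"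
proof -
  interpret group G by fact
  let ?P = "non_subnormal_subgroups G"
  let ?v = "chernikov_group G \<or> (\<forall>H. subgroup H G \<longrightarrow> subnormal H G)"
  have torsion: "torsion (carrier G)" using assms(2) by (simp add: torsion_def periodic_group_def)
  have sg: "subgroup H G" if "H \<in> ?P" for H using that by (simp add: non_subnormal_subgroups_def)
  have iv_v: ?v if "real_chain_condition ?P"
  proof (cases "dcc {\<one>\<^bsub>G\<^esub>} (carrier G)")
    case True
    obtain M where M: "normal_in M (carrier G)" "commuting M" "finite_index M (carrier G)"
      using solvable_dcc_abelian_finite_index[OF torsion True assms(3)] by blast
    have "dcc {\<one>\<^bsub>G\<^esub>} M" using dcc_mono[OF True subset_refl] M(1) by (simp add: normal_in_def)
    then show ?thesis using M chernikov_iff by blast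
  next
    case False
    then show ?thesis
      using rcc_imp_dcc_or_all_subnormal_in[OF torsion assms(3) _ False] that rcc_iff subnormal_iff_subnormal_in by blast
  qed
  have v_i: "weak_minimal_condition G ?P" if v: ?v
    unfolding weak_minimal_condition_def
  proof (intro notI, elim exE conjE)
    fix H :: "nat \<Rightarrow> 'a set" assume H: "range H \<subseteq> ?P" "monotone (<) (>) H"
    \<comment> \<open>Any member of the chain is a non-subnormal subgroup, which rules out the
      second alternative.\<close>
    have "H 0 \<in> ?P" using H(1) by blast
    then have "chernikov_group G" using v by (auto simp: non_subnormal_subgroups_def)
    then have d: "dcc {\<one>\<^bsub>G\<^esub>} (carrier G)" by (rule chernikov_dcc)
    have "subgroup (H n) G" for n using H(1) sg by blast
    then show False
      using dccD[OF d, of H] sub_one sub_carrier H(2) by (auto simp: monotone_def)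
  qed
  have v_ii: "weak_maximal_condition G ?P" if v: ?v
    unfolding weak_maximal_condition_def
  proof (intro notI, elim exE conjE)
    fix H :: "nat \<Rightarrow> 'a set"
    assume H: "range H \<subseteq> ?P" "strict_mono H" "\<forall>n. infinite_index G (H n) (H (Suc n))"
    have "H 0 \<in> ?P" using H(1) by blast
    then have ch: "chernikov_group G" using v by (auto simp: non_subnormal_subgroups_def)
    have s: "subgroup (H n) G" for n using H(1) sg by blast
    have le: "H n \<subseteq> H (Suc n)" for n using strict_monoD[OF H(2), of n "Suc n"] by auto
    show False
    proof (rule chernikov_no_ascending[OF torsion ch, of H])
      show "\<not> finite_index (H n) (H (Suc n))" for n using H(3) infinite_index_iff[OF s s le] by blast
    qed (fact s le)+
  qed
  show ?thesis
    \<comment> \<open>Both one-sided weak conditions imply the double chain condition, and this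
      implies the real one. The structural alternative then leads back to both one-sided
      conditions.\<close>
    using iv_v v_i v_ii weak_double_chain_imp_rcc weak_maximal_imp_double[of G ?P] weak_minimal_imp_double[of G ?P]
    by blast
qed

end
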